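(* Let $SO(n)$ be endowed with a Riemannian metric $\langle\cdot,\cdot\rangle$, with Levi-Civita connection $\nabla$ and curvature tensor $\mathcal{R}$, and let $\mathcal{M}$ be the space of smooth curves $[0,1]\to SO(n)$ with non-vanishing velocity. Represent each curve by its starting point together with its square root velocity function, parallel transported to the starting point, and equip $\mathcal{M}$ with the Riemannian metric described in the context. Let $[0,1]\ni s\mapsto (c(s,0),q(s,\cdot))$ be a smooth path of curves in $\mathcal{M}$ in this representation, where $t\in[0,1]$ is the parameter of the curve $c(s,\cdot)$, so that $q(s,t)\in T_{c(s,0)}SO(n)$. Then this path is a geodesic on $\mathcal{M}$ if and only if $$\nabla_{\partial c/\partial s}\,\frac{\partial c}{\partial s}(s,0)+\int_0^1 \mathcal{R}\bigl(q(s,t),\nabla_{\partial c/\partial s}q(s,t)\bigr)\Bigl(\frac{\partial c}{\partial s}(s,0)\Bigr)\,dt=0\qquad\text{for all } s\in[0,1],$$ $$\nabla_{\partial c/\partial s}\bigl(\nabla_{\partial c/\partial s}q(s,t)\bigr)=0\qquad\text{for all } s,t\in[0,1].$$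
   Context: $\mathcal{M}=\{c\in C^\infty([0,1],SO(n)) : c'(t)\neq 0\ \text{for all } t\}$. Representation of curves: a curve $c\in\mathcal{M}$ is represented by the pair $(c(0),q)$, where $q(t)\in T_{c(0)}SO(n)$ is the parallel transport along $c$, from $c(t)$ to $c(0)$, of the vector $c'(t)/\sqrt{\|c'(t)\|}$, and $\|\cdot\|$ is the norm of $\langle\cdot,\cdot\rangle$. Thus $q$ is a nowhere vanishing smooth curve in the vector space $T_{c(0)}SO(n)$. The curve $c$ is determined by $(c(0),q)$. The starting points are not assumed to be fixed or translated to the identity. Path of curves: a smooth path of curves is a smooth map $(s,t)\mapsto c(s,t)$ such that $c(s,\cdot)\in\mathcal{M}$ for each $s\in[0,1]$. It is represented by the pairs $(c(s,0),q(s,\cdot))$. For each fixed $t$, $s\mapsto q(s,t)$ is a vector field along the curve of starting points $s\mapsto c(s,0)$, and $\nabla_{\partial c/\partial s}$ denotes covariant differentiation with respect to $s$ along $s\mapsto c(s,0)$. Metric and geodesics: in the representation $(c(0),q)$, the squared norm of the velocity of a path at parameter $s$ is $$\Bigl\|\frac{\partial c}{\partial s}(s,0)\Bigr\|^2+\int_0^1\bigl\|\nabla_{\partial c/\partial s}q(s,t)\bigr\|^2dt .$$ A path is a geodesic on $\mathcal{M}$ if it is a critical point of the energy $$E=\frac12\int_0^1\Bigl(\Bigl\|\frac{\partial c}{\partial s}(s,0)\Bigr\|^2+\int_0^1\bigl\|\nabla_{\partial c/\partial s}q(s,t)\bigr\|^2dt\Bigr)ds$$ among smooth variations $(c(s,0,\tau),q(s,t,\tau))$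 with the same end points, i.e. with the pairs at $s=0$ and $s=1$ fixed. Curvature convention: $\mathcal{R}(X,Y)Z=\nabla_X\nabla_YZ-\nabla_Y\nabla_XZ-\nabla_{[X,Y]}Z$. *)

theory Defs
  imports "HOL-Analysis.Analysis"
begin

section \<open>Smooth maps\<close>

primrec Ck_on :: "nat \<Rightarrow> ('a::euclidean_space \<Rightarrow> 'b::real_normed_vector) \<Rightarrow> 'a set \<Rightarrow> bool" where
  "Ck_on 0 f U \<longleftrightarrow> continuous_on U f"
| "Ck_on (Suc k) f U \<longleftrightarrow>
     (\<exists>f'. (\<forall>x\<in>U. (f has_derivative f' x) (at x)) \<and> (\<forall>v. Ck_on k (\<lambda>x. f' x v) U))"

text \<open>Smoothness on a set that need not be open (the interval, the square, a closed submanifold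
  of matrix space) means having a smooth extension to an open neighbourhood. Only the values
  on the set itself matter.\<close>

definition smooth_on :: "'a::euclidean_space set \<Rightarrow> ('a \<Rightarrow> 'b::real_normed_vector) \<Rightarrow> bool" where
  "smooth_on S f \<longleftrightarrow>
     (\<exists>U F. open U \<and> S \<subseteq> U \<and> (\<forall>k. Ck_on k F U) \<and> (\<forall>x\<in>S. F x = f x))"

section \<open>The manifold \<open>SO(n)\<close>, embedded in the space of matrices\<close>

type_synonym 'n sqmat = "real ^ 'n ^ 'n"

definition SO :: "('n::finite) sqmat set" where
  "SO = {A. rotation_matrix A}"

definition left_invariant :: "('n::finite) sqmat \<Rightarrow> 'n sqmat \<Rightarrow> 'n sqmat" where
  "left_invariant B A = A ** B"

text \<open>The tangent space at \<open>A\<close> is the left translate of the Lie algebra of skew-symmetric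
  matrices. For \<open>A\<close> in \<open>SO\<close> the left translation back to the Lie algebra
  is \<open>V \<mapsto> transpose A ** V\<close>.\<close>

definition tangent_space :: "('n::finite) sqmat \<Rightarrow> 'n sqmat set" where
  "tangent_space A = {left_invariant B A | B. transpose B = - B}"

definition vector_field :: "(('n::finite) sqmat \<Rightarrow> 'n sqmat) \<Rightarrow> bool" where
  "vector_field X \<longleftrightarrow> smooth_on SO X \<and> (\<forall>A\<in>SO. X A \<in> tangent_space A)"

text \<open>A function on \<open>SO\<close> may have several derivatives within \<open>SO\<close> in the ambient matrix space,
  but they all agree on vectors \<open>u\<close> tangent to \<open>SO\<close> at \<open>A\<close>, which are the only
  ones this is used for.\<close>

definition dir_deriv :: "(('n::finite) sqmat \<Rightarrow> 'b::real_normed_vector) \<Rightarrow> 'n sqmat \<Rightarrow> 'n sqmat \<Rightarrow> 'b" where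
  "dir_deriv f A u = frechet_derivative f (at A within SO) u"

definition lie_bracket ::
  "(('n::finite) sqmat \<Rightarrow> 'n sqmat) \<Rightarrow> ('n sqmat \<Rightarrow> 'n sqmat) \<Rightarrow> 'n sqmat \<Rightarrow> 'n sqmat" where
  "lie_bracket X Y A = dir_deriv Y A (X A) - dir_deriv X A (Y A)"

section \<open>Riemannian metrics, the Levi-Civita connection and curvature\<close>

type_synonym 'n metric_tensor = "'n sqmat \<Rightarrow> 'n sqmat \<Rightarrow> 'n sqmat \<Rightarrow> real"

definition riemannian_metric :: "('n::finite) metric_tensor \<Rightarrow> bool" where
  "riemannian_metric g \<longleftrightarrow>
     (\<forall>A\<in>SO. \<forall>u\<in>tangent_space A. \<forall>v\<in>tangent_space A. \<forall>w\<in>tangent_space A. \<forall>a b.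
        g A (a *\<^sub>R u + b *\<^sub>R v) w = a * g A u w + b * g A v w) \<and>
     (\<forall>A\<in>SO. \<forall>u\<in>tangent_space A. \<forall>v\<in>tangent_space A. g A u v = g A v u) \<and>
     (\<forall>A\<in>SO. \<forall>u\<in>tangent_space A. u \<noteq> 0 \<longrightarrow> g A u u > 0) \<and>
     (\<forall>X Y. vector_field X \<longrightarrow> vector_field Y \<longrightarrow> smooth_on SO (\<lambda>A. g A (X A) (Y A)))"

definition riem_norm :: "('n::finite) metric_tensor \<Rightarrow> 'n sqmat \<Rightarrow> 'n sqmat \<Rightarrow> real" where
  "riem_norm g A v = sqrt (g A v v)"

text \<open>For a vector field \<open>Y\<close> and a tangent vector \<open>u\<close> at \<open>A\<close>, the term \<open>nab Y A u\<close> stands for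
  the covariant derivative of \<open>Y\<close> at \<open>A\<close> in the direction \<open>u\<close>.\<close>

type_synonym 'n connection = "('n sqmat \<Rightarrow> 'n sqmat) \<Rightarrow> 'n sqmat \<Rightarrow> 'n sqmat \<Rightarrow> 'n sqmat"

definition affine_connection :: "('n::finite) connection \<Rightarrow> bool" where
  "affine_connection nab \<longleftrightarrow>
     (\<forall>X Y. vector_field X \<longrightarrow> vector_field Y \<longrightarrow> vector_field (\<lambda>A. nab Y A (X A))) \<and>
     (\<forall>Y. vector_field Y \<longrightarrow> (\<forall>A\<in>SO. \<forall>u\<in>tangent_space A. \<forall>v\<in>tangent_space A. \<forall>a b.
        nab Y A (a *\<^sub>R u + b *\<^sub>R v) = a *\<^sub>R nab Y A u + b *\<^sub>R nab Y A v)) \<and>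
     (\<forall>Y Z. vector_field Y \<longrightarrow> vector_field Z \<longrightarrow> (\<forall>A\<in>SO. \<forall>u\<in>tangent_space A.
        nab (\<lambda>B. Y B + Z B) A u = nab Y A u + nab Z A u)) \<and>
     (\<forall>(f :: 'n sqmat \<Rightarrow> real) Y. smooth_on SO f \<longrightarrow> vector_field Y \<longrightarrow> (\<forall>A\<in>SO. \<forall>u\<in>tangent_space A.
        nab (\<lambda>B. f B *\<^sub>R Y B) A u = f A *\<^sub>R nab Y A u + dir_deriv f A u *\<^sub>R Y A))"

definition torsion_free :: "('n::finite) connection \<Rightarrow> bool" where
  "torsion_free nab \<longleftrightarrow>
     (\<forall>X Y. vector_field X \<longrightarrow> vector_field Y \<longrightarrow>
        (\<forall>A\<in>SO. nab Y A (X A) - nab X A (Y A) = lie_bracket X Y A))"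

definition metric_compatible :: "('n::finite) metric_tensor \<Rightarrow> 'n connection \<Rightarrow> bool" where
  "metric_compatible g nab \<longleftrightarrow>
     (\<forall>Y Z. vector_field Y \<longrightarrow> vector_field Z \<longrightarrow> (\<forall>A\<in>SO. \<forall>u\<in>tangent_space A.
        dir_deriv (\<lambda>B. g B (Y B) (Z B)) A u = g A (nab Y A u) (Z A) + g A (Y A) (nab Z A u)))"

definition levi_civita :: "('n::finite) metric_tensor \<Rightarrow> 'n connection \<Rightarrow> bool" where
  "levi_civita g nab \<longleftrightarrow> affine_connection nab \<and> torsion_free nab \<and> metric_compatible g nab"

definition curvature_op ::
  "('n::finite) connection \<Rightarrow> ('n sqmat \<Rightarrow> 'n sqmat) \<Rightarrow> ('n sqmat \<Rightarrow> 'n sqmat) \<Rightarrow> ('n sqmat \<Rightarrow> 'n sqmat)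
     \<Rightarrow> 'n sqmat \<Rightarrow> 'n sqmat" where
  "curvature_op nab X Y Z A =
     nab (\<lambda>B. nab Z B (Y B)) A (X A) - nab (\<lambda>B. nab Z B (X B)) A (Y A) - nab Z A (lie_bracket X Y A)"

text \<open>The curvature is tensorial, so tangent vectors at \<open>A\<close> may be extended to arbitrary
  vector fields; the left-invariant extensions are used.\<close>

definition curvature :: "('n::finite) connection \<Rightarrow> 'n sqmat \<Rightarrow> 'n sqmat \<Rightarrow> 'n sqmat \<Rightarrow> 'n sqmat \<Rightarrow> 'n sqmat" where
  "curvature nab A x y z =
     curvature_op nab (left_invariant (transpose A ** x)) (left_invariant (transpose A ** y))
       (left_invariant (transpose A ** z)) A"

section \<open>Covariant differentiation along curves and parallel transport\<close>

definition velocity :: "(real \<Rightarrow> 'b::real_normed_vector) \<Rightarrow> real \<Rightarrow> 'b" where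
  "velocity c t = vector_derivative c (at t within {0..1})"

text \<open>A field \<open>V\<close> along \<open>c\<close> is \<open>V t = (\<Sum>i. v i t *\<^sub>R left_invariant (E i) (c t))\<close>, where \<open>E\<close> is a basis
  of the Lie algebra and the \<open>v i t\<close> are the coordinates of \<open>transpose (c t) ** V t\<close>.
  Its covariant derivative is the sum of
  \<open>v' i t *\<^sub>R left_invariant (E i) (c t) + v i t *\<^sub>R nab (left_invariant (E i)) (c t) (velocity c t)\<close>,
  which is written here without the basis.\<close>

definition covariant_deriv ::
  "('n::finite) connection \<Rightarrow> (real \<Rightarrow> 'n sqmat) \<Rightarrow> (real \<Rightarrow> 'n sqmat) \<Rightarrow> real \<Rightarrow> 'n sqmat" where
  "covariant_deriv nab c V t =
     left_invariant (velocity (\<lambda>r. transpose (c r) ** V r) t) (c t)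
     + nab (left_invariant (transpose (c t) ** V t)) (c t) (velocity c t)"

definition parallel_field :: "('n::finite) connection \<Rightarrow> (real \<Rightarrow> 'n sqmat) \<Rightarrow> (real \<Rightarrow> 'n sqmat) \<Rightarrow> bool" where
  "parallel_field nab c V \<longleftrightarrow>
     smooth_on {0..1} V \<and> (\<forall>t\<in>{0..1}. V t \<in> tangent_space (c t) \<and> covariant_deriv nab c V t = 0)"

text \<open>Parallel transport along \<open>c\<close> of the vector \<open>v\<close> from \<open>c a\<close> to \<open>c b\<close>.\<close>

definition parallel_transport ::
  "('n::finite) connection \<Rightarrow> (real \<Rightarrow> 'n sqmat) \<Rightarrow> real \<Rightarrow> real \<Rightarrow> 'n sqmat \<Rightarrow> 'n sqmat" where
  "parallel_transport nab c a b v = (THE w. \<exists>V. parallel_field nab c V \<and> V a = v \<and> V b = w)"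

section \<open>The space of curves and its square root velocity representation\<close>

definition curve_space :: "(real \<Rightarrow> ('n::finite) sqmat) set" where
  "curve_space = {c. smooth_on {0..1} c \<and> (\<forall>t\<in>{0..1}. c t \<in> SO \<and> velocity c t \<noteq> 0)}"

definition srvf ::
  "('n::finite) metric_tensor \<Rightarrow> 'n connection \<Rightarrow> (real \<Rightarrow> 'n sqmat) \<Rightarrow> real \<Rightarrow> 'n sqmat" where
  "srvf g nab c t =
     parallel_transport nab c t 0 ((1 / sqrt (riem_norm g (c t) (velocity c t))) *\<^sub>R velocity c t)"

text \<open>In \<open>c s t\<close> the first argument is the parameter of the path, the second one that of the curve.\<close>

definition path_of_curves :: "(real \<Rightarrow> real \<Rightarrow> ('n::finite) sqmat) \<Rightarrow> bool" where
  "path_of_curves c \<longleftrightarrow>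
     smooth_on ({0..1} \<times> {0..1}) (\<lambda>(s, t). c s t) \<and> (\<forall>s\<in>{0..1}. c s \<in> curve_space)"

definition energy ::
  "('n::finite) metric_tensor \<Rightarrow> 'n connection \<Rightarrow> (real \<Rightarrow> 'n sqmat) \<Rightarrow> (real \<Rightarrow> real \<Rightarrow> 'n sqmat) \<Rightarrow> real" where
  "energy g nab p q =
     1 / 2 * integral {0..1} (\<lambda>s. (riem_norm g (p s) (velocity p s))\<^sup>2
       + integral {0..1} (\<lambda>t. (riem_norm g (p s) (covariant_deriv nab p (\<lambda>r. q r t) s))\<^sup>2))"

text \<open>A pair (starting point, square root velocity function) consists of a point of \<open>SO\<close> and a
  smooth nowhere vanishing curve in the tangent space at that point; variations are
  smooth families \<open>P \<tau> s\<close>, \<open>Q \<tau> s t\<close> of such pairs with the variation parameter \<open>\<tau>\<close> as first argument.\<close>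

definition variation ::
  "(real \<Rightarrow> ('n::finite) sqmat) \<Rightarrow> (real \<Rightarrow> real \<Rightarrow> 'n sqmat) \<Rightarrow> real
     \<Rightarrow> (real \<Rightarrow> real \<Rightarrow> 'n sqmat) \<Rightarrow> (real \<Rightarrow> real \<Rightarrow> real \<Rightarrow> 'n sqmat) \<Rightarrow> bool" where
  "variation p q \<epsilon> P Q \<longleftrightarrow>
     \<epsilon> > 0 \<and>
     smooth_on ({-\<epsilon><..<\<epsilon>} \<times> {0..1}) (\<lambda>(\<tau>, s). P \<tau> s) \<and>
     smooth_on ({-\<epsilon><..<\<epsilon>} \<times> {0..1} \<times> {0..1}) (\<lambda>(\<tau>, s, t). Q \<tau> s t) \<and>
     (\<forall>\<tau>\<in>{-\<epsilon><..<\<epsilon>}. \<forall>s\<in>{0..1}. P \<tau> s \<in> SO) \<and>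
     (\<forall>\<tau>\<in>{-\<epsilon><..<\<epsilon>}. \<forall>s\<in>{0..1}. \<forall>t\<in>{0..1}. Q \<tau> s t \<in> tangent_space (P \<tau> s) \<and> Q \<tau> s t \<noteq> 0) \<and>
     (\<forall>s\<in>{0..1}. P 0 s = p s) \<and>
     (\<forall>s\<in>{0..1}. \<forall>t\<in>{0..1}. Q 0 s t = q s t) \<and>
     (\<forall>\<tau>\<in>{-\<epsilon><..<\<epsilon>}. \<forall>s\<in>{0, 1}. P \<tau> s = p s \<and> (\<forall>t\<in>{0..1}. Q \<tau> s t = q s t))"

definition geodesic ::
  "('n::finite) metric_tensor \<Rightarrow> 'n connection \<Rightarrow> (real \<Rightarrow> 'n sqmat) \<Rightarrow> (real \<Rightarrow> real \<Rightarrow> 'n sqmat) \<Rightarrow> bool" where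
  "geodesic g nab p q \<longleftrightarrow>
     (\<forall>\<epsilon> P Q. variation p q \<epsilon> P Q \<longrightarrow>
        ((\<lambda>\<tau>. energy g nab (P \<tau>) (Q \<tau>)) has_real_derivative 0) (at 0))"

end

theory Submission
  imports Defs
begin

text \<open>
  Left translation trivialises the tangent bundle of \<open>SO(n)\<close>, so that the Levi-Civita connection and the
  metric become fields of bilinear maps on the skew-symmetric matrices, and vector fields along a family
  of curves become smooth maps into a fixed vector space. For a variation of the pair (starting point
  \<open>p\<close>, square root velocity \<open>q\<close>), let \<open>\<eta>\<close> and \<open>\<zeta>\<close> be the covariant derivatives of \<open>p\<close> and \<open>q\<close> in
  the variation parameter. Torsion-freeness and the commutator of covariant derivatives turn the
  derivative of the energy density into a total derivative in \<open>s\<close>, which integrates to \<open>0\<close> because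
  the end points are fixed, minus
  \<open>\<langle>\<eta>, \<nabla>\<^sub>s p' + R(q, \<nabla>\<^sub>s q) p'\<rangle> + \<langle>\<zeta>, \<nabla>\<^sub>s \<nabla>\<^sub>s q\<rangle>\<close>;
  here the pair symmetry of the curvature moves \<open>\<eta>\<close> out of \<open>R(\<eta>, p') q\<close>. This gives the
  sufficiency of the two equations. For the necessity, the variation \<open>q + \<tau> s (1 - s) \<nabla>\<^sub>s \<nabla>\<^sub>s q\<close> forces
  the second equation, and then rotating \<open>p\<close> by the angle \<open>\<tau> s (1 - s) F s\<close> in a coordinate plane, with
  \<open>F\<close> the component of the first equation in that direction, forces the first one. These variations are
  smooth because parallel transport solves a linear differential equation whose
  fundamental solution depends smoothly on the parameter.
\<close>

section \<open>Calculus of smooth maps\<close>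

text \<open>The axioms constrain \<open>nab\<close> only as an operator on global vector fields,
  while the energy involves fields along curves. In the left trivialisation every field is a
  combination of left-invariant ones, so the values of \<open>nab\<close> on these, collected in
  \<open>Gam\<close>, determine everything, and covariant differentiation along a family of curves
  requires no extension of fields. The parameter domains contain boundary points, where derivatives
  are one-sided; smoothness is carried by an extension to an open set, and \<open>pd\<close>
  differentiates within the domain. Since \<open>geodesic\<close> quantifies over smooth variations
  only, the necessity rests on the smoothness of the pair \<open>p\<close>, \<open>q\<close>; this
  is what the parameter-dependent differential equation provides. As
  \<open>parallel_transport\<close> is a definite description, parallel fields must be shown to be
  unique and not only to exist. The second geodesic equation is derived before the first because it
  removes the term with \<zeta>, so that the rotating variation is tested through \<eta> alone. The
  weight s(1 - s) keeps the end points fixed.\<close>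

lemma Ck_on_SucI:
  assumes "\<And>x. x \<in> U \<Longrightarrow> (f has_derivative f' x) (at x)" "\<And>v. Ck_on k (\<lambda>x. f' x v) U"
  shows "Ck_on (Suc k) f U"
  using assms by auto

lemma Ck_on_SucE:
  assumes "Ck_on (Suc k) f U"
  obtains f' where "\<And>x. x \<in> U \<Longrightarrow> (f has_derivative f' x) (at x)" "\<And>v. Ck_on k (\<lambda>x. f' x v) U"
  using assms by auto

lemma Ck_on_cong:
  assumes "open U" "\<And>x. x \<in> U \<Longrightarrow> f x = g x" "Ck_on k f U"
  shows "Ck_on k g U"
proof (cases k)
  case 0
  then show ?thesis using assms by (auto cong: continuous_on_cong)
next
  case (Suc m)
  with assms(3) obtain f' where f': "\<And>x. x \<in> U \<Longrightarrow> (f has_derivative f' x) (at x)"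
    "\<And>v. Ck_on m (\<lambda>x. f' x v) U" by auto
  have "(g has_derivative f' x) (at x)" if "x \<in> U" for x
    by (rule has_derivative_transform_within_open[OF f'(1)[OF that] assms(1) that assms(2)])
  then show ?thesis unfolding Suc by (rule Ck_on_SucI) (auto intro: f'(2))
qed

lemma Ck_on_subset:
  assumes "V \<subseteq> U" "Ck_on k f U"
  shows "Ck_on k f V"
  using assms(2)
proof (induction k arbitrary: f)
  case 0 then show ?case using assms(1) by (auto intro: continuous_on_subset)
next
  case (Suc k)
  then obtain f' where "\<And>x. x \<in> U \<Longrightarrow> (f has_derivative f' x) (at x)"
    "\<And>v. Ck_on k (\<lambda>x. f' x v) U" by auto
  then show ?case using assms(1) Suc.IH by (intro Ck_on_SucI[where f'=f']) auto
qed

lemma Ck_on_SucD: "Ck_on (Suc k) f U \<Longrightarrow> Ck_on k f U"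
proof (induction k arbitrary: f)
  case 0
  then show ?case
    by (auto intro!: continuous_at_imp_continuous_on dest: has_derivative_continuous)
next
  case (Suc k)
  then obtain f' where "\<And>x. x \<in> U \<Longrightarrow> (f has_derivative f' x) (at x)"
    "\<And>v. Ck_on (Suc k) (\<lambda>x. f' x v) U" by auto
  then show ?case using Suc.IH by (intro Ck_on_SucI[where f'=f']) auto
qed

lemma Ck_on_imp_continuous_on: "Ck_on k f U \<Longrightarrow> continuous_on U f"
  by (induction k) (auto simp del: Ck_on.simps(2) dest: Ck_on_SucD)

lemma Ck_on_const: "Ck_on k (\<lambda>x. c) U"
  by (induction k arbitrary: c) (auto intro!: exI[of _ "\<lambda>x v. 0"])

lemma Ck_on_linear: "bounded_linear L \<Longrightarrow> Ck_on k L U"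
proof (cases k)
  case 0 then show "bounded_linear L \<Longrightarrow> ?thesis" by (simp add: linear_continuous_on)
next
  case (Suc m)
  show "bounded_linear L \<Longrightarrow> ?thesis" unfolding Suc
    by (rule Ck_on_SucI[where f'="\<lambda>x. L"]) (auto intro: bounded_linear_imp_has_derivative Ck_on_const)
qed

lemma Ck_on_add: "Ck_on k f U \<Longrightarrow> Ck_on k g U \<Longrightarrow> Ck_on k (\<lambda>x. f x + g x) U"
proof (induction k arbitrary: f g)
  case 0 then show ?case by (auto intro: continuous_intros)
next
  case (Suc k)
  from Suc.prems(1) obtain f' where f': "\<And>x. x \<in> U \<Longrightarrow> (f has_derivative f' x) (at x)"
    "\<And>v. Ck_on k (\<lambda>x. f' x v) U" by (rule Ck_on_SucE) blast
  from Suc.prems(2) obtain g' where g': "\<And>x. x \<in> U \<Longrightarrow> (g has_derivative g' x) (at x)"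
    "\<And>v. Ck_on k (\<lambda>x. g' x v) U" by (rule Ck_on_SucE) blast
  with f' show ?case using Suc.IH
    by (intro Ck_on_SucI[where f'="\<lambda>x v. f' x v + g' x v"]) (auto intro!: has_derivative_add)
qed

lemma Ck_on_sum: "(\<And>i. i \<in> I \<Longrightarrow> Ck_on k (f i) U) \<Longrightarrow> Ck_on k (\<lambda>x. \<Sum>i\<in>I. f i x) U"
  by (induction I rule: infinite_finite_induct) (auto intro: Ck_on_add Ck_on_const)

lemma Ck_on_bilinear:
  assumes "bounded_bilinear pr"
  shows "Ck_on k f U \<Longrightarrow> Ck_on k g U \<Longrightarrow> Ck_on k (\<lambda>x. pr (f x) (g x)) U"
proof (induction k arbitrary: f g)
  case 0 then show ?case by (auto intro: bounded_bilinear.continuous_on[OF assms])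
next
  case (Suc k)
  from Suc.prems(1) obtain f' where f': "\<And>x. x \<in> U \<Longrightarrow> (f has_derivative f' x) (at x)"
    "\<And>v. Ck_on k (\<lambda>x. f' x v) U" by (rule Ck_on_SucE) blast
  from Suc.prems(2) obtain g' where g': "\<And>x. x \<in> U \<Longrightarrow> (g has_derivative g' x) (at x)"
    "\<And>v. Ck_on k (\<lambda>x. g' x v) U" by (rule Ck_on_SucE) blast
  have "Ck_on k f U" "Ck_on k g U" using Suc.prems by (auto dest: Ck_on_SucD simp del: Ck_on.simps)
  with f' g' show ?case using Suc.IH
    by (intro Ck_on_SucI[where f'="\<lambda>x v. pr (f x) (g' x v) + pr (f' x v) (g x)"])
       (auto intro!: bounded_bilinear.FDERIV[OF assms] Ck_on_add)
qed

lemma linear_eq_sum_Basis: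
  fixes L :: "'a::euclidean_space \<Rightarrow> 'b::real_vector"
  assumes "linear L"
  shows "L v = (\<Sum>b\<in>Basis. (v \<bullet> b) *\<^sub>R L b)"
proof -
  have "L v = L (\<Sum>b\<in>Basis. (v \<bullet> b) *\<^sub>R b)" by (simp add: euclidean_representation)
  then show ?thesis by (simp add: linear_sum[OF assms] linear_cmul[OF assms])
qed

text \<open>\<open>Ck_on\<close> controls a derivative along fixed directions only, whereas the
  chain rule produces the moving direction \<open>h' x v\<close>. Expanding it in the standard basis
  leaves fixed directions, with coefficients as regular as \<open>h'\<close>.\<close>

lemma Ck_on_compose:
  fixes h :: "'a::euclidean_space \<Rightarrow> 'c::euclidean_space"
  assumes "h ` V \<subseteq> U"
  shows "Ck_on k f U \<Longrightarrow> Ck_on k h V \<Longrightarrow> Ck_on k (\<lambda>x. f (h x)) V"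
proof (induction k arbitrary: f)
  case 0 then show ?case using assms by (auto intro: continuous_on_compose2)
next
  case (Suc k)
  from Suc.prems(1) obtain f' where f': "\<And>x. x \<in> U \<Longrightarrow> (f has_derivative f' x) (at x)"
    "\<And>v. Ck_on k (\<lambda>x. f' x v) U" by (rule Ck_on_SucE) blast
  from Suc.prems(2) obtain h' where h': "\<And>x. x \<in> V \<Longrightarrow> (h has_derivative h' x) (at x)"
    "\<And>v. Ck_on k (\<lambda>x. h' x v) V" by (rule Ck_on_SucE) blast
  have hk: "Ck_on k h V" using Suc.prems by (auto dest: Ck_on_SucD simp del: Ck_on.simps)
  show ?case
  proof (rule Ck_on_SucI[where f'="\<lambda>x v. \<Sum>b\<in>Basis. (h' x v \<bullet> b) *\<^sub>R f' (h x) b"])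
    fix x assume x: "x \<in> V"
    then have f1: "(f has_derivative f' (h x)) (at (h x))" using f' assms by auto
    have "linear (f' (h x))" using f1 has_derivative_linear by blast
    then have "(\<lambda>v. \<Sum>b\<in>Basis. (h' x v \<bullet> b) *\<^sub>R f' (h x) b) = (\<lambda>v. f' (h x) (h' x v))"
      by (subst linear_eq_sum_Basis) auto
    then show "((\<lambda>x. f (h x)) has_derivative (\<lambda>v. \<Sum>b\<in>Basis. (h' x v \<bullet> b) *\<^sub>R f' (h x) b)) (at x)"
      using has_derivative_compose[OF h'(1)[OF x] f1] by simp
  next
    fix v
    show "Ck_on k (\<lambda>x. \<Sum>b\<in>Basis. (h' x v \<bullet> b) *\<^sub>R f' (h x) b) V"
      by (intro Ck_on_sum Ck_on_bilinear[OF bounded_bilinear_scaleR] Suc.IH f' h' hk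
          Ck_on_bilinear[OF bounded_bilinear_inner] Ck_on_const)
  qed
qed

text \<open>The derivative hidden behind the existential quantifier of \<open>Ck_on\<close> is
  unique, so \<open>frechet_derivative\<close> names it. This gives a concrete function that can be
  differentiated again.\<close>

lemma Ck_on_frechet:
  assumes "open U" "Ck_on (Suc k) f U"
  shows "x \<in> U \<Longrightarrow> (f has_derivative frechet_derivative f (at x)) (at x)"
    "Ck_on k (\<lambda>x. frechet_derivative f (at x) v) U"
proof -
  obtain f' where f': "\<And>x. x \<in> U \<Longrightarrow> (f has_derivative f' x) (at x)"
    "\<And>v. Ck_on k (\<lambda>x. f' x v) U" using assms by auto
  show "(f has_derivative frechet_derivative f (at x)) (at x)" if "x \<in> U"
    using f'(1)[OF that] frechet_derivative_at by metis
  have "\<And>x. x \<in> U \<Longrightarrow> f' x v = frechet_derivative f (at x) v"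
    using f'(1) frechet_derivative_at by metis
  then show "Ck_on k (\<lambda>x. frechet_derivative f (at x) v) U"
    by (rule Ck_on_cong[OF assms(1) _ f'(2)[of v]])
qed

subsection \<open>Integrals depending on a parameter\<close>

lemma Ck_on_pair_cont:
  assumes "continuous_on V (\<lambda>z. f z)" "U \<times> {0..1} \<subseteq> V" "x \<in> U"
  shows "continuous_on {0..1} (\<lambda>\<theta>. f (x, \<theta>))"
  by (rule continuous_on_compose2[OF assms(1)]) (use assms in \<open>auto intro!: continuous_intros\<close>)

text \<open>Differentiation under the integral sign by \<open>leibniz_rule\<close>, which asks for
  the partial derivative as a jointly continuous map into bounded linear maps. In finite dimension
  this continuity can be checked one direction at a time.\<close>

lemma has_derivative_integral01:
  fixes f :: "'a::euclidean_space \<times> real \<Rightarrow> 'b::banach"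
  assumes "open V" "open U" "U \<times> {0..1} \<subseteq> V" "Ck_on (Suc 0) f V" "x \<in> U"
  shows "((\<lambda>x. integral {0..1} (\<lambda>\<theta>. f (x, \<theta>))) has_derivative
     (\<lambda>v. integral {0..1} (\<lambda>\<theta>. frechet_derivative f (at (x, \<theta>)) (v, 0)))) (at x)"
proof -
  let ?D = "\<lambda>x \<theta>. Blinfun (\<lambda>v. frechet_derivative f (at (x, \<theta>)) (v, 0))"
  obtain e where e: "e > 0" "ball x e \<subseteq> U" using assms(2,5) openE by blast
  have der: "((\<lambda>x. f (x, \<theta>)) has_derivative (\<lambda>v. frechet_derivative f (at (y, \<theta>)) (v, 0))) (at y within ball x e)"
    if "y \<in> ball x e" "\<theta> \<in> cbox 0 1" for y \<theta>
  proof -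
    have "(f has_derivative frechet_derivative f (at (y, \<theta>))) (at (y, \<theta>))"
    proof (rule Ck_on_frechet(1)[OF assms(1,4)])
      have "y \<in> U" using that e by blast
      then show "(y, \<theta>) \<in> V" using that assms(3) by auto
    qed
    then have "((\<lambda>x. f (x, \<theta>)) has_derivative (\<lambda>v. frechet_derivative f (at (y, \<theta>)) (v, 0))) (at y)"
      by (rule has_derivative_compose[rotated]) (auto intro!: derivative_eq_intros)
    then show ?thesis by (rule has_derivative_at_withinI)
  qed
  have app: "blinfun_apply (?D y \<theta>) = (\<lambda>v. frechet_derivative f (at (y, \<theta>)) (v, 0))"
    if "y \<in> ball x e" "\<theta> \<in> cbox 0 1" for y \<theta>
    using der[OF that] has_derivative_bounded_linear bounded_linear_Blinfun_apply by blast
  have contv: "continuous_on (ball x e \<times> cbox 0 1) (\<lambda>z. frechet_derivative f (at z) (v, 0))" for v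
    using Ck_on_frechet(2)[OF assms(1,4), of "(v, 0)"] e(2) assms(3)
    by (auto elim!: continuous_on_subset)
  have contD: "continuous_on (ball x e \<times> cbox 0 1) (\<lambda>(y, \<theta>). ?D y \<theta>)"
    unfolding continuous_on_eq_continuous_within
  proof
    fix z assume z: "z \<in> ball x e \<times> cbox (0::real) 1"
    show "continuous (at z within ball x e \<times> cbox 0 1) (\<lambda>(y, \<theta>). ?D y \<theta>)"
    proof (rule continuous_blinfun_componentwiseI1)
      fix i :: 'a
      have "continuous_on (ball x e \<times> cbox 0 1) (\<lambda>z. (case z of (y, \<theta>) \<Rightarrow> ?D y \<theta>) i)"
        by (rule continuous_on_eq[OF contv[of i]]) (use app in auto)
      then show "continuous (at z within ball x e \<times> cbox 0 1) (\<lambda>z. (case z of (y, \<theta>) \<Rightarrow> ?D y \<theta>) i)"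
        using z continuous_on_eq_continuous_within by blast
    qed
  qed
  from contD have L: "((\<lambda>x. integral (cbox 0 1) (\<lambda>\<theta>. f (x, \<theta>))) has_derivative integral (cbox 0 1) (?D x)) (at x within ball x e)"
  proof (intro leibniz_rule)
    fix y and \<theta> :: real assume "y \<in> ball x e" "\<theta> \<in> cbox 0 1"
    then show "((\<lambda>x. f (x, \<theta>)) has_derivative blinfun_apply (?D y \<theta>)) (at y within ball x e)"
      using der app by simp
  next
    fix y assume y: "y \<in> ball x e"
    have "continuous_on {0..1} (\<lambda>\<theta>. f (y, \<theta>))"
      by (rule Ck_on_pair_cont[OF Ck_on_imp_continuous_on[OF assms(4)] assms(3)]) (use y e in auto)
    then show "(\<lambda>\<theta>. f (y, \<theta>)) integrable_on cbox 0 1" by (simp add: integrable_continuous_real)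
  qed (use e in auto)
  have xe: "x \<in> ball x e" using e by auto
  have "continuous_on {0..1} (?D x)"
    using continuous_on_compose2[OF contD, of "{0..1}" "\<lambda>t. (x, t)"] xe
    by (auto simp: image_subset_iff continuous_on_Pair continuous_on_const continuous_on_id)
  then have "?D x integrable_on {0..1}" by (rule integrable_continuous_real)
  then have "blinfun_apply (integral {0..1} (?D x)) v = integral {0..1} (\<lambda>\<theta>. ?D x \<theta> v)" for v
    by (rule integral_linear[OF _ bounded_bilinear.bounded_linear_left[OF bounded_bilinear_blinfun_apply],
        unfolded o_def, symmetric])
  moreover have "integral {0..1} (\<lambda>\<theta>. ?D x \<theta> v) = integral {0..1} (\<lambda>\<theta>. frechet_derivative f (at (x, \<theta>)) (v, 0))" for v
    by (rule integral_cong) (use app xe in auto)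
  ultimately have ap: "blinfun_apply (integral {0..1} (?D x)) =
      (\<lambda>v. integral {0..1} (\<lambda>\<theta>. frechet_derivative f (at (x, \<theta>)) (v, 0)))"
    by (intro ext) (simp only:)
  have "((\<lambda>x. integral {0..1} (\<lambda>\<theta>. f (x, \<theta>))) has_derivative blinfun_apply (integral {0..1} (?D x))) (at x within ball x e)"
    by (rule L[unfolded cbox_interval])
  then show ?thesis unfolding ap at_within_open[OF xe open_ball] .
qed

text \<open>The derivative in direction \<open>v\<close> is again an integral of this kind, with the
  derivative of \<open>f\<close> along \<open>(v, 0)\<close> as integrand; hence the induction over
  \<open>k\<close> with \<open>f\<close> generalised.\<close>

lemma Ck_on_integral01:
  fixes f :: "'a::euclidean_space \<times> real \<Rightarrow> 'b::banach"
  assumes "open V" "open U" "U \<times> {0..1} \<subseteq> V"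
  shows "Ck_on k f V \<Longrightarrow> Ck_on k (\<lambda>x. integral {0..1} (\<lambda>\<theta>. f (x, \<theta>))) U"
proof (induction k arbitrary: f)
  case 0
  have "continuous_on (U \<times> cbox 0 1) (\<lambda>(x, t). f (x, t))"
    using 0 assms(3) by (auto elim!: continuous_on_subset)
  then show ?case using integral_continuous_on_param[of U 0 1 "\<lambda>x t. f (x, t)"] by simp
next
  case (Suc k)
  have "Ck_on (Suc 0) f V" using Suc.prems by (induction k) (auto dest: Ck_on_SucD simp del: Ck_on.simps)
  then show ?case
    by (intro Ck_on_SucI[OF has_derivative_integral01[OF assms]] Suc.IH Ck_on_frechet(2)[OF assms(1) Suc.prems])
qed

section \<open>Symmetry of second derivatives\<close>

lemma open_Collect_mem:
  assumes "open U" "continuous_on UNIV h"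
  shows "open {y. h y \<in> U}"
  using open_vimage[OF assms] by (simp add: vimage_def)

lemma has_vector_derivative_at_0I:
  assumes "((\<lambda>h. (1/h) *\<^sub>R (f h - f 0)) \<longlongrightarrow> D) (at 0)"
  shows "(f has_vector_derivative D) (at 0)"
proof -
  have "((\<lambda>h. norm ((1/h) *\<^sub>R (f h - f 0) - D)) \<longlongrightarrow> 0) (at 0)"
    using assms by (simp add: LIM_zero_iff tendsto_norm_zero_iff)
  moreover have "\<forall>\<^sub>F h in at 0. norm ((1/h) *\<^sub>R (f h - f 0) - D) = norm (f h - f 0 - h *\<^sub>R D) / norm h"
    unfolding eventually_at_filter
  proof (intro always_eventually allI impI)
    fix h :: real assume "h \<noteq> 0"
    then have "(1/h) *\<^sub>R (f h - f 0) - D = (1/h) *\<^sub>R (f h - f 0 - h *\<^sub>R D)"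
      by (simp add: algebra_simps)
    then show "norm ((1/h) *\<^sub>R (f h - f 0) - D) = norm (f h - f 0 - h *\<^sub>R D) / norm h"
      by (simp add: divide_simps)
  qed
  ultimately have "((\<lambda>h. norm (f h - f 0 - h *\<^sub>R D) / norm h) \<longlongrightarrow> 0) (at 0)"
    by (rule Lim_transform_eventually)
  then show ?thesis
    by (simp add: has_vector_derivative_def has_derivative_at bounded_linear_scaleR_left)
qed

text \<open>The increment of \<open>f\<close> along \<open>b *\<^sub>R v\<close> is \<open>b\<close>
  times the mean over the segment of the derivative along \<open>v\<close>. Differentiating this
  identity along \<open>u\<close> under the integral sign, dividing by \<open>b\<close> and letting
  \<open>b\<close> tend to 0 exchanges the two derivatives; continuity of the second derivatives
  gives the limit.\<close>

lemma frechet_derivative_commute: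
  fixes f :: "'a::euclidean_space \<Rightarrow> 'b::banach"
  assumes "open U" "Ck_on (Suc (Suc 0)) f U" "x \<in> U"
  shows "frechet_derivative (\<lambda>y. frechet_derivative f (at y) u) (at x) v =
         frechet_derivative (\<lambda>y. frechet_derivative f (at y) v) (at x) u"
proof -
  let ?D = "\<lambda>v y. frechet_derivative f (at y) v"
  have f1: "Ck_on (Suc 0) f U" using Ck_on_SucD[OF assms(2)] .
  have fd: "(f has_derivative frechet_derivative f (at y)) (at y)" if "y \<in> U" for y
    using Ck_on_frechet(1)[OF assms(1) assms(2) that] .
  have D1: "Ck_on (Suc 0) (?D w) U" for w using Ck_on_frechet(2)[OF assms(1) assms(2)] .
  have Dd: "(?D w has_derivative frechet_derivative (?D w) (at y)) (at y)" if "y \<in> U" for y w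
    using Ck_on_frechet(1)[OF assms(1) D1 that] .
  obtain e0 where e0: "e0 > 0" "ball x e0 \<subseteq> U" using assms(1,3) openE by blast
  \<comment> \<open>For \<bar>b\<bar> < \<open>e\<close> the point \<open>x + b *\<^sub>R v\<close>
    stays in the ball around \<open>x\<close>; the summand 1 covers the case
    \<open>v = 0\<close>.\<close>
  define e where "e = e0 / (norm v + 1)"
  have vp: "norm v + 1 > 0" by (smt (verit) norm_ge_zero)
  have e: "e > 0" using e0 vp by (simp add: e_def)
  have inU: "x + b *\<^sub>R v \<in> U" if "\<bar>b\<bar> < e" for b
  proof -
    have "norm (b *\<^sub>R v) \<le> \<bar>b\<bar> * (norm v + 1)" by (simp add: mult_left_mono)
    also have "\<dots> < e0" using that vp by (simp add: e_def pos_less_divide_eq)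
    finally show ?thesis using e0 by (auto simp: dist_norm)
  qed
  have key: "?D u (x + b *\<^sub>R v) - ?D u x = b *\<^sub>R integral {0..1} (\<lambda>\<theta>. frechet_derivative (?D v) (at (x + (\<theta> * b) *\<^sub>R v)) u)"
    if b: "\<bar>b\<bar> < e" for b
  proof -
    have seg: "x + (\<theta> * b) *\<^sub>R v \<in> U" if "\<theta> \<in> {0..1}" for \<theta>
    proof -
      have "\<bar>\<theta> * b\<bar> \<le> \<bar>b\<bar>" using that by (auto simp: abs_mult mult_left_le_one_le)
      then show ?thesis using inU b by (meson le_less_trans)
    qed
    \<comment> \<open>The tube lemma applied to this open set yields one neighbourhood of
      \<open>x\<close> from which all segments in direction \<open>b *\<^sub>R v\<close> stay in
      \<open>U\<close>, so the integral can be differentiated there.\<close>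
    define V where "V = {z::'a\<times>real. fst z + (snd z * b) *\<^sub>R v \<in> U}"
    have oV: "open V" unfolding V_def
      by (rule open_Collect_mem[OF assms(1)]) (auto intro!: continuous_intros) 
    have "{x} \<times> {0..1} \<subseteq> V" using seg by (auto simp: V_def)
    from Elementary_Topology.tube_lemma[OF compact_Icc oV this]
    obtain X0 where X0: "x \<in> X0" "open X0" "X0 \<times> {0..1} \<subseteq> V" by blast
    let ?h = "\<lambda>z::'a\<times>real. ?D v (fst z + (snd z * b) *\<^sub>R v)"
    have Ch: "Ck_on (Suc 0) ?h V"
    proof (rule Ck_on_compose[where U=U])
      show "(\<lambda>z::'a\<times>real. fst z + (snd z * b) *\<^sub>R v) ` V \<subseteq> U" by (auto simp: V_def)
      show "Ck_on (Suc 0) (?D v) U" by (rule D1)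
      have "bounded_linear (\<lambda>z::'a\<times>real. fst z + (snd z * b) *\<^sub>R v)"
        by (intro bounded_linear_add bounded_linear_fst bounded_linear_scaleR_const bounded_linear_mult_const bounded_linear_snd)
      then show "Ck_on (Suc 0) (\<lambda>z::'a\<times>real. fst z + (snd z * b) *\<^sub>R v) V" by (rule Ck_on_linear)
    qed
    let ?X = "X0 \<inter> {y. y + b *\<^sub>R v \<in> U} \<inter> U"
    have oX: "open ?X" using X0 assms(1)
      by (intro open_Int open_Collect_mem[OF assms(1)]) (auto intro!: continuous_intros)
    have xX: "x \<in> ?X" using X0 inU[OF b] assms(3) by auto
    have FTC: "f (y + b *\<^sub>R v) - f y = b *\<^sub>R integral {0..1} (\<lambda>\<theta>. ?h (y, \<theta>))" if y: "y \<in> ?X" for y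
    proof -
      have "((\<lambda>\<theta>. f (y + (\<theta> * b) *\<^sub>R v)) has_vector_derivative b *\<^sub>R ?h (y, \<theta>)) (at \<theta> within {0..1})"
        if "\<theta> \<in> {0..1}" for \<theta>
      proof -
        have "(y, \<theta>) \<in> V" using y X0(3) that by auto
        then have yU: "y + (\<theta> * b) *\<^sub>R v \<in> U" by (simp add: V_def)
        have "((\<lambda>\<theta>. f (y + (\<theta> * b) *\<^sub>R v)) has_derivative (\<lambda>h. frechet_derivative f (at (y + (\<theta> * b) *\<^sub>R v)) ((h * b) *\<^sub>R v))) (at \<theta>)"
          by (rule has_derivative_compose[where g=f and f="\<lambda>\<theta>. y + (\<theta> * b) *\<^sub>R v" and x=\<theta>, OF _ fd[OF yU]]) (auto intro!: derivative_eq_intros)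
        then show ?thesis
          using linear_cmul[OF has_derivative_linear[OF fd[OF yU]]]
          by (auto simp: has_vector_derivative_def has_derivative_at_withinI)
      qed
      from fundamental_theorem_of_calculus[OF _ this]
      have "((\<lambda>\<theta>. b *\<^sub>R ?h (y, \<theta>)) has_integral f (y + b *\<^sub>R v) - f y) {0..1}" by simp
      from integral_unique[OF this] show ?thesis by (simp only: integral_cmul)
    qed
    \<comment> \<open>The increment is differentiated twice: directly, and through
      \<open>FTC\<close> under the integral sign. Uniqueness of the derivative equates the
      results.\<close>
    have h1: "((\<lambda>y. f (y + b *\<^sub>R v) - f y) has_derivative (\<lambda>w. ?D w (x + b *\<^sub>R v) - ?D w x)) (at x)"
      by (intro has_derivative_diff fd assms(3) has_derivative_compose[where g=f and f="\<lambda>y. y + b *\<^sub>R v" and x=x, OF _ fd[OF inU[OF b]]])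
         (auto intro!: derivative_eq_intros)
    have h2: "((\<lambda>y. b *\<^sub>R integral {0..1} (\<lambda>\<theta>. ?h (y, \<theta>))) has_derivative
        (\<lambda>w. b *\<^sub>R integral {0..1} (\<lambda>\<theta>. frechet_derivative ?h (at (x, \<theta>)) (w, 0)))) (at x)"
      by (intro has_derivative_scaleR_right has_derivative_integral01[OF oV X0(2,3) Ch X0(1)])
    have "((\<lambda>y. f (y + b *\<^sub>R v) - f y) has_derivative
        (\<lambda>w. b *\<^sub>R integral {0..1} (\<lambda>\<theta>. frechet_derivative ?h (at (x, \<theta>)) (w, 0)))) (at x)"
      by (rule has_derivative_transform_within_open[OF h2 oX xX]) (use FTC in simp)
    from has_derivative_unique[OF h1 this]
    have "?D u (x + b *\<^sub>R v) - ?D u x = b *\<^sub>R integral {0..1} (\<lambda>\<theta>. frechet_derivative ?h (at (x, \<theta>)) (u, 0))"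
      by (rule fun_cong)
    also have "integral {0..1} (\<lambda>\<theta>. frechet_derivative ?h (at (x, \<theta>)) (u, 0)) =
       integral {0..1} (\<lambda>\<theta>. frechet_derivative (?D v) (at (x + (\<theta> * b) *\<^sub>R v)) u)"
    proof (rule integral_cong)
      fix \<theta> :: real assume t: "\<theta> \<in> {0..1}"
      have "(?h has_derivative (\<lambda>z. frechet_derivative (?D v) (at (x + (\<theta> * b) *\<^sub>R v)) (fst z + (snd z * b) *\<^sub>R v))) (at (x, \<theta>))"
      proof (rule has_derivative_compose[where g="?D v" and f="\<lambda>z. fst z + (snd z * b) *\<^sub>R v" and x="(x, \<theta>)"])
        have "bounded_linear (\<lambda>z::'a\<times>real. fst z + (snd z * b) *\<^sub>R v)"
          by (intro bounded_linear_add bounded_linear_fst bounded_linear_scaleR_const bounded_linear_mult_const bounded_linear_snd)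
        then show "((\<lambda>z::'a\<times>real. fst z + (snd z * b) *\<^sub>R v) has_derivative (\<lambda>z. fst z + (snd z * b) *\<^sub>R v)) (at (x, \<theta>))"
          by (rule bounded_linear_imp_has_derivative)
      qed (use Dd[OF seg[OF t]] in simp)
      then have "frechet_derivative ?h (at (x, \<theta>)) = (\<lambda>z. frechet_derivative (?D v) (at (x + (\<theta> * b) *\<^sub>R v)) (fst z + (snd z * b) *\<^sub>R v))"
        by (rule frechet_derivative_at[symmetric])
      then show "frechet_derivative ?h (at (x, \<theta>)) (u, 0) = frechet_derivative (?D v) (at (x + (\<theta> * b) *\<^sub>R v)) u"
        by simp
    qed
    finally show ?thesis .
  qed
  let ?g = "\<lambda>b. integral {0..1} (\<lambda>\<theta>. frechet_derivative (?D v) (at (x + (\<theta> * b) *\<^sub>R v)) u)"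
  have cg: "continuous_on {-e<..<e} ?g"
  proof -
    have "continuous_on ({-e<..<e} \<times> cbox 0 1) (\<lambda>(b, \<theta>). frechet_derivative (?D v) (at (x + (\<theta> * b) *\<^sub>R v)) u)"
      unfolding split_beta
    proof (rule continuous_on_compose2[of U "\<lambda>y. frechet_derivative (?D v) (at y) u"])
      show "continuous_on U (\<lambda>y. frechet_derivative (?D v) (at y) u)"
        using Ck_on_frechet(2)[OF assms(1) D1[of v], of u] by simp
      show "(\<lambda>z. x + (snd z * fst z) *\<^sub>R v) ` ({- e<..<e} \<times> cbox 0 1) \<subseteq> U"
      proof clarsimp
        fix b \<theta> :: real assume *: "-e < b" "b < e" "0 \<le> \<theta>" "\<theta> \<le> 1"
        then have "\<bar>\<theta> * b\<bar> \<le> \<bar>b\<bar>" by (auto simp: abs_mult mult_left_le_one_le)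
        also have "\<bar>b\<bar> < e" using * by auto
        finally show "x + (\<theta> * b) *\<^sub>R v \<in> U" by (rule inU)
      qed
    qed (auto intro!: continuous_intros)
    then show ?thesis using integral_continuous_on_param[of "{-e<..<e}" 0 1 "\<lambda>b \<theta>. frechet_derivative (?D v) (at (x + (\<theta> * b) *\<^sub>R v)) u"] by simp
  qed
  have g0: "?g 0 = frechet_derivative (?D v) (at x) u" by simp
  have "isCont ?g 0" using cg e by (simp add: continuous_on_eq_continuous_at)
  then have gl: "(?g \<longlongrightarrow> ?g 0) (at 0)" by (simp add: isCont_def)
  have "((\<lambda>b. (1/b) *\<^sub>R (?D u (x + b *\<^sub>R v) - ?D u x)) \<longlongrightarrow> ?g 0) (at 0)"
  proof (rule Lim_transform_eventually[OF gl])
    have "\<forall>\<^sub>F b in at 0. \<bar>b\<bar> < e \<and> b \<noteq> 0" using e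
      by (auto simp: eventually_at dist_real_def intro!: exI[of _ e])
    then show "\<forall>\<^sub>F b in at 0. ?g b = (1/b) *\<^sub>R (?D u (x + b *\<^sub>R v) - ?D u x)"
      by eventually_elim (simp add: key)
  qed
  then have "((\<lambda>b. ?D u (x + b *\<^sub>R v)) has_vector_derivative ?g 0) (at 0)"
    by (intro has_vector_derivative_at_0I) simp
  moreover have "((\<lambda>b. ?D u (x + b *\<^sub>R v)) has_vector_derivative frechet_derivative (?D u) (at x) v) (at 0)"
  proof -
    have "((\<lambda>b. ?D u (x + b *\<^sub>R v)) has_derivative (\<lambda>h. frechet_derivative (?D u) (at x) (h *\<^sub>R v))) (at 0)"
      by (rule has_derivative_compose[where g="?D u" and f="\<lambda>b. x + b *\<^sub>R v" and x=0]) (use Dd[OF assms(3)] in \<open>auto intro!: derivative_eq_intros\<close>)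
    then show ?thesis
      using linear_cmul[OF has_derivative_linear[OF Dd[OF assms(3)]]]
      by (auto simp: has_vector_derivative_def)
  qed
  ultimately have "frechet_derivative (?D u) (at x) v = ?g 0" by (rule vector_derivative_unique_at[rotated])
  then show ?thesis using g0 by simp
qed

declare Ck_on.simps(2) [simp del]

subsection \<open>Smooth maps on sets that need not be open\<close>

lemma smooth_onE:
  assumes "smooth_on S f"
  obtains U F where "open U" "S \<subseteq> U" "\<And>k. Ck_on k F U" "\<And>x. x \<in> S \<Longrightarrow> F x = f x"
  using assms unfolding smooth_on_def by blast

lemma smooth_onI:
  assumes "open U" "S \<subseteq> U" "\<And>k. Ck_on k F U" "\<And>x. x \<in> S \<Longrightarrow> F x = f x"
  shows "smooth_on S f"
  using assms unfolding smooth_on_def by blast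

lemma smooth_on_cong: "smooth_on S f \<Longrightarrow> (\<And>x. x \<in> S \<Longrightarrow> f x = g x) \<Longrightarrow> smooth_on S g"
  unfolding smooth_on_def by metis

lemma smooth_on_const: "smooth_on S (\<lambda>x. c)"
  by (rule smooth_onI[OF open_UNIV _ Ck_on_const]) auto

lemma smooth_on_linear: "bounded_linear L \<Longrightarrow> smooth_on S L"
  by (rule smooth_onI[OF open_UNIV _ Ck_on_linear]) auto

lemma smooth_on_ident: "smooth_on S (\<lambda>x. x)"
  by (rule smooth_on_linear[OF bounded_linear_ident])

lemma smooth_on_bilinear:
  assumes "bounded_bilinear pr" "smooth_on S f" "smooth_on S g"
  shows "smooth_on S (\<lambda>x. pr (f x) (g x))"
proof -
  obtain U F where F: "open U" "S \<subseteq> U" "\<And>k. Ck_on k F U" "\<And>x. x \<in> S \<Longrightarrow> F x = f x"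
    using assms(2) by (rule smooth_onE) blast
  obtain V G where G: "open V" "S \<subseteq> V" "\<And>k. Ck_on k G V" "\<And>x. x \<in> S \<Longrightarrow> G x = g x"
    using assms(3) by (rule smooth_onE) blast
  show ?thesis
  proof (rule smooth_onI[of "U \<inter> V"])
    show "Ck_on k (\<lambda>x. pr (F x) (G x)) (U \<inter> V)" for k
      by (rule Ck_on_bilinear[OF assms(1)]) (rule Ck_on_subset[OF _ F(3)] Ck_on_subset[OF _ G(3)], blast)+
  qed (use F(1,2,4) G(1,2,4) in auto)
qed

lemma smooth_on_add:
  assumes "smooth_on S f" "smooth_on S g"
  shows "smooth_on S (\<lambda>x. f x + g x)"
proof -
  obtain U F where F: "open U" "S \<subseteq> U" "\<And>k. Ck_on k F U" "\<And>x. x \<in> S \<Longrightarrow> F x = f x"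
    using assms(1) by (rule smooth_onE) blast
  obtain V G where G: "open V" "S \<subseteq> V" "\<And>k. Ck_on k G V" "\<And>x. x \<in> S \<Longrightarrow> G x = g x"
    using assms(2) by (rule smooth_onE) blast
  show ?thesis
  proof (rule smooth_onI[of "U \<inter> V"])
    show "Ck_on k (\<lambda>x. F x + G x) (U \<inter> V)" for k
      by (rule Ck_on_add) (rule Ck_on_subset[OF _ F(3)] Ck_on_subset[OF _ G(3)], blast)+
  qed (use F(1,2,4) G(1,2,4) in auto)
qed

lemma smooth_on_sum: "(\<And>i. i \<in> I \<Longrightarrow> smooth_on S (f i)) \<Longrightarrow> smooth_on S (\<lambda>x. \<Sum>i\<in>I. f i x)"
  by (induction I rule: infinite_finite_induct) (auto intro: smooth_on_add smooth_on_const)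

lemma smooth_on_compose:
  fixes h :: "'a::euclidean_space \<Rightarrow> 'c::euclidean_space"
  assumes "smooth_on T f" "smooth_on S h" "\<And>x. x \<in> S \<Longrightarrow> h x \<in> T"
  shows "smooth_on S (\<lambda>x. f (h x))"
proof -
  obtain U F where F: "open U" "T \<subseteq> U" "\<And>k. Ck_on k F U" "\<And>x. x \<in> T \<Longrightarrow> F x = f x"
    using assms(1) by (rule smooth_onE) blast
  obtain V H where H: "open V" "S \<subseteq> V" "\<And>k. Ck_on k H V" "\<And>x. x \<in> S \<Longrightarrow> H x = h x"
    using assms(2) by (rule smooth_onE) blast
  show ?thesis
  proof (rule smooth_onI[of "V \<inter> H -` U"])
    have "continuous_on V H" by (rule Ck_on_imp_continuous_on[OF H(3)[of 0]])
    then show "open (V \<inter> H -` U)" by (rule continuous_open_preimage[OF _ H(1) F(1)])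
    show "S \<subseteq> V \<inter> H -` U" using F(2) H(2,4) assms(3) by fastforce
    show "Ck_on k (\<lambda>x. F (H x)) (V \<inter> H -` U)" for k
      by (rule Ck_on_compose[OF _ F(3) Ck_on_subset[OF _ H(3)]]) auto
    show "F (H x) = f (h x)" if "x \<in> S" for x using that F(4) H(4) assms(3) by auto
  qed
qed

lemma smooth_on_compose_linear:
  "bounded_linear L \<Longrightarrow> smooth_on S f \<Longrightarrow> smooth_on S (\<lambda>x. L (f x))"
  for f :: "'a::euclidean_space \<Rightarrow> 'b::euclidean_space"
  by (rule smooth_on_compose[OF smooth_on_linear[of L UNIV]]) auto

lemmas smooth_on_scaleR = smooth_on_bilinear[OF bounded_bilinear_scaleR]
lemmas smooth_on_mult = smooth_on_bilinear[OF bounded_bilinear_mult]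
lemmas smooth_on_inner = smooth_on_bilinear[OF bounded_bilinear_inner]

lemma smooth_on_minus: "smooth_on S f \<Longrightarrow> smooth_on S (\<lambda>x. - f x)"
  using smooth_on_scaleR[OF smooth_on_const[of S "-1"]] by auto

lemma smooth_on_diff: "smooth_on S f \<Longrightarrow> smooth_on S g \<Longrightarrow> smooth_on S (\<lambda>x. f x - g x)"
  using smooth_on_add[OF _ smooth_on_minus, of S f g] by simp

lemma smooth_on_imp_continuous_on: "smooth_on S f \<Longrightarrow> continuous_on S f"
  by (elim smooth_onE) (metis Ck_on_imp_continuous_on continuous_on_eq continuous_on_subset)

lemma smooth_on_Pair_arg:
  fixes f :: "'a::euclidean_space \<times> 'b::euclidean_space \<Rightarrow> 'c::real_normed_vector"
  shows "smooth_on T f \<Longrightarrow> (\<And>y. y \<in> S \<Longrightarrow> (x, y) \<in> T) \<Longrightarrow> smooth_on S (\<lambda>y. f (x, y))"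
proof (rule smooth_on_compose[of T f S "\<lambda>y. (x, y)"])
  have "bounded_linear (\<lambda>y::'b. (0::'a, y))" by (intro bounded_linear_Pair bounded_linear_zero bounded_linear_ident)
  from smooth_on_add[OF smooth_on_const[of S "(x, 0)"] smooth_on_linear[OF this]]
  show "smooth_on S (Pair x)" by simp
qed auto

lemma smooth_on_Pair:
  fixes f :: "'a::euclidean_space \<Rightarrow> 'b::euclidean_space" and g :: "'a \<Rightarrow> 'c::euclidean_space"
  assumes "smooth_on S f" "smooth_on S g"
  shows "smooth_on S (\<lambda>x. (f x, g x))"
proof -
  have "bounded_linear (\<lambda>y::'b. (y, 0::'c))" "bounded_linear (\<lambda>y::'c. (0::'b, y))"
    by (intro bounded_linear_Pair bounded_linear_zero bounded_linear_ident)+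
  from smooth_on_add[OF smooth_on_compose_linear[OF this(1) assms(1)] smooth_on_compose_linear[OF this(2) assms(2)]]
  show ?thesis by simp
qed

text \<open>Differentiation lowers the exponent by 1 and adds a constant factor, so the induction
  runs over all exponents. The square root velocity uses the exponent -1/4 of the squared
  speed.\<close>

lemma smooth_on_real_powr: "smooth_on {0<..} (\<lambda>x::real. x powr a)"
proof (rule smooth_onI[of "{0<..}"])
  show "Ck_on k (\<lambda>x::real. x powr a) {0<..}" for k
  proof (induction k arbitrary: a)
    case 0 then show ?case by (auto intro!: continuous_intros)
  next
    case (Suc k)
    show ?case
    proof (rule Ck_on_SucI[where f'="\<lambda>x v. (v * a) *\<^sub>R x powr (a - 1)"])
      fix x :: real assume "x \<in> {0<..}"
      then show "((\<lambda>x. x powr a) has_derivative (\<lambda>v. (v * a) *\<^sub>R x powr (a - 1))) (at x)"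
        using has_real_derivative_powr[of x a] unfolding has_field_derivative_def
        by (auto simp: mult_ac elim!: has_derivative_eq_rhs)
    qed (rule Ck_on_bilinear[OF bounded_bilinear_scaleR Ck_on_const Suc.IH])
  qed
qed auto

text \<open>The span of the two functions is closed under differentiation, which lets a single
  induction treat both.\<close>

lemma smooth_on_sin_cos: "smooth_on S (sin :: real \<Rightarrow> real)" "smooth_on S (cos :: real \<Rightarrow> real)"
proof -
  have *: "Ck_on k (\<lambda>x. a * sin x + b * cos x) UNIV" for k and a b :: real
  proof (induction k arbitrary: a b)
    case 0 then show ?case by (auto intro!: continuous_intros)
  next
    case (Suc k)
    show ?case
    proof (rule Ck_on_SucI[where f'="\<lambda>x v. v *\<^sub>R ((-b) * sin x + a * cos x)"])
      show "((\<lambda>x. a * sin x + b * cos x) has_derivative (\<lambda>v. v *\<^sub>R (- b * sin x + a * cos x))) (at x)" for x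
        by (auto intro!: derivative_eq_intros simp: algebra_simps)
    qed (rule Ck_on_bilinear[OF bounded_bilinear_scaleR Ck_on_const Suc.IH])
  qed
  show "smooth_on S (sin :: real \<Rightarrow> real)"
    by (rule smooth_onI[OF open_UNIV _ *[of _ 1 0]]) auto
  show "smooth_on S (cos :: real \<Rightarrow> real)"
    by (rule smooth_onI[OF open_UNIV _ *[of _ 0 1]]) auto
qed

subsection \<open>Directional derivatives within a set\<close>

text \<open>The parameter \<open>r\<close> is restricted to values for which the point stays in
  \<open>S\<close>: the derivative is one-sided at boundary points and sees only the values of
  \<open>f\<close> on \<open>S\<close>.\<close>

definition pd :: "'a::real_normed_vector set \<Rightarrow> 'a \<Rightarrow> ('a \<Rightarrow> 'b::real_normed_vector) \<Rightarrow> 'a \<Rightarrow> 'b" where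
  "pd S v f x = vector_derivative (\<lambda>r. f (x + r *\<^sub>R v)) (at 0 within {r. x + r *\<^sub>R v \<in> S})"

text \<open>From each point of \<open>S\<close> there are arbitrarily short steps along
  \<plusminus>\<open>v\<close> inside \<open>S\<close>. This makes the derivative
  \<open>pd S v\<close> unique, also on the edges and corners of a box.\<close>

definition admissible :: "'a::real_normed_vector set \<Rightarrow> 'a \<Rightarrow> bool" where
  "admissible S v \<longleftrightarrow> (\<forall>x\<in>S. 0 islimpt {r. x + r *\<^sub>R v \<in> S})"

text \<open>Convexity shrinks one nonzero displacement to arbitrarily small ones.\<close>

lemma admissibleI:
  assumes "convex S" "\<And>x. x \<in> S \<Longrightarrow> \<exists>d. d \<noteq> 0 \<and> x + d *\<^sub>R v \<in> S"
  shows "admissible S v"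
  unfolding admissible_def islimpt_approachable
proof (intro ballI allI impI)
  fix x and e :: real assume "x \<in> S" and e: "0 < e"
  obtain d where d: "d \<noteq> 0" "x + d *\<^sub>R v \<in> S" using assms(2)[OF \<open>x \<in> S\<close>] by blast
  define t where "t = min 1 (e / (2 * \<bar>d\<bar>))"
  have t: "0 < t" "t \<le> 1" using e d by (auto simp: t_def)
  have "x + (t * d) *\<^sub>R v = (1 - t) *\<^sub>R x + t *\<^sub>R (x + d *\<^sub>R v)" by (simp add: algebra_simps)
  also have "\<dots> \<in> S" using t by (intro convexD[OF assms(1) \<open>x \<in> S\<close> d(2)]) auto
  finally have "x + (t * d) *\<^sub>R v \<in> S" .
  moreover have "\<bar>t * d\<bar> < e"
  proof -
    have "t * \<bar>d\<bar> \<le> e / (2 * \<bar>d\<bar>) * \<bar>d\<bar>" by (intro mult_right_mono) (auto simp: t_def)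
    also have "\<dots> < e" using d e by simp
    finally show ?thesis using t by (simp add: abs_mult)
  qed
  ultimately show "\<exists>x'\<in>{r. x + r *\<^sub>R v \<in> S}. x' \<noteq> 0 \<and> dist x' 0 < e"
    using t d by (intro bexI[of _ "t * d"]) auto
qed

lemma has_derivative_along_line:
  assumes "(f has_derivative f') (at x within S)"
  shows "((\<lambda>r. f (x + r *\<^sub>R v)) has_vector_derivative f' v) (at 0 within {r. x + r *\<^sub>R v \<in> S})"
proof -
  have "((\<lambda>r. f (x + r *\<^sub>R v)) has_derivative (\<lambda>r. f' (r *\<^sub>R v))) (at 0 within {r. x + r *\<^sub>R v \<in> S})"
  proof (rule has_derivative_in_compose[where f="\<lambda>r. x + r *\<^sub>R v" and g=f])
    show "((\<lambda>r. x + r *\<^sub>R v) has_derivative (\<lambda>r. r *\<^sub>R v)) (at 0 within {r. x + r *\<^sub>R v \<in> S})"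
      by (auto intro!: derivative_eq_intros)
    show "(f has_derivative f') (at (x + 0 *\<^sub>R v) within (\<lambda>r. x + r *\<^sub>R v) ` {r. x + r *\<^sub>R v \<in> S})"
      by (rule has_derivative_subset[of _ _ _ S]) (use assms in auto)
  qed
  then show ?thesis
    by (simp add: has_vector_derivative_def linear_cmul[OF has_derivative_linear[OF assms]])
qed

lemma pd_eqI:
  assumes "admissible S v" "x \<in> S" "(f has_derivative f') (at x within S)"
  shows "pd S v f x = f' v"
  unfolding pd_def
  by (rule vector_derivative_within[OF _ has_derivative_along_line[OF assms(3)]])
     (use assms in \<open>auto simp: admissible_def trivial_limit_within\<close>)

lemma pd_cong:
  assumes "x \<in> S" "\<And>y. y \<in> S \<Longrightarrow> f y = g y"
  shows "pd S v f x = pd S v g x"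
proof -
  have "((\<lambda>r. f (x + r *\<^sub>R v)) has_vector_derivative D) (at 0 within {r. x + r *\<^sub>R v \<in> S}) \<longleftrightarrow>
        ((\<lambda>r. g (x + r *\<^sub>R v)) has_vector_derivative D) (at 0 within {r. x + r *\<^sub>R v \<in> S})" for D
    using assms by (intro iffI; elim has_vector_derivative_transform[rotated 2]) auto
  then show ?thesis unfolding pd_def vector_derivative_def by simp
qed

lemma smooth_on_has_derivative:
  assumes "smooth_on S f" "x \<in> S"
  shows "\<exists>f'. (f has_derivative f') (at x within S)"
proof -
  obtain U F where F: "open U" "S \<subseteq> U" "\<And>k. Ck_on k F U" "\<And>x. x \<in> S \<Longrightarrow> F x = f x"
    using assms(1) by (rule smooth_onE) blast
  have "x \<in> U" using F(2) assms(2) by blast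
  then have "(F has_derivative frechet_derivative F (at x)) (at x within S)"
    by (rule has_derivative_at_withinI[OF Ck_on_frechet(1)[OF F(1) F(3)]])
  then have "(f has_derivative frechet_derivative F (at x)) (at x within S)"
    by (rule has_derivative_transform[OF assms(2) F(4)[symmetric], rotated])
  then show ?thesis by (intro exI[of _ "frechet_derivative F (at x)"])
qed

lemma pd_has_derivative:
  assumes "smooth_on S f" "x \<in> S"
  shows "\<exists>f'. (f has_derivative f') (at x within S) \<and> (\<forall>v. admissible S v \<longrightarrow> pd S v f x = f' v)"
proof -
  obtain f' where f': "(f has_derivative f') (at x within S)"
    using smooth_on_has_derivative[OF assms] ..
  show ?thesis by (intro exI[of _ f'] conjI f' allI impI pd_eqI[OF _ assms(2) f'])
qed

text \<open>Extensions of \<open>f\<close> are far from unique, but at points of \<open>S\<close>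
  and in admissible directions their derivatives are forced by \<open>f\<close>. Thus
  \<open>pd\<close> inherits smoothness and the symmetry of second derivatives from any
  extension.\<close>

lemma pd_extension:
  assumes "open U" "S \<subseteq> U" "Ck_on (Suc k) F U" "\<And>x. x \<in> S \<Longrightarrow> F x = f x" "admissible S v" "x \<in> S"
  shows "pd S v f x = frechet_derivative F (at x) v"
proof -
  have "(F has_derivative frechet_derivative F (at x)) (at x within S)"
    by (rule has_derivative_at_withinI[OF Ck_on_frechet(1)[OF assms(1,3)]]) (use assms in blast)
  from pd_eqI[OF assms(5,6) this] pd_cong[OF assms(6,4)] show ?thesis by simp
qed

lemma smooth_on_pd:
  assumes "smooth_on S f" "admissible S v"
  shows "smooth_on S (pd S v f)"
proof -
  obtain U F where F: "open U" "S \<subseteq> U" "\<And>k. Ck_on k F U" "\<And>x. x \<in> S \<Longrightarrow> F x = f x"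
    using assms(1) by (rule smooth_onE) blast
  show ?thesis
    by (rule smooth_onI[OF F(1,2) Ck_on_frechet(2)[OF F(1) F(3), of _ v]])
       (use pd_extension[OF F(1,2) F(3) F(4) assms(2)] in simp)
qed

lemma pd_commute:
  fixes f :: "'a::euclidean_space \<Rightarrow> 'b::banach"
  assumes "smooth_on S f" "admissible S u" "admissible S v" "x \<in> S"
  shows "pd S u (pd S v f) x = pd S v (pd S u f) x"
proof -
  obtain U F where F: "open U" "S \<subseteq> U" "\<And>k. Ck_on k F U" "\<And>x. x \<in> S \<Longrightarrow> F x = f x"
    using assms(1) by (rule smooth_onE) blast
  have C: "Ck_on (Suc 0) (\<lambda>x. frechet_derivative F (at x) w) U" for w
    by (rule Ck_on_frechet(2)[OF F(1) F(3)])
  have "pd S u (pd S v f) x = frechet_derivative (\<lambda>x. frechet_derivative F (at x) v) (at x) u"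
    by (rule pd_extension[OF F(1,2) C _ assms(2,4)]) (use pd_extension[OF F(1,2) F(3) F(4) assms(3)] in simp)
  moreover have "pd S v (pd S u f) x = frechet_derivative (\<lambda>x. frechet_derivative F (at x) u) (at x) v"
    by (rule pd_extension[OF F(1,2) C _ assms(3,4)]) (use pd_extension[OF F(1,2) F(3) F(4) assms(2)] in simp)
  ultimately show ?thesis
    using frechet_derivative_commute[OF F(1) F(3), of x v u] F(2) assms(4) by auto
qed

lemma pd_const: "admissible S v \<Longrightarrow> x \<in> S \<Longrightarrow> pd S v (\<lambda>x. c) x = 0"
  by (rule pd_eqI[where f'="\<lambda>v. 0"]) auto

lemma pd_bilinear:
  assumes "bounded_bilinear pr" "smooth_on S f" "smooth_on S g" "admissible S v" "x \<in> S"
  shows "pd S v (\<lambda>x. pr (f x) (g x)) x = pr (f x) (pd S v g x) + pr (pd S v f x) (g x)"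
proof -
  obtain f' where f': "(f has_derivative f') (at x within S)" "\<And>v. admissible S v \<Longrightarrow> pd S v f x = f' v"
    using pd_has_derivative[OF assms(2,5)] by (elim exE conjE) simp
  obtain g' where g': "(g has_derivative g') (at x within S)" "\<And>v. admissible S v \<Longrightarrow> pd S v g x = g' v"
    using pd_has_derivative[OF assms(3,5)] by (elim exE conjE) simp
  show ?thesis
    using pd_eqI[OF assms(4,5) bounded_bilinear.FDERIV[OF assms(1) f'(1) g'(1)]] f'(2) g'(2) assms(4) by simp
qed

lemma pd_add:
  assumes "smooth_on S f" "smooth_on S g" "admissible S v" "x \<in> S"
  shows "pd S v (\<lambda>x. f x + g x) x = pd S v f x + pd S v g x"
proof -
  obtain f' where f': "(f has_derivative f') (at x within S)" "\<And>v. admissible S v \<Longrightarrow> pd S v f x = f' v"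
    using pd_has_derivative[OF assms(1,4)] by (elim exE conjE) simp
  obtain g' where g': "(g has_derivative g') (at x within S)" "\<And>v. admissible S v \<Longrightarrow> pd S v g x = g' v"
    using pd_has_derivative[OF assms(2,4)] by (elim exE conjE) simp
  show ?thesis
    using pd_eqI[OF assms(3,4) has_derivative_add[OF f'(1) g'(1)]] f'(2) g'(2) assms(3) by simp
qed

lemma pd_linear:
  assumes "bounded_linear L" "smooth_on S f" "admissible S v" "x \<in> S"
  shows "pd S v (\<lambda>x. L (f x)) x = L (pd S v f x)"
proof -
  obtain f' where f': "(f has_derivative f') (at x within S)" "\<And>v. admissible S v \<Longrightarrow> pd S v f x = f' v"
    using pd_has_derivative[OF assms(2,4)] by (elim exE conjE) simp
  show ?thesis
    using pd_eqI[OF assms(3,4) bounded_linear.has_derivative[OF assms(1) f'(1)]] f'(2) assms(3) by simp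
qed

lemma pd_has_vector_derivative:
  assumes "smooth_on S f" "admissible S v" "\<And>r. r \<in> I \<Longrightarrow> x + r *\<^sub>R v \<in> S \<and> h r = f (x + r *\<^sub>R v)" "t \<in> I"
  shows "(h has_vector_derivative pd S v f (x + t *\<^sub>R v)) (at t within I)"
proof -
  have xt: "x + t *\<^sub>R v \<in> S" using assms by auto
  obtain f' where f': "(f has_derivative f') (at (x + t *\<^sub>R v) within S)"
    "\<And>w. admissible S w \<Longrightarrow> pd S w f (x + t *\<^sub>R v) = f' w"
    using pd_has_derivative[OF assms(1) xt] by auto
  have "((\<lambda>r. f (x + r *\<^sub>R v)) has_derivative (\<lambda>r. f' (r *\<^sub>R v))) (at t within I)"
  proof (rule has_derivative_in_compose[where f="\<lambda>r. x + r *\<^sub>R v" and g=f])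
    show "((\<lambda>r. x + r *\<^sub>R v) has_derivative (\<lambda>r. r *\<^sub>R v)) (at t within I)"
      by (auto intro!: derivative_eq_intros)
    show "(f has_derivative f') (at (x + t *\<^sub>R v) within (\<lambda>r. x + r *\<^sub>R v) ` I)"
      by (rule has_derivative_subset[OF f'(1)]) (use assms in auto)
  qed
  then have "((\<lambda>r. f (x + r *\<^sub>R v)) has_vector_derivative pd S v f (x + t *\<^sub>R v)) (at t within I)"
    by (simp add: has_vector_derivative_def linear_cmul[OF has_derivative_linear[OF f'(1)]] f'(2) assms(2))
  then show ?thesis
    by (rule has_vector_derivative_transform[rotated 2]) (use assms in auto)
qed

lemma velocity_eqI:
  assumes "(h has_vector_derivative D) (at t within {0..1})" "t \<in> {0..1}"
  shows "velocity h t = D"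
  unfolding velocity_def
  using vector_derivative_within_cbox[of 0 1 t h D] assms by simp

lemma velocity_pd:
  assumes "smooth_on S f" "admissible S v" "\<And>r. r \<in> {0..1} \<Longrightarrow> x + r *\<^sub>R v \<in> S \<and> h r = f (x + r *\<^sub>R v)" "t \<in> {0..1}"
  shows "velocity h t = pd S v f (x + t *\<^sub>R v)"
  by (rule velocity_eqI[OF pd_has_vector_derivative[OF assms(1-3)] assms(4)]) (use assms in auto)

lemma velocity_cong:
  assumes "\<And>r. r \<in> {0..1} \<Longrightarrow> f r = h r" "t \<in> {0..1}"
  shows "velocity f t = velocity h t"
proof -
  have "(f has_vector_derivative D) (at t within {0..1}) \<longleftrightarrow>
        (h has_vector_derivative D) (at t within {0..1})" for D
    using assms by (intro iffI; elim has_vector_derivative_transform[rotated 2]) auto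
  then show ?thesis unfolding velocity_def vector_derivative_def by simp
qed

lemma open_tube_base: "open V \<Longrightarrow> open {x. {x} \<times> {0..1::real} \<subseteq> V}"
proof (subst open_subopen, intro ballI)
  fix x assume "open V" "x \<in> {x. {x} \<times> {0..1::real} \<subseteq> V}"
  then obtain X0 where "x \<in> X0" "open X0" "X0 \<times> {0..1} \<subseteq> V"
    using Elementary_Topology.tube_lemma[of "{0..1::real}" V x] by auto
  then show "\<exists>T. open T \<and> x \<in> T \<and> T \<subseteq> {x. {x} \<times> {0..1::real} \<subseteq> V}" by blast
qed

text \<open>An extension of the integrand lives on an open set around
  \<open>S \<times> {0..1}\<close>. Because the fibre is compact, the points whose whole fibre lies
  in that set form an open set, on which the integral of the extension is smooth.\<close>

lemma smooth_on_integral01: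
  fixes f :: "'a::euclidean_space \<times> real \<Rightarrow> 'b::banach"
  assumes "smooth_on (S \<times> {0..1}) f"
  shows "smooth_on S (\<lambda>x. integral {0..1} (\<lambda>\<theta>. f (x, \<theta>)))"
    and "admissible S v \<Longrightarrow> admissible (S \<times> {0..1}) (v, 0::real) \<Longrightarrow> x \<in> S \<Longrightarrow>
      pd S v (\<lambda>x. integral {0..1} (\<lambda>\<theta>. f (x, \<theta>))) x = integral {0..1} (\<lambda>\<theta>. pd (S \<times> {0..1}) (v, 0) f (x, \<theta>))"
proof -
  obtain V F where F: "open V" "S \<times> {0..1} \<subseteq> V" "\<And>k. Ck_on k F V" "\<And>x. x \<in> S \<times> {0..1} \<Longrightarrow> F x = f x"
    using assms by (rule smooth_onE) blast
  define U where "U = {x. {x} \<times> {0..1::real} \<subseteq> V}"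
  have U: "open U" "S \<subseteq> U" "U \<times> {0..1} \<subseteq> V"
    using open_tube_base[OF F(1)] F(2) by (auto simp: U_def)
  have C: "Ck_on k (\<lambda>x. integral {0..1} (\<lambda>\<theta>. F (x, \<theta>))) U" for k
    by (rule Ck_on_integral01[OF F(1) U(1,3) F(3)])
  have eq: "integral {0..1} (\<lambda>\<theta>. F (x, \<theta>)) = integral {0..1} (\<lambda>\<theta>. f (x, \<theta>))" if "x \<in> S" for x
    by (rule integral_cong) (use F(4) that in auto)
  show "smooth_on S (\<lambda>x. integral {0..1} (\<lambda>\<theta>. f (x, \<theta>)))"
    by (rule smooth_onI[OF U(1,2) C]) (use eq in auto)
  assume *: "admissible S v" "admissible (S \<times> {0..1}) (v, 0::real)" "x \<in> S"
  have "pd S v (\<lambda>x. integral {0..1} (\<lambda>\<theta>. f (x, \<theta>))) x = pd S v (\<lambda>x. integral {0..1} (\<lambda>\<theta>. F (x, \<theta>))) x"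
    by (rule pd_cong) (use * eq in auto)
  also have "\<dots> = integral {0..1} (\<lambda>\<theta>. frechet_derivative F (at (x, \<theta>)) (v, 0))"
    by (rule pd_eqI[OF *(1,3) has_derivative_at_withinI[OF has_derivative_integral01[OF F(1) U(1,3) F(3)]]])
       (use * U in auto)
  also have "\<dots> = integral {0..1} (\<lambda>\<theta>. pd (S \<times> {0..1}) (v, 0) f (x, \<theta>))"
    by (rule integral_cong, rule pd_extension[OF F(1,2) F(3) _ *(2), symmetric]) (use * F(4) in auto)
  finally show "pd S v (\<lambda>x. integral {0..1} (\<lambda>\<theta>. f (x, \<theta>))) x = integral {0..1} (\<lambda>\<theta>. pd (S \<times> {0..1}) (v, 0) f (x, \<theta>))" .
qed

section \<open>Geometry of \<open>SO(n)\<close>\<close>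

lemma bounded_bilinear_matrix_mult: "bounded_bilinear ((**) :: real^'n^'m \<Rightarrow> real^'p^'n \<Rightarrow> real^'p^'m)"
proof -
  have "bilinear ((**) :: real^'n^'m \<Rightarrow> real^'p^'n \<Rightarrow> real^'p^'m)"
    unfolding bilinear_def
    by (auto intro!: linearI simp: matrix_add_ldistrib vec_eq_iff matrix_matrix_mult_def
        sum.distrib sum_distrib_left algebra_simps)
  then show ?thesis by (simp add: bilinear_conv_bounded_bilinear)
qed

interpretation mm: bounded_bilinear "(**) :: real^'n^'m \<Rightarrow> real^'p^'n \<Rightarrow> real^'p^'m"
  by (rule bounded_bilinear_matrix_mult)

lemmas mm_simps = mm.add_left mm.add_right mm.diff_left mm.diff_right mm.minus_left mm.minus_right
  mm.scaleR_left mm.scaleR_right mm.zero_left mm.zero_right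

lemma bounded_linear_transpose: "bounded_linear (transpose :: real^'n^'m \<Rightarrow> real^'m^'n)"
  by (auto intro!: linearI simp: linear_conv_bounded_linear[symmetric] transpose_def vec_eq_iff)

lemmas tr_add = linear_add[OF bounded_linear.linear[OF bounded_linear_transpose]]
  and tr_diff = linear_diff[OF bounded_linear.linear[OF bounded_linear_transpose]]
  and tr_scaleR = linear_cmul[OF bounded_linear.linear[OF bounded_linear_transpose]]
  and tr_zero = linear_0[OF bounded_linear.linear[OF bounded_linear_transpose]]

section \<open>Skew-symmetric matrices and tangent vectors\<close>

definition so :: "('n::finite) sqmat set" where
  "so = {x. transpose x = - x}"

text \<open>The Lie algebra is a subspace of the matrices and not a type of its own. Maps given on
  it are extended to all matrices by this projection, and invariance under it expresses membership
  in \<open>so\<close>.\<close>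

definition skw :: "('n::finite) sqmat \<Rightarrow> 'n sqmat" where
  "skw x = (1/2) *\<^sub>R (x - transpose x)"

lemma bounded_linear_skw: "bounded_linear skw"
  unfolding skw_def
  by (intro bounded_linear_compose[OF bounded_linear_scaleR_right] bounded_linear_sub
      bounded_linear_ident bounded_linear_transpose)

lemmas skw_add = linear_add[OF bounded_linear.linear[OF bounded_linear_skw]]
  and skw_scaleR = linear_cmul[OF bounded_linear.linear[OF bounded_linear_skw]]

lemma skw_so [simp]: "skw x \<in> so"
  by (simp add: skw_def so_def tr_scaleR tr_diff transpose_transpose scaleR_diff_right)

lemma skw_id: "x \<in> so \<Longrightarrow> skw x = x"
  by (simp add: so_def skw_def scaleR_2[symmetric])

lemma subspace_so: "subspace so"
  by (auto simp: subspace_def so_def tr_add tr_scaleR tr_zero)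

lemma so_closed:
  "x \<in> so \<Longrightarrow> y \<in> so \<Longrightarrow> x + y \<in> so" "x \<in> so \<Longrightarrow> y \<in> so \<Longrightarrow> x - y \<in> so"
  "x \<in> so \<Longrightarrow> c *\<^sub>R x \<in> so" "0 \<in> so" "x \<in> so \<Longrightarrow> - x \<in> so"
  by (simp_all add: subspace_add[OF subspace_so] subspace_diff[OF subspace_so] subspace_scale[OF subspace_so]
      subspace_0[OF subspace_so] subspace_neg[OF subspace_so])

lemma so_commutator: "x \<in> so \<Longrightarrow> y \<in> so \<Longrightarrow> x ** y - y ** x \<in> so"
  by (auto simp: so_def tr_diff matrix_transpose_mul mm_simps)

lemma SO_inverse:
  assumes "A \<in> SO"
  shows "transpose A ** A = mat 1" "A ** transpose A = mat 1"
  using assms by (auto simp: SO_def rotation_matrix_def orthogonal_matrix_def)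

lemma SO_cancel:
  assumes "A \<in> SO"
  shows "transpose A ** (A ** x) = x" "A ** (transpose A ** x) = x"
  by (simp_all add: matrix_mul_assoc SO_inverse[OF assms] matrix_mul_lid)

lemma tangent_space_iff:
  assumes A: "A \<in> SO"
  shows "u \<in> tangent_space A \<longleftrightarrow> transpose A ** u \<in> so"
proof
  assume "u \<in> tangent_space A"
  then show "transpose A ** u \<in> so"
    by (auto simp: tangent_space_def left_invariant_def so_def SO_cancel[OF A])
next
  assume "transpose A ** u \<in> so"
  then show "u \<in> tangent_space A"
    unfolding tangent_space_def left_invariant_def so_def
    by (intro CollectI exI[of _ "transpose A ** u"]) (simp add: SO_cancel[OF A])
qed

lemma mult_tangent: "x \<in> so \<Longrightarrow> A ** x \<in> tangent_space A"
  unfolding tangent_space_def left_invariant_def so_def by auto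

lemma tangentE:
  assumes "A \<in> SO" "u \<in> tangent_space A"
  obtains x where "x \<in> so" "u = A ** x"
  using assms unfolding tangent_space_def left_invariant_def so_def by auto

lemma SO_mult: "A \<in> SO \<Longrightarrow> B \<in> SO \<Longrightarrow> A ** B \<in> SO"
  by (simp add: SO_def rotation_matrix_def orthogonal_matrix_mul det_mul)

subsection \<open>Plane rotations\<close>

text \<open>Rodrigues' formula; for \<open>B\<close> with \<open>B\<^sup>3 = -B\<close> it is the exponential of \<open>\<theta> B\<close>.\<close>

definition rot :: "('n::finite) sqmat \<Rightarrow> real \<Rightarrow> 'n sqmat" where
  "rot B \<theta> = mat 1 + sin \<theta> *\<^sub>R B + (1 - cos \<theta>) *\<^sub>R (B ** B)"

definition munit :: "'n::finite \<Rightarrow> 'n \<Rightarrow> 'n sqmat" where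
  "munit i j = (\<chi> a b. if a = i \<and> b = j then 1 else 0)"

text \<open>The generator of the rotations in the plane of the coordinates \<open>i\<close> and
  \<open>j\<close>; for \<open>i = j\<close> it is 0 and the rotation is constantly the
  identity.\<close>

definition gen :: "'n::finite \<Rightarrow> 'n \<Rightarrow> 'n sqmat" where
  "gen i j = munit i j - munit j i"

lemma munit_mult: "munit i j ** munit k l = (if j = k then munit i l else 0)"
proof -
  have "(munit i j ** munit k l) $ a $ b = (if j = k then munit i l else 0) $ a $ b" for a b
  proof -
    have "(munit i j ** munit k l) $ a $ b =
      (\<Sum>c\<in>UNIV. if c = j then (if a = i \<and> j = k \<and> b = l then 1 else 0) else 0)"
      by (simp only: matrix_matrix_mult_def munit_def vec_lambda_beta) (rule sum.cong, auto)
    then show ?thesis by (simp add: munit_def)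
  qed
  then show ?thesis by (simp only: vec_eq_iff) blast
qed

lemma transpose_munit: "transpose (munit i j) = munit j i"
  by (auto simp: munit_def transpose_def vec_eq_iff)

lemma gen_so: "gen i j \<in> so"
  by (simp add: so_def gen_def tr_diff transpose_munit)

lemma gen_cube: "gen i j ** gen i j ** gen i j = - gen i j"
  by (cases "i = j") (auto simp: gen_def mm_simps munit_mult)

lemma sum_munit: "x = (\<Sum>i\<in>UNIV. \<Sum>j\<in>UNIV. (x $ i $ j) *\<^sub>R munit i j)"
proof -
  have "(\<Sum>i\<in>UNIV. \<Sum>j\<in>UNIV. (x $ i $ j) *\<^sub>R munit i j) $ a $ b = x $ a $ b" for a b
  proof -
    have e: "((x $ i $ j) *\<^sub>R munit i j) $ a $ b = (if j = b then (if i = a then x $ i $ j else 0) else 0)" for i j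
      by (simp add: munit_def)
    show ?thesis by (simp only: sum_component e) (simp add: sum.delta)
  qed
  then show ?thesis by (simp only: vec_eq_iff) simp
qed

text \<open>Each coordinate plane occurs twice in the double sum, as \<open>(i, j)\<close> and as
  \<open>(j, i)\<close>, with equal contributions; hence the factor 1/2.\<close>

lemma so_sum_gen:
  assumes "x \<in> so"
  shows "x = (1/2) *\<^sub>R (\<Sum>i\<in>UNIV. \<Sum>j\<in>UNIV. (x $ i $ j) *\<^sub>R gen i j)"
proof -
  have t: "transpose x = (\<Sum>i\<in>UNIV. \<Sum>j\<in>UNIV. (x $ i $ j) *\<^sub>R munit j i)"
    by (subst sum_munit[of x])
       (simp only: linear_sum[OF bounded_linear.linear[OF bounded_linear_transpose]] tr_scaleR transpose_munit)
  have "x = (1/2) *\<^sub>R (x - transpose x)" using skw_id[OF assms] by (simp add: skw_def)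
  also have "x - transpose x = (\<Sum>i\<in>UNIV. \<Sum>j\<in>UNIV. (x $ i $ j) *\<^sub>R gen i j)"
    unfolding t by (subst (1) sum_munit[of x]) (simp only: gen_def scaleR_diff_right sum_subtractf)
  finally show ?thesis .
qed

text \<open>Since the cube of \<open>B\<close> is \<open>- B\<close>, products of its powers reduce
  to the identity, \<open>B\<close> and \<open>B ** B\<close>; comparing coefficients leaves the
  addition theorems of sine and cosine.\<close>

lemma rot_add:
  assumes "B ** B ** B = - B"
  shows "rot B a ** rot B b = rot B (a + b)"
proof -
  have B: "B ** (B ** B) = - B" "(B ** B) ** B = - B" "(B ** B) ** (B ** B) = - (B ** B)"
    using assms by (simp_all add: matrix_mul_assoc mm_simps)
  have "rot B a ** rot B b = mat 1 + (sin a * cos b + cos a * sin b) *\<^sub>R B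
      + (1 - (cos a * cos b - sin a * sin b)) *\<^sub>R (B ** B)"
    unfolding rot_def by (simp add: mm_simps matrix_mul_lid matrix_mul_rid B algebra_simps)
  then show ?thesis by (simp add: rot_def sin_add cos_add)
qed

lemma rot_0 [simp]: "rot B 0 = mat 1"
  by (simp add: rot_def)

lemma transpose_rot: "B \<in> so \<Longrightarrow> transpose (rot B a) = rot B (- a)"
  by (simp add: rot_def so_def tr_add tr_scaleR matrix_transpose_mul transpose_mat mm_simps)

text \<open>Orthogonality alone leaves the determinant 1 or -1. The rotation is the square of the
  one by half the angle, so its determinant is a square and equals 1.\<close>

lemma rot_SO:
  assumes "B \<in> so" "B ** B ** B = - B"
  shows "rot B \<theta> \<in> SO"
proof -
  have o: "orthogonal_matrix (rot B a)" for a
    by (simp add: orthogonal_matrix_def transpose_rot[OF assms(1)] rot_add[OF assms(2)])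
  have "det (rot B \<theta>) = det (rot B (\<theta>/2)) * det (rot B (\<theta>/2))"
    using rot_add[OF assms(2), of "\<theta>/2" "\<theta>/2"] by (simp add: det_mul[symmetric])
  also have "\<dots> = 1" using det_orthogonal_matrix[OF o[of "\<theta>/2"]] by auto
  finally show ?thesis using o by (simp add: SO_def rotation_matrix_def)
qed

lemma smooth_on_rot:
  assumes "smooth_on S f"
  shows "smooth_on S (\<lambda>x. rot B (f x))"
  unfolding rot_def
  by (intro smooth_on_add smooth_on_diff smooth_on_const smooth_on_scaleR
      smooth_on_compose[OF smooth_on_sin_cos(1)[of UNIV] assms]
      smooth_on_compose[OF smooth_on_sin_cos(2)[of UNIV] assms]) auto

lemma rot_has_vector_derivative: "((\<lambda>\<theta>. rot B \<theta>) has_vector_derivative B) (at 0)"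
  unfolding rot_def by (auto intro!: derivative_eq_intros simp: has_vector_derivative_def)

subsection \<open>Derivatives of functions on \<open>SO(n)\<close>\<close>

text \<open>The curves \<open>A ** rot (gen i j) \<theta>\<close> stay in \<open>SO\<close>, so any
  derivative within \<open>SO\<close> is determined on their velocities at 0, and the generators
  span the Lie algebra.\<close>

lemma derivative_unique_tangent:
  assumes A: "A \<in> SO" and "x \<in> so"
    and D: "(f has_derivative D) (at A within SO)" "(f has_derivative D') (at A within SO)"
  shows "D (A ** x) = D' (A ** x)"
proof -
  have *: "D (A ** gen i j) = D' (A ** gen i j)" for i j
  proof -
    have "((\<lambda>\<theta>. f (A ** rot (gen i j) \<theta>)) has_vector_derivative D (A ** gen i j)) (at 0)"
      if D: "(f has_derivative D) (at A within SO)" for D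
    proof -
      have "((\<lambda>\<theta>. A ** rot (gen i j) \<theta>) has_derivative (\<lambda>r. A ** (r *\<^sub>R gen i j))) (at 0)"
        using rot_has_vector_derivative[of "gen i j"] unfolding has_vector_derivative_def
        by (rule bounded_linear.has_derivative[OF mm.bounded_linear_right])
      then have "((\<lambda>\<theta>. f (A ** rot (gen i j) \<theta>)) has_derivative (\<lambda>r. D (A ** (r *\<^sub>R gen i j)))) (at 0)"
        by (rule has_derivative_in_compose[where g=f and f="\<lambda>\<theta>. A ** rot (gen i j) \<theta>"])
           (use D A in \<open>auto simp: matrix_mul_rid intro!: has_derivative_subset[OF D] SO_mult rot_SO gen_so gen_cube\<close>)
      then show ?thesis
        by (simp add: has_vector_derivative_def mm_simps linear_cmul[OF has_derivative_linear[OF D]])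
    qed
    from vector_derivative_unique_at[OF this[OF D(1)] this[OF D(2)]] show ?thesis .
  qed
  have "D (A ** x) = (1/2) *\<^sub>R (\<Sum>i\<in>UNIV. \<Sum>j\<in>UNIV. (x $ i $ j) *\<^sub>R D (A ** gen i j))"
    if D: "linear D" for D :: "'a sqmat \<Rightarrow> 'b"
    by (subst so_sum_gen[OF \<open>x \<in> so\<close>])
       (simp add: mm_simps mm.sum_right linear_sum[OF D] linear_cmul[OF D])
  from this[OF has_derivative_linear[OF D(1)]] this[OF has_derivative_linear[OF D(2)]] *
  show ?thesis by simp
qed

lemma dir_deriv_has_derivative:
  assumes "smooth_on SO f" "A \<in> SO"
  shows "(f has_derivative (dir_deriv f A)) (at A within SO)"
  using smooth_on_has_derivative[OF assms] frechet_derivative_works[of f "at A within SO"]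
  unfolding dir_deriv_def differentiable_def by auto

lemma dir_deriv_eqI:
  assumes "(f has_derivative D) (at A within SO)" "A \<in> SO" "x \<in> so"
  shows "dir_deriv f A (A ** x) = D (A ** x)"
proof -
  have "(f has_derivative (dir_deriv f A)) (at A within SO)"
    using assms(1) frechet_derivative_works[of f "at A within SO"]
    unfolding dir_deriv_def differentiable_def by auto
  from derivative_unique_tangent[OF assms(2,3) this assms(1)] show ?thesis .
qed

lemma dir_deriv_cong:
  assumes "smooth_on SO f" "A \<in> SO" "x \<in> so" "\<And>B. B \<in> SO \<Longrightarrow> h B = f B"
  shows "dir_deriv h A (A ** x) = dir_deriv f A (A ** x)"
  by (rule dir_deriv_eqI[OF has_derivative_transform[OF assms(2) assms(4)
        dir_deriv_has_derivative[OF assms(1,2)]] assms(2,3)])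

lemma dir_deriv_const: "A \<in> SO \<Longrightarrow> x \<in> so \<Longrightarrow> dir_deriv (\<lambda>_. c) A (A ** x) = 0"
  using dir_deriv_eqI[of "\<lambda>_. c" "\<lambda>_. 0" A x] by simp

lemma dir_deriv_linear_image:
  assumes "bounded_linear L" "smooth_on SO f" "A \<in> SO" "x \<in> so"
  shows "dir_deriv (\<lambda>B. L (f B)) A (A ** x) = L (dir_deriv f A (A ** x))"
  by (rule dir_deriv_eqI[OF bounded_linear.has_derivative[OF assms(1) dir_deriv_has_derivative[OF assms(2,3)]] assms(3,4)])

lemma dir_deriv_add:
  assumes "smooth_on SO f" "smooth_on SO h" "A \<in> SO" "x \<in> so"
  shows "dir_deriv (\<lambda>B. f B + h B) A (A ** x) = dir_deriv f A (A ** x) + dir_deriv h A (A ** x)"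
  by (rule dir_deriv_eqI[OF has_derivative_add[OF dir_deriv_has_derivative[OF assms(1,3)]
        dir_deriv_has_derivative[OF assms(2,3)]] assms(3,4)])

lemma dir_deriv_diff:
  assumes "smooth_on SO f" "smooth_on SO h" "A \<in> SO" "x \<in> so"
  shows "dir_deriv (\<lambda>B. f B - h B) A (A ** x) = dir_deriv f A (A ** x) - dir_deriv h A (A ** x)"
  by (rule dir_deriv_eqI[OF has_derivative_diff[OF dir_deriv_has_derivative[OF assms(1,3)]
        dir_deriv_has_derivative[OF assms(2,3)]] assms(3,4)])

lemma linear_dir_deriv: "smooth_on SO f \<Longrightarrow> A \<in> SO \<Longrightarrow> linear (dir_deriv f A)"
  using dir_deriv_has_derivative has_derivative_linear by blast

text \<open>The bracket of left-invariant fields as differential operators. The second derivative of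
  an extension is symmetric and cancels; what remains comes from differentiating the direction
  \<open>B ** y\<close> along \<open>A ** x\<close>, which gives \<open>A ** x ** y\<close>, and
  symmetrically \<open>A ** y ** x\<close>.\<close>

lemma dir_deriv_commutator:
  fixes f :: "('n::finite) sqmat \<Rightarrow> 'b::banach"
  assumes f: "smooth_on SO f"
  shows "x \<in> so \<Longrightarrow> smooth_on SO (\<lambda>B. dir_deriv f B (B ** x))"
    and "A \<in> SO \<Longrightarrow> x \<in> so \<Longrightarrow> y \<in> so \<Longrightarrow>
      dir_deriv (\<lambda>B. dir_deriv f B (B ** y)) A (A ** x) - dir_deriv (\<lambda>B. dir_deriv f B (B ** x)) A (A ** y)
      = dir_deriv f A (A ** (x ** y - y ** x))"
proof -
  obtain U F where F: "open U" "SO \<subseteq> U" "\<And>k. Ck_on k F U" "\<And>x. x \<in> SO \<Longrightarrow> F x = f x"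
    using f by (rule smooth_onE) blast
  define F' where "F' b B = frechet_derivative F (at B) b" for b B
  have F'C: "Ck_on k (F' b) U" for k b
    unfolding F'_def by (rule Ck_on_frechet(2)[OF F(1) F(3)])
  have Fd: "(F has_derivative (\<lambda>b. F' b B)) (at B within SO)" if "B \<in> SO" for B
    unfolding F'_def
    by (rule has_derivative_at_withinI[OF Ck_on_frechet(1)[OF F(1) F(3)]]) (use that F(2) in blast)
  have lin: "linear (\<lambda>b. F' b B)" if "B \<in> SO" for B
    using has_derivative_linear[OF Fd[OF that]] .
  have d: "dir_deriv f B (B ** x) = F' (B ** x) B" if "B \<in> SO" "x \<in> so" for B x
    by (rule dir_deriv_eqI[OF _ that], rule has_derivative_transform[OF that(1) _ Fd[OF that(1)]]) (simp add: F(4))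
  \<comment> \<open>The expansion in the standard basis turns the derivative in the moving direction
    \<open>B ** x\<close> into a sum of products of smooth functions of \<open>B\<close>, defined
    also off \<open>SO\<close>.\<close>
  define H where "H x B = (\<Sum>b\<in>Basis. ((B ** x) \<bullet> b) *\<^sub>R F' b B)" for x B
  have dH: "dir_deriv f B (B ** x) = H x B" if "B \<in> SO" "x \<in> so" for B x
    unfolding d[OF that] H_def using linear_eq_sum_Basis[OF lin[OF that(1)]] .
  have sm: "smooth_on SO (H x)" for x
    unfolding H_def
    by (intro smooth_on_sum smooth_on_scaleR smooth_on_inner smooth_on_const
        smooth_on_bilinear[OF bounded_bilinear_matrix_mult] smooth_on_ident)
       (rule smooth_onI[OF F(1,2) F'C], simp)
  show "x \<in> so \<Longrightarrow> smooth_on SO (\<lambda>B. dir_deriv f B (B ** x))" for x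
    by (rule smooth_on_cong[OF sm[of x]]) (simp add: dH)
  assume A: "A \<in> SO" and xy: "x \<in> so" "y \<in> so"
  have AU: "A \<in> U" using A F(2) by blast
  define F2 where "F2 b c = frechet_derivative (F' b) (at A) c" for b c
  have F2d: "(F' b has_derivative F2 b) (at A within SO)" for b
    unfolding F2_def
    by (rule has_derivative_at_withinI) (rule Ck_on_frechet(1)[OF F(1) F'C AU])
  have sym: "F2 b c = F2 c b" for b c
    unfolding F2_def F'_def by (rule frechet_derivative_commute[OF F(1) F(3) AU])
  have F2lin: "linear (F2 b)" for b using has_derivative_linear[OF F2d] .
  have Hd: "dir_deriv (H y) A (A ** x) = F' (A ** x ** y) A +
      (\<Sum>b\<in>Basis. \<Sum>c\<in>Basis. (((A ** y) \<bullet> b) * ((A ** x) \<bullet> c)) *\<^sub>R F2 b c)" if "x \<in> so" for x y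
  proof -
    have ml: "((\<lambda>u. u ** y) has_derivative (\<lambda>u. u ** y)) (at A within SO)"
      by (rule bounded_linear_imp_has_derivative[OF mm.bounded_linear_left])
    have "(H y has_derivative (\<lambda>u. \<Sum>b\<in>Basis. ((A ** y) \<bullet> b) *\<^sub>R F2 b u + ((u ** y) \<bullet> b) *\<^sub>R F' b A)) (at A within SO)"
      unfolding H_def
      by (intro has_derivative_sum has_derivative_scaleR F2d has_derivative_inner_left ml)
    from dir_deriv_eqI[OF this A that]
    have "dir_deriv (H y) A (A ** x) = (\<Sum>b\<in>Basis. ((A ** y) \<bullet> b) *\<^sub>R F2 b (A ** x)) + (\<Sum>b\<in>Basis. ((A ** x ** y) \<bullet> b) *\<^sub>R F' b A)"
      by (simp add: sum.distrib)
    also have "(\<Sum>b\<in>Basis. ((A ** x ** y) \<bullet> b) *\<^sub>R F' b A) = F' (A ** x ** y) A"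
      using linear_eq_sum_Basis[OF lin[OF A]] by metis
    also have "(\<Sum>b\<in>Basis. ((A ** y) \<bullet> b) *\<^sub>R F2 b (A ** x)) = (\<Sum>b\<in>Basis. \<Sum>c\<in>Basis. (((A ** y) \<bullet> b) * ((A ** x) \<bullet> c)) *\<^sub>R F2 b c)"
    proof (rule sum.cong[OF refl])
      fix b :: "'n sqmat"
      show "((A ** y) \<bullet> b) *\<^sub>R F2 b (A ** x) = (\<Sum>c\<in>Basis. (((A ** y) \<bullet> b) * ((A ** x) \<bullet> c)) *\<^sub>R F2 b c)"
        by (subst linear_eq_sum_Basis[OF F2lin]) (simp add: scaleR_sum_right)
    qed
    finally show ?thesis by simp
  qed
  have "(\<Sum>b\<in>Basis. \<Sum>c\<in>Basis. (((A ** y) \<bullet> b) * ((A ** x) \<bullet> c)) *\<^sub>R F2 b c) =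
        (\<Sum>b\<in>Basis. \<Sum>c\<in>Basis. (((A ** x) \<bullet> b) * ((A ** y) \<bullet> c)) *\<^sub>R F2 b c)"
    by (subst sum.swap) (simp add: sym mult.commute)
  with Hd[OF xy(1), of y] Hd[OF xy(2), of x]
  have "dir_deriv (H y) A (A ** x) - dir_deriv (H x) A (A ** y) = F' (A ** x ** y) A - F' (A ** y ** x) A"
    by simp
  also have "\<dots> = F' (A ** (x ** y - y ** x)) A"
    using linear_diff[OF lin[OF A]] by (simp add: mm_simps matrix_mul_assoc)
  also have "\<dots> = dir_deriv f A (A ** (x ** y - y ** x))"
    using d[OF A so_commutator[OF xy]] by simp
  also have "dir_deriv (H y) A (A ** x) = dir_deriv (\<lambda>B. dir_deriv f B (B ** y)) A (A ** x)"
    by (rule dir_deriv_cong[OF sm A xy(1), symmetric]) (simp add: dH xy)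
  also have "dir_deriv (H x) A (A ** y) = dir_deriv (\<lambda>B. dir_deriv f B (B ** x)) A (A ** y)"
    by (rule dir_deriv_cong[OF sm A xy(2), symmetric]) (simp add: dH xy)
  finally show "dir_deriv (\<lambda>B. dir_deriv f B (B ** y)) A (A ** x) - dir_deriv (\<lambda>B. dir_deriv f B (B ** x)) A (A ** y)
      = dir_deriv f A (A ** (x ** y - y ** x))" .
qed

subsection \<open>Smooth fields of bilinear maps\<close>

text \<open>Smoothness is asked only for fixed arguments. The arguments range over
  finite-dimensional spaces, so expansion in bases recovers the dependence on all variables
  jointly.\<close>

definition bilin_field :: "(('n::finite) sqmat \<Rightarrow> 'a::euclidean_space \<Rightarrow> 'b::euclidean_space \<Rightarrow> 'c::real_normed_vector) \<Rightarrow> bool" where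
  "bilin_field T \<longleftrightarrow> (\<forall>A\<in>SO. bilinear (T A)) \<and> (\<forall>u v. smooth_on SO (\<lambda>A. T A u v))"

lemma bilinear_eq_sum_Basis:
  assumes "bilinear T"
  shows "T u v = (\<Sum>a\<in>Basis. \<Sum>b\<in>Basis. (u \<bullet> a) *\<^sub>R (v \<bullet> b) *\<^sub>R T a b)"
proof -
  have l: "linear (T a)" "linear (\<lambda>u. T u v)" for a v using assms by (auto simp: bilinear_def)
  have "T u v = (\<Sum>a\<in>Basis. (u \<bullet> a) *\<^sub>R T a v)" by (rule linear_eq_sum_Basis[OF l(2)])
  also have "\<dots> = (\<Sum>a\<in>Basis. (u \<bullet> a) *\<^sub>R (\<Sum>b\<in>Basis. (v \<bullet> b) *\<^sub>R T a b))"
    by (subst linear_eq_sum_Basis[OF l(1)]) rule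
  finally show ?thesis by (simp add: scaleR_sum_right)
qed

lemma bilin_field_smooth:
  assumes T: "bilin_field T" and P: "smooth_on S P" "\<And>x. x \<in> S \<Longrightarrow> P x \<in> SO"
    and "smooth_on S u" "smooth_on S v"
  shows "smooth_on S (\<lambda>x. T (P x) (u x) (v x))"
proof (rule smooth_on_cong)
  have "smooth_on S (\<lambda>x. T (P x) a b)" for a b
    by (rule smooth_on_compose[where h=P and T=SO and f="\<lambda>A. T A a b"])
       (use T P in \<open>auto simp: bilin_field_def\<close>)
  then show "smooth_on S (\<lambda>x. \<Sum>a\<in>Basis. \<Sum>b\<in>Basis. (u x \<bullet> a) *\<^sub>R (v x \<bullet> b) *\<^sub>R T (P x) a b)"
    by (intro smooth_on_sum smooth_on_scaleR smooth_on_inner smooth_on_const assms(4,5))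
  fix x assume "x \<in> S"
  then have "bilinear (T (P x))" using T P by (auto simp: bilin_field_def)
  from bilinear_eq_sum_Basis[OF this, of "u x" "v x"]
  show "(\<Sum>a\<in>Basis. \<Sum>b\<in>Basis. (u x \<bullet> a) *\<^sub>R (v x \<bullet> b) *\<^sub>R T (P x) a b) = T (P x) (u x) (v x)" by simp
qed

text \<open>The product rule with three factors. The map \<open>D\<close> is a derivative in all
  directions, but its first term can be written with \<open>dir_deriv\<close> only where
  \<open>P' h\<close> is tangent, since the derivative within \<open>SO\<close> is undetermined in
  the other directions.\<close>

lemma bilin_field_deriv_aux:
  assumes T: "bilin_field T"
    and P: "(P has_derivative P') (at x within S)" "\<And>x. x \<in> S \<Longrightarrow> P x \<in> SO" and x: "x \<in> S"
    and u: "(u has_derivative u') (at x within S)" and v: "(v has_derivative v') (at x within S)"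
  shows "\<exists>D. ((\<lambda>x. T (P x) (u x) (v x)) has_derivative D) (at x within S) \<and>
    (\<forall>h. P' h \<in> tangent_space (P x) \<longrightarrow>
      D h = dir_deriv (\<lambda>B. T B (u x) (v x)) (P x) (P' h) + T (P x) (u' h) (v x) + T (P x) (u x) (v' h))"
proof -
  have sT: "smooth_on SO (\<lambda>A. T A a b)" and bT: "\<And>A. A \<in> SO \<Longrightarrow> bilinear (T A)" for a b
    using T by (auto simp: bilin_field_def)
  have Px: "P x \<in> SO" using P(2) x by auto
  define t where "t a b = dir_deriv (\<lambda>A. T A a b) (P x)" for a b
  have td: "((\<lambda>A. T A a b) has_derivative t a b) (at (P x) within SO)" for a b
    unfolding t_def by (rule dir_deriv_has_derivative[OF sT Px])
  have tP: "((\<lambda>x. T (P x) a b) has_derivative (\<lambda>h. t a b (P' h))) (at x within S)" for a b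
    by (rule has_derivative_in_compose[OF P(1), where g="\<lambda>A. T A a b"])
       (rule has_derivative_subset[OF td], use P(2) in auto)
  define D where "D h = (\<Sum>a\<in>Basis. \<Sum>b\<in>Basis. (u x \<bullet> a) *\<^sub>R ((v x \<bullet> b) *\<^sub>R t a b (P' h) + (v' h \<bullet> b) *\<^sub>R T (P x) a b)
      + (u' h \<bullet> a) *\<^sub>R ((v x \<bullet> b) *\<^sub>R T (P x) a b))" for h
  have "((\<lambda>x. \<Sum>a\<in>Basis. \<Sum>b\<in>Basis. (u x \<bullet> a) *\<^sub>R (v x \<bullet> b) *\<^sub>R T (P x) a b) has_derivative D) (at x within S)"
    unfolding D_def
    by (intro has_derivative_sum has_derivative_scaleR has_derivative_inner_left u v tP)
  then have Dd: "((\<lambda>x. T (P x) (u x) (v x)) has_derivative D) (at x within S)"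
    by (rule has_derivative_transform[OF x, rotated]) (rule bilinear_eq_sum_Basis[OF bT[OF P(2)]])
  have "D h = dir_deriv (\<lambda>B. T B (u x) (v x)) (P x) (P' h) + T (P x) (u' h) (v x) + T (P x) (u x) (v' h)"
    if h: "P' h \<in> tangent_space (P x)" for h
  proof -
    obtain y where y: "y \<in> so" "P' h = P x ** y" by (rule tangentE[OF Px h])
    have "((\<lambda>B. \<Sum>a\<in>Basis. \<Sum>b\<in>Basis. (u x \<bullet> a) *\<^sub>R (v x \<bullet> b) *\<^sub>R T B a b) has_derivative
        (\<lambda>h. \<Sum>a\<in>Basis. \<Sum>b\<in>Basis. (u x \<bullet> a) *\<^sub>R (v x \<bullet> b) *\<^sub>R t a b h)) (at (P x) within SO)"
      by (intro has_derivative_sum has_derivative_scaleR_right td)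
    then have "((\<lambda>B. T B (u x) (v x)) has_derivative
        (\<lambda>h. \<Sum>a\<in>Basis. \<Sum>b\<in>Basis. (u x \<bullet> a) *\<^sub>R (v x \<bullet> b) *\<^sub>R t a b h)) (at (P x) within SO)"
      by (rule has_derivative_transform[OF Px, rotated]) (rule bilinear_eq_sum_Basis[OF bT])
    from dir_deriv_eqI[OF this Px y(1)]
    have "dir_deriv (\<lambda>B. T B (u x) (v x)) (P x) (P' h) = (\<Sum>a\<in>Basis. \<Sum>b\<in>Basis. (u x \<bullet> a) *\<^sub>R (v x \<bullet> b) *\<^sub>R t a b (P' h))"
      by (simp only: y(2))
    moreover note bilinear_eq_sum_Basis[OF bT[OF Px], of "u' h" "v x"] bilinear_eq_sum_Basis[OF bT[OF Px], of "u x" "v' h"]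
    ultimately show ?thesis unfolding D_def by (simp add: sum.distrib scaleR_add_right)
  qed
  with Dd show ?thesis by (intro exI[of _ D]) auto
qed

lemma bilin_field_dir_deriv:
  assumes "bilin_field T" "smooth_on SO u" "smooth_on SO v" "A \<in> SO" "x \<in> so"
  shows "dir_deriv (\<lambda>B. T B (u B) (v B)) A (A ** x) =
    dir_deriv (\<lambda>B. T B (u A) (v A)) A (A ** x) + T A (dir_deriv u A (A ** x)) (v A) + T A (u A) (dir_deriv v A (A ** x))"
proof -
  obtain D where "((\<lambda>x. T x (u x) (v x)) has_derivative D) (at A within SO)"
    "\<forall>h. h \<in> tangent_space A \<longrightarrow> D h = dir_deriv (\<lambda>B. T B (u A) (v A)) A h + T A (dir_deriv u A h) (v A) + T A (u A) (dir_deriv v A h)"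
    using bilin_field_deriv_aux[OF assms(1) has_derivative_ident _ assms(4) dir_deriv_has_derivative[OF assms(2,4)] dir_deriv_has_derivative[OF assms(3,4)]]
    by auto
  with dir_deriv_eqI[OF this(1) assms(4,5)] mult_tangent[OF assms(5)] show ?thesis by simp
qed

text \<open>The left logarithmic derivative of a family of rotations, that is, the pullback of the
  Maurer-Cartan form evaluated on \<open>v\<close>.\<close>

definition logd :: "'a::real_normed_vector set \<Rightarrow> ('a \<Rightarrow> ('n::finite) sqmat) \<Rightarrow> 'a \<Rightarrow> 'a \<Rightarrow> 'n sqmat" where
  "logd S P v x = transpose (P x) ** pd S v P x"

text \<open>Differentiating the constant \<open>transpose (P x) ** P x\<close> shows that the
  logarithmic derivative is skew.\<close>

lemma logd_so:
  assumes "smooth_on S P" "\<And>x. x \<in> S \<Longrightarrow> P x \<in> SO" "admissible S v" "x \<in> S"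
  shows "logd S P v x \<in> so" "pd S v P x = P x ** logd S P v x" "pd S v P x \<in> tangent_space (P x)"
proof -
  have sT: "smooth_on S (\<lambda>x. transpose (P x))" by (rule smooth_on_compose_linear[OF bounded_linear_transpose assms(1)])
  have "pd S v (\<lambda>x. transpose (P x) ** P x) x = pd S v (\<lambda>x. mat 1) x"
    by (rule pd_cong[OF assms(4)]) (simp add: SO_inverse assms(2))
  then have "transpose (P x) ** pd S v P x + transpose (pd S v P x) ** P x = 0"
    using pd_bilinear[OF bounded_bilinear_matrix_mult sT assms(1,3,4)]
      pd_linear[OF bounded_linear_transpose assms(1,3,4)] pd_const[OF assms(3,4)] by simp
  then show l: "logd S P v x \<in> so"
    by (simp add: logd_def so_def matrix_transpose_mul transpose_transpose add_eq_0_iff)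
  show e: "pd S v P x = P x ** logd S P v x" by (simp add: logd_def SO_cancel assms)
  show "pd S v P x \<in> tangent_space (P x)" unfolding e by (rule mult_tangent[OF l])
qed

lemma smooth_on_logd: "smooth_on S P \<Longrightarrow> admissible S v \<Longrightarrow> smooth_on S (logd S P v)"
  unfolding logd_def
  by (intro smooth_on_bilinear[OF bounded_bilinear_matrix_mult] smooth_on_pd smooth_on_compose_linear[OF bounded_linear_transpose])

lemma bilin_field_pd:
  assumes "bilin_field T" and P: "smooth_on S P" "\<And>x. x \<in> S \<Longrightarrow> P x \<in> SO"
    and "smooth_on S u" "smooth_on S v" "admissible S d" "x \<in> S"
  shows "pd S d (\<lambda>x. T (P x) (u x) (v x)) x =
    dir_deriv (\<lambda>B. T B (u x) (v x)) (P x) (P x ** logd S P d x) + T (P x) (pd S d u x) (v x) + T (P x) (u x) (pd S d v x)"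
proof -
  note e = assms(7)
  obtain P' where P': "(P has_derivative P') (at x within S)" "\<And>w. admissible S w \<Longrightarrow> pd S w P x = P' w"
    using pd_has_derivative[OF P(1) e] by (elim exE conjE) simp
  obtain u' where u': "(u has_derivative u') (at x within S)" "\<And>w. admissible S w \<Longrightarrow> pd S w u x = u' w"
    using pd_has_derivative[OF assms(4) e] by (elim exE conjE) simp
  obtain v' where v': "(v has_derivative v') (at x within S)" "\<And>w. admissible S w \<Longrightarrow> pd S w v x = v' w"
    using pd_has_derivative[OF assms(5) e] by (elim exE conjE) simp
  obtain D where D: "((\<lambda>x. T (P x) (u x) (v x)) has_derivative D) (at x within S)"
    "\<forall>h. P' h \<in> tangent_space (P x) \<longrightarrow>
      D h = dir_deriv (\<lambda>B. T B (u x) (v x)) (P x) (P' h) + T (P x) (u' h) (v x) + T (P x) (u x) (v' h)"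
    using bilin_field_deriv_aux[OF assms(1) P'(1) P(2) e u'(1) v'(1)] by auto
  have "P' d \<in> tangent_space (P x)" using logd_so(3)[OF P assms(6) e] P'(2)[OF assms(6)] by simp
  with D(2) have "D d = dir_deriv (\<lambda>B. T B (u x) (v x)) (P x) (pd S d P x) + T (P x) (pd S d u x) (v x) + T (P x) (u x) (pd S d v x)"
    by (simp add: P'(2) u'(2) v'(2) assms(6))
  then show ?thesis using pd_eqI[OF assms(6) e D(1)] logd_so(2)[OF P assms(6) e] by simp
qed

section \<open>The left-trivialised Levi-Civita connection\<close>

locale riem_so =
  fixes g :: "('n::finite) metric_tensor" and nab :: "'n connection"
  assumes metric: "riemannian_metric g" and levi_civita: "levi_civita g nab"
begin

section \<open>Vector fields on the group and the axioms of the connection\<close>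

lemma vector_field_left_invariant: "y \<in> so \<Longrightarrow> vector_field (left_invariant y)"
  unfolding vector_field_def left_invariant_def
  by (auto intro!: smooth_on_bilinear[OF bounded_bilinear_matrix_mult] smooth_on_ident smooth_on_const mult_tangent)

lemma vector_field_cong:
  "vector_field Y \<Longrightarrow> (\<And>B. B \<in> SO \<Longrightarrow> Z B = Y B) \<Longrightarrow> vector_field Z"
  unfolding vector_field_def using smooth_on_cong[of SO Y Z] by auto

lemma vector_field_zero: "vector_field (\<lambda>B. 0)"
  using vector_field_left_invariant[OF so_closed(4)] by (rule vector_field_cong) (simp add: left_invariant_def)

lemma vector_field_scaleR: "smooth_on SO f \<Longrightarrow> vector_field Y \<Longrightarrow> vector_field (\<lambda>B. f B *\<^sub>R Y B)"
  unfolding vector_field_def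
  by (auto simp: tangent_space_iff mm_simps so_closed intro!: smooth_on_scaleR)

lemma vector_field_add: "vector_field Y \<Longrightarrow> vector_field Z \<Longrightarrow> vector_field (\<lambda>B. Y B + Z B)"
  unfolding vector_field_def
  by (auto simp: tangent_space_iff mm_simps so_closed intro!: smooth_on_add)

lemma vector_field_sum: "(\<And>i. i \<in> I \<Longrightarrow> vector_field (Y i)) \<Longrightarrow> vector_field (\<lambda>B. \<Sum>i\<in>I. Y i B)"
  by (induction I rule: infinite_finite_induct) (auto simp: vector_field_zero intro: vector_field_add)

lemma aff: "affine_connection nab" "torsion_free nab" "metric_compatible g nab"
  using levi_civita by (simp_all add: levi_civita_def)

lemma nab_field: "vector_field X \<Longrightarrow> vector_field Y \<Longrightarrow> vector_field (\<lambda>A. nab Y A (X A))"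
  using aff(1)[unfolded affine_connection_def, THEN conjunct1] by blast

lemma nab_linear:
  assumes "vector_field Y" "A \<in> SO" "u \<in> tangent_space A" "v \<in> tangent_space A"
  shows "nab Y A (a *\<^sub>R u + b *\<^sub>R v) = a *\<^sub>R nab Y A u + b *\<^sub>R nab Y A v"
  using aff(1)[unfolded affine_connection_def, THEN conjunct2, THEN conjunct1] assms by blast

lemma nab_add:
  assumes "vector_field Y" "vector_field Z" "A \<in> SO" "u \<in> tangent_space A"
  shows "nab (\<lambda>B. Y B + Z B) A u = nab Y A u + nab Z A u"
  using aff(1)[unfolded affine_connection_def, THEN conjunct2, THEN conjunct2, THEN conjunct1] assms by blast

lemma nab_leibniz:
  assumes "smooth_on SO f" "vector_field Y" "A \<in> SO" "u \<in> tangent_space A"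
  shows "nab (\<lambda>B. f B *\<^sub>R Y B) A u = f A *\<^sub>R nab Y A u + dir_deriv f A u *\<^sub>R Y A"
  using aff(1)[unfolded affine_connection_def, THEN conjunct2, THEN conjunct2, THEN conjunct2] assms by blast

lemma nab_zero: "A \<in> SO \<Longrightarrow> u \<in> tangent_space A \<Longrightarrow> nab (\<lambda>B. 0) A u = 0"
  using nab_leibniz[OF smooth_on_const[of SO 0] vector_field_zero] by simp

text \<open>The axioms do not say that \<open>nab Y A u\<close> only depends on the values of \<open>Y\<close> on \<open>SO\<close>; this
  follows from the Leibniz rule with the indicator function of the complement of \<open>SO\<close>.\<close>

lemma nab_cong:
  assumes Y: "vector_field Y" and eq: "\<And>B. B \<in> SO \<Longrightarrow> Z B = Y B" and A: "A \<in> SO" "u \<in> tangent_space A"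
  shows "nab Z A u = nab Y A u"
proof -
  define D where "D B = Z B - Y B" for B
  define f where "f B = (if B \<in> SO then 0 else 1 :: real)" for B :: "'n sqmat"
  have D: "vector_field D" by (rule vector_field_cong[OF vector_field_zero]) (simp add: D_def eq)
  have f: "smooth_on SO f" by (rule smooth_on_cong[OF smooth_on_const[of SO 0]]) (simp add: f_def)
  have fD: "(\<lambda>B. f B *\<^sub>R D B) = D" by (auto simp: f_def D_def eq)
  have "nab D A u = 0" using nab_leibniz[OF f D A] unfolding fD by (simp add: f_def D_def A eq)
  moreover have "Z = (\<lambda>B. Y B + D B)" by (simp add: D_def)
  ultimately show ?thesis using nab_add[OF Y D A] by simp
qed

lemma nab_sum:
  assumes "finite I" "\<And>i. i \<in> I \<Longrightarrow> vector_field (Y i)" "A \<in> SO" "u \<in> tangent_space A"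
  shows "nab (\<lambda>B. \<Sum>i\<in>I. Y i B) A u = (\<Sum>i\<in>I. nab (Y i) A u)"
  using assms(1,2)
  by (induction I rule: finite_induct) (auto simp: nab_zero nab_add assms(3,4) vector_field_sum)

text \<open>\<open>Gam A x v\<close> and \<open>G A u v\<close> are the connection and the metric in the trivialisation
  \<open>x \<mapsto> A ** x\<close> of the tangent bundle. The projection \<open>skw\<close> makes them bilinear on all matrices.\<close>

definition Gam :: "'n sqmat \<Rightarrow> 'n sqmat \<Rightarrow> 'n sqmat \<Rightarrow> 'n sqmat" where
  "Gam A x v = transpose A ** nab (left_invariant (skw v)) A (A ** skw x)"

definition G :: "'n sqmat \<Rightarrow> 'n sqmat \<Rightarrow> 'n sqmat \<Rightarrow> real" where
  "G A u v = g A (A ** skw u) (A ** skw v)"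

lemma nab_left_invariant:
  assumes "A \<in> SO" "x \<in> so" "v \<in> so"
  shows "nab (left_invariant v) A (A ** x) = A ** Gam A x v"
  by (simp add: Gam_def skw_id assms SO_cancel)

lemma nab_left_field:
  "x \<in> so \<Longrightarrow> v \<in> so \<Longrightarrow> vector_field (\<lambda>A. nab (left_invariant v) A (A ** x))"
  using nab_field[OF vector_field_left_invariant vector_field_left_invariant, of x v]
  by (simp add: left_invariant_def[of x])

lemma Gam_so: "A \<in> SO \<Longrightarrow> Gam A x v \<in> so"
  using nab_left_field[OF skw_so[of x] skw_so[of v]] unfolding Gam_def vector_field_def
  by (simp add: tangent_space_iff)

lemma Gam_skw: "Gam A (skw x) v = Gam A x v" "Gam A x (skw v) = Gam A x v"
  by (simp_all add: Gam_def skw_id)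

text \<open>Homogeneity in the field argument is the Leibniz rule with a constant function.
  Smoothness holds because the connection maps vector fields to vector fields.\<close>

lemma bilin_field_Gam: "bilin_field Gam"
  unfolding bilin_field_def bilinear_def
proof (intro conjI ballI allI)
  fix A :: "'n sqmat" and x assume A: "A \<in> SO"
  have t: "A ** skw x \<in> tangent_space A" for x by (simp add: mult_tangent)
  show "linear (Gam A x)"
  proof (rule linearI)
    fix v w :: "'n sqmat" and r :: real
    have "left_invariant (skw (v + w)) = (\<lambda>B. left_invariant (skw v) B + left_invariant (skw w) B)"
      by (auto simp: left_invariant_def skw_add mm_simps)
    then show "Gam A x (v + w) = Gam A x v + Gam A x w"
      unfolding Gam_def using nab_add[OF vector_field_left_invariant vector_field_left_invariant A t]
      by (simp add: mm_simps)
    have "left_invariant (skw (r *\<^sub>R v)) = (\<lambda>B. r *\<^sub>R left_invariant (skw v) B)"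
      by (auto simp: left_invariant_def skw_scaleR mm_simps)
    then show "Gam A x (r *\<^sub>R v) = r *\<^sub>R Gam A x v"
      unfolding Gam_def using nab_leibniz[OF smooth_on_const[of SO r] vector_field_left_invariant A t]
      by (simp add: mm_simps dir_deriv_const[OF A])
  qed
next
  fix A :: "'n sqmat" and v assume A: "A \<in> SO"
  have t: "A ** skw x \<in> tangent_space A" for x by (simp add: mult_tangent)
  have l: "nab (left_invariant (skw v)) A (A ** skw (a *\<^sub>R x + b *\<^sub>R y)) =
    a *\<^sub>R nab (left_invariant (skw v)) A (A ** skw x) + b *\<^sub>R nab (left_invariant (skw v)) A (A ** skw y)" for a b x y
    using nab_linear[OF vector_field_left_invariant A t t] by (simp add: skw_add skw_scaleR mm_simps)
  show "linear (\<lambda>x. Gam A x v)"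
    using l[of 1 _ 1] l[of _ _ 0] by (intro linearI) (auto simp: Gam_def mm_simps)
next
  fix x v
  show "smooth_on SO (\<lambda>A. Gam A x v)"
    unfolding Gam_def using nab_left_field[OF skw_so[of x] skw_so[of v]] unfolding vector_field_def
    by (intro smooth_on_bilinear[OF bounded_bilinear_matrix_mult] smooth_on_compose_linear[OF bounded_linear_transpose] smooth_on_ident) auto
qed

section \<open>The metric in the trivialisation\<close>

lemma g_linear:
  assumes "A \<in> SO" "u \<in> tangent_space A" "v \<in> tangent_space A" "w \<in> tangent_space A"
  shows "g A (a *\<^sub>R u + b *\<^sub>R v) w = a * g A u w + b * g A v w"
  using metric[unfolded riemannian_metric_def, THEN conjunct1] assms by blast

lemma g_sym: "A \<in> SO \<Longrightarrow> u \<in> tangent_space A \<Longrightarrow> v \<in> tangent_space A \<Longrightarrow> g A u v = g A v u"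
  using metric[unfolded riemannian_metric_def, THEN conjunct2, THEN conjunct1] by blast

lemma g_pos: "A \<in> SO \<Longrightarrow> u \<in> tangent_space A \<Longrightarrow> u \<noteq> 0 \<Longrightarrow> g A u u > 0"
  using metric[unfolded riemannian_metric_def, THEN conjunct2, THEN conjunct2, THEN conjunct1] by blast

lemma G_sym: "A \<in> SO \<Longrightarrow> G A u v = G A v u"
  unfolding G_def by (rule g_sym) (auto intro: mult_tangent)

lemma G_pos: "A \<in> SO \<Longrightarrow> u \<in> so \<Longrightarrow> u \<noteq> 0 \<Longrightarrow> G A u u > 0"
  unfolding G_def by (rule g_pos) (auto simp: mult_tangent skw_id dest: SO_cancel(1)[of A u])

lemma bilin_field_G: "bilin_field G"
  unfolding bilin_field_def bilinear_def
proof (intro conjI ballI allI)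
  fix A :: "'n sqmat" and v assume A: "A \<in> SO"
  have t: "A ** skw x \<in> tangent_space A" for x by (simp add: mult_tangent)
  have l: "G A (a *\<^sub>R x + b *\<^sub>R y) v = a * G A x v + b * G A y v" for a b x y v
    using g_linear[OF A t t t] by (simp add: G_def skw_add skw_scaleR mm_simps)
  show l1: "linear (\<lambda>x. G A x v)" for v
    using l[of 1 _ 1] l[of _ _ 0] by (intro linearI) auto
  have "G A v = (\<lambda>x. G A x v)" by (rule ext, rule G_sym[OF A])
  then show "linear (G A v)" using l1[of v] by (simp only:)
next
  fix u v
  have "smooth_on SO (\<lambda>A. g A (left_invariant (skw u) A) (left_invariant (skw v) A))"
    using metric[unfolded riemannian_metric_def, THEN conjunct2, THEN conjunct2, THEN conjunct2]
      vector_field_left_invariant[OF skw_so[of u]] vector_field_left_invariant[OF skw_so[of v]] by blast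
  then show "smooth_on SO (\<lambda>A. G A u v)" by (simp add: G_def left_invariant_def)
qed

lemma Gam_bilinear: "A \<in> SO \<Longrightarrow> bilinear (Gam A)" and G_bilinear: "A \<in> SO \<Longrightarrow> bilinear (G A)"
  and Gam_smooth: "smooth_on SO (\<lambda>A. Gam A x v)" and G_smooth: "smooth_on SO (\<lambda>A. G A u w)"
  using bilin_field_Gam bilin_field_G by (auto simp: bilin_field_def)

lemmas Gam_simps = bilinear_ladd[OF Gam_bilinear] bilinear_radd[OF Gam_bilinear] bilinear_lsub[OF Gam_bilinear]
  bilinear_rsub[OF Gam_bilinear] bilinear_lmul[OF Gam_bilinear] bilinear_rmul[OF Gam_bilinear]
  bilinear_lneg[OF Gam_bilinear] bilinear_rneg[OF Gam_bilinear] bilinear_lzero[OF Gam_bilinear] bilinear_rzero[OF Gam_bilinear]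
lemmas G_simps = bilinear_ladd[OF G_bilinear] bilinear_radd[OF G_bilinear] bilinear_lsub[OF G_bilinear]
  bilinear_rsub[OF G_bilinear] bilinear_lmul[OF G_bilinear] bilinear_rmul[OF G_bilinear]
  bilinear_lneg[OF G_bilinear] bilinear_rneg[OF G_bilinear] bilinear_lzero[OF G_bilinear] bilinear_rzero[OF G_bilinear]

lemma G_eq_0: "A \<in> SO \<Longrightarrow> u \<in> so \<Longrightarrow> G A u u = 0 \<longleftrightarrow> u = 0"
  by (cases "u = 0") (use G_pos[of A u] in \<open>auto simp: G_simps\<close>)

lemma G_nonneg: "A \<in> SO \<Longrightarrow> u \<in> so \<Longrightarrow> G A u u \<ge> 0"
  using G_pos[of A u] by (cases "u = 0") (auto simp: G_simps)

text \<open>The bracket of two left-invariant fields is the left-invariant field of the matrix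
  commutator, because the derivative of \<open>B ** y\<close> along \<open>A ** x\<close> is
  \<open>A ** x ** y\<close>.\<close>

lemma torsion_Gam:
  assumes A: "A \<in> SO" and x: "x \<in> so" and y: "y \<in> so"
  shows "Gam A x y - Gam A y x = x ** y - y ** x"
proof -
  have dl: "dir_deriv (left_invariant y) A (A ** x) = A ** x ** y" if "x \<in> so" for x y
  proof -
    have "((\<lambda>B. B ** y) has_derivative (\<lambda>B. B ** y)) (at A within SO)"
      by (rule bounded_linear_imp_has_derivative[OF mm.bounded_linear_left])
    from dir_deriv_eqI[OF this A that] show ?thesis unfolding left_invariant_def .
  qed
  have "nab (left_invariant y) A (left_invariant x A) - nab (left_invariant x) A (left_invariant y A)
      = lie_bracket (left_invariant x) (left_invariant y) A"
    using aff(2)[unfolded torsion_free_def] A vector_field_left_invariant[OF x] vector_field_left_invariant[OF y]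
    by blast
  also have "\<dots> = A ** (x ** y - y ** x)"
    unfolding lie_bracket_def left_invariant_def[of x A] left_invariant_def[of y A] dl[OF x] dl[OF y]
    by (simp add: mm_simps matrix_mul_assoc)
  finally have "A ** (Gam A x y - Gam A y x) = A ** (x ** y - y ** x)"
    by (simp add: left_invariant_def[of _ A] nab_left_invariant A x y mm_simps)
  then show ?thesis by (metis SO_cancel(1)[OF A])
qed

lemma dir_deriv_G:
  assumes A: "A \<in> SO" and x: "x \<in> so"
  shows "dir_deriv (\<lambda>B. G B u v) A (A ** x) = G A (Gam A x u) v + G A u (Gam A x v)"
proof -
  have "dir_deriv (\<lambda>B. g B (left_invariant (skw u) B) (left_invariant (skw v) B)) A (A ** x) =
    g A (nab (left_invariant (skw u)) A (A ** x)) (left_invariant (skw v) A) +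
    g A (left_invariant (skw u) A) (nab (left_invariant (skw v)) A (A ** x))"
    using aff(3)[unfolded metric_compatible_def] A vector_field_left_invariant[OF skw_so[of u]]
      vector_field_left_invariant[OF skw_so[of v]] mult_tangent[OF x, of A]
    by blast
  then show ?thesis
    by (simp add: left_invariant_def[of _ A] nab_left_invariant A x Gam_skw)
       (simp add: G_def skw_id Gam_so A left_invariant_def)
qed

text \<open>The field is written as a combination of left-invariant fields with smooth coefficients,
  to which the Leibniz rule applies. The standard basis matrices are not skew, so their projections
  serve as a spanning family.\<close>

lemma nab_trivialised:
  assumes W: "smooth_on SO W" "\<And>B. B \<in> SO \<Longrightarrow> W B \<in> so" and A: "A \<in> SO" and x: "x \<in> so"
  shows "nab (\<lambda>B. B ** W B) A (A ** x) = A ** (dir_deriv W A (A ** x) + Gam A x (W A))"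
proof -
  let ?f = "\<lambda>e B. W B \<bullet> e"
  let ?Y = "\<lambda>B. \<Sum>e\<in>Basis. ?f e B *\<^sub>R left_invariant (skw e) B"
  have t: "A ** x \<in> tangent_space A" using x by (rule mult_tangent)
  have sf: "smooth_on SO (?f e)" for e by (intro smooth_on_inner W smooth_on_const)
  have vf: "vector_field (\<lambda>B. ?f e B *\<^sub>R left_invariant (skw e) B)" for e
    by (intro vector_field_scaleR vector_field_left_invariant sf skw_so)
  have expand: "skw V = (\<Sum>e\<in>Basis. (V \<bullet> e) *\<^sub>R skw e)" for V :: "'n sqmat"
    by (rule linear_eq_sum_Basis[OF bounded_linear.linear[OF bounded_linear_skw]])
  have "nab (\<lambda>B. B ** W B) A (A ** x) = nab ?Y A (A ** x)"
  proof (rule nab_cong[OF vector_field_sum[OF vf] _ A t])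
    fix B :: "'n sqmat" assume "B \<in> SO"
    then have "W B = (\<Sum>e\<in>Basis. (W B \<bullet> e) *\<^sub>R skw e)" using expand[of "W B"] W(2) by (simp add: skw_id)
    then have "B ** W B = B ** (\<Sum>e\<in>Basis. (W B \<bullet> e) *\<^sub>R skw e)" by (rule arg_cong)
    then show "B ** W B = ?Y B" by (simp add: mm.sum_right mm_simps left_invariant_def)
  qed
  also have "\<dots> = (\<Sum>e\<in>Basis. ?f e A *\<^sub>R (A ** Gam A x e) + (dir_deriv W A (A ** x) \<bullet> e) *\<^sub>R (A ** skw e))"
  proof (subst nab_sum[OF finite_Basis vf A t], rule sum.cong[OF refl])
    fix e :: "'n sqmat"
    have "dir_deriv (?f e) A (A ** x) = dir_deriv W A (A ** x) \<bullet> e"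
      by (rule dir_deriv_linear_image[OF bounded_linear_inner_left W(1) A x])
    then show "nab (\<lambda>B. ?f e B *\<^sub>R left_invariant (skw e) B) A (A ** x) =
        ?f e A *\<^sub>R (A ** Gam A x e) + (dir_deriv W A (A ** x) \<bullet> e) *\<^sub>R (A ** skw e)"
      by (simp add: nab_leibniz[OF sf vector_field_left_invariant[OF skw_so] A t] nab_left_invariant A x
          Gam_skw left_invariant_def[of _ A])
  qed
  also have "\<dots> = A ** ((\<Sum>e\<in>Basis. (W A \<bullet> e) *\<^sub>R Gam A x e) + skw (dir_deriv W A (A ** x)))"
    unfolding expand[of "dir_deriv W A (A ** x)"] by (simp add: mm.sum_right mm_simps sum.distrib)
  also have "(\<Sum>e\<in>Basis. (W A \<bullet> e) *\<^sub>R Gam A x e) = Gam A x (W A)"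
    using linear_eq_sum_Basis[of "Gam A x" "W A"] Gam_bilinear[OF A] by (simp add: bilinear_def)
  \<comment> \<open>A map with values in \<open>so\<close> on \<open>SO\<close> is fixed by the
    linear projection, and so is its derivative in tangent directions.\<close>
  also have "skw (dir_deriv W A (A ** x)) = dir_deriv W A (A ** x)"
    using dir_deriv_linear_image[OF bounded_linear_skw W(1) A x, symmetric]
      dir_deriv_cong[OF W(1) A x, of "\<lambda>B. skw (W B)"] W(2) by (simp add: skw_id)
  finally show ?thesis by (simp add: add.commute)
qed

subsection \<open>Curvature\<close>

definition DG :: "'n sqmat \<Rightarrow> 'n sqmat \<Rightarrow> 'n sqmat \<Rightarrow> 'n sqmat \<Rightarrow> 'n sqmat" where
  "DG A x y z = dir_deriv (\<lambda>B. Gam B y z) A (A ** skw x)"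

text \<open>The curvature in the trivialisation. For left-invariant fields the first covariant
  derivative \<open>Gam B y z\<close> still varies with the base point, which is the origin of the
  \<open>DG\<close> terms; the last term is the connection along the bracket.\<close>

definition K :: "'n sqmat \<Rightarrow> 'n sqmat \<Rightarrow> 'n sqmat \<Rightarrow> 'n sqmat \<Rightarrow> 'n sqmat" where
  "K A x y z = DG A x y z + Gam A x (Gam A y z) - (DG A y x z + Gam A y (Gam A x z))
     - Gam A (skw x ** skw y - skw y ** skw x) z"

lemma DG_so: "A \<in> SO \<Longrightarrow> DG A x y z \<in> so"
proof -
  assume A: "A \<in> SO"
  have "skw (DG A x y z) = DG A x y z" unfolding DG_def
    using dir_deriv_linear_image[OF bounded_linear_skw Gam_smooth A skw_so, symmetric]
      dir_deriv_cong[OF Gam_smooth A skw_so, of "\<lambda>B. skw (Gam B y z)"] by (simp add: skw_id Gam_so)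
  then show ?thesis using skw_so by metis
qed

lemma K_so: "A \<in> SO \<Longrightarrow> K A x y z \<in> so"
  unfolding K_def by (intro so_closed DG_so Gam_so)

lemma DG_linear:
  assumes A: "A \<in> SO"
  shows "linear (\<lambda>x. DG A x y z)" "linear (\<lambda>y. DG A x y z)" "linear (\<lambda>z. DG A x y z)"
proof -
  have l: "linear (dir_deriv (\<lambda>B. Gam B y z) A)" by (rule linear_dir_deriv[OF Gam_smooth A])
  show "linear (\<lambda>x. DG A x y z)"
    by (rule linearI) (auto simp: DG_def skw_add skw_scaleR mm_simps linear_add[OF l] linear_cmul[OF l])
  show "linear (\<lambda>y. DG A x y z)"
  proof (rule linearI)
    show "DG A x (y + y') z = DG A x y z + DG A x y' z" for y y'
      unfolding DG_def dir_deriv_add[OF Gam_smooth Gam_smooth A skw_so, symmetric]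
      by (rule dir_deriv_cong[OF smooth_on_add[OF Gam_smooth Gam_smooth] A skw_so]) (simp add: Gam_simps)
    show "DG A x (r *\<^sub>R y) z = r *\<^sub>R DG A x y z" for r y
      unfolding DG_def dir_deriv_linear_image[OF bounded_linear_scaleR_right Gam_smooth A skw_so, symmetric]
      by (rule dir_deriv_cong[OF smooth_on_scaleR[OF smooth_on_const Gam_smooth] A skw_so]) (simp add: Gam_simps)
  qed
  show "linear (\<lambda>z. DG A x y z)"
  proof (rule linearI)
    show "DG A x y (z + z') = DG A x y z + DG A x y z'" for z z'
      unfolding DG_def dir_deriv_add[OF Gam_smooth Gam_smooth A skw_so, symmetric]
      by (rule dir_deriv_cong[OF smooth_on_add[OF Gam_smooth Gam_smooth] A skw_so]) (simp add: Gam_simps)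
    show "DG A x y (r *\<^sub>R z) = r *\<^sub>R DG A x y z" for r z
      unfolding DG_def dir_deriv_linear_image[OF bounded_linear_scaleR_right Gam_smooth A skw_so, symmetric]
      by (rule dir_deriv_cong[OF smooth_on_scaleR[OF smooth_on_const Gam_smooth] A skw_so]) (simp add: Gam_simps)
  qed
qed

text \<open>\<open>DG\<close> is trilinear: for a fixed last argument it is a field of bilinear
  maps, and the last argument is then expanded in the standard basis.\<close>

lemma smooth_on_K:
  assumes P: "smooth_on S P" "\<And>x. x \<in> S \<Longrightarrow> P x \<in> SO"
    and "smooth_on S u" "smooth_on S v" "smooth_on S w"
  shows "smooth_on S (\<lambda>x. K (P x) (u x) (v x) (w x))"
proof -
  have b: "bilin_field (\<lambda>A x y. DG A x y z)" for z
    unfolding bilin_field_def bilinear_def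
  proof (intro conjI ballI allI)
    show "smooth_on SO (\<lambda>A. DG A x y z)" for x y
      unfolding DG_def by (rule dir_deriv_commutator(1)[OF Gam_smooth skw_so])
  qed (use DG_linear in auto)
  have D: "smooth_on S (\<lambda>x. DG (P x) (u x) (v x) (w x))"
    if u: "smooth_on S u" and v: "smooth_on S v" and w: "smooth_on S w" for u v w
  proof (rule smooth_on_cong)
    show "smooth_on S (\<lambda>x. \<Sum>c\<in>Basis. (w x \<bullet> c) *\<^sub>R DG (P x) (u x) (v x) c)"
      by (intro smooth_on_sum smooth_on_scaleR smooth_on_inner smooth_on_const w bilin_field_smooth[OF b P u v])
    fix x assume "x \<in> S"
    then show "(\<Sum>c\<in>Basis. (w x \<bullet> c) *\<^sub>R DG (P x) (u x) (v x) c) = DG (P x) (u x) (v x) (w x)"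
      using linear_eq_sum_Basis[OF DG_linear(3)[OF P(2)], of x "u x" "v x" "w x"] by simp
  qed
  note s = smooth_on_compose_linear[OF bounded_linear_skw]
  show ?thesis unfolding K_def
    by (intro smooth_on_add smooth_on_diff D bilin_field_smooth[OF bilin_field_Gam P]
        smooth_on_bilinear[OF bounded_bilinear_matrix_mult] s assms)
qed

text \<open>The inner covariant derivative agrees on \<open>SO\<close> with the field
  \<open>B ** Gam B y z\<close>, to which \<open>nab_trivialised\<close> applies with a non-constant
  coefficient map.\<close>

lemma curvature_eq_K:
  assumes A: "A \<in> SO" and x: "x \<in> so" and y: "y \<in> so" and z: "z \<in> so"
  shows "curvature nab A (A ** x) (A ** y) (A ** z) = A ** K A x y z"
proof -
  have e: "nab (\<lambda>B. nab (left_invariant z) B (left_invariant y B)) A (left_invariant x A)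
      = A ** (DG A x y z + Gam A x (Gam A y z))" if "x \<in> so" "y \<in> so" for x y
  proof -
    have f: "vector_field (\<lambda>B. nab (left_invariant z) B (left_invariant y B))"
      by (intro nab_field vector_field_left_invariant that z)
    have "nab (\<lambda>B. B ** Gam B y z) A (A ** x) = nab (\<lambda>B. nab (left_invariant z) B (left_invariant y B)) A (A ** x)"
      by (rule nab_cong[OF f _ A mult_tangent[OF that(1)]]) (simp add: left_invariant_def[of y] nab_left_invariant that z)
    then show ?thesis
      using nab_trivialised[OF Gam_smooth Gam_so A that(1), of y z]
      by (simp add: left_invariant_def[of x] DG_def skw_id that)
  qed
  have dl: "dir_deriv (left_invariant y) A (A ** x) = A ** x ** y" if "x \<in> so" for x y
  proof -
    have "((\<lambda>B. B ** y) has_derivative (\<lambda>B. B ** y)) (at A within SO)"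
      by (rule bounded_linear_imp_has_derivative[OF mm.bounded_linear_left])
    from dir_deriv_eqI[OF this A that] show ?thesis unfolding left_invariant_def .
  qed
  have "lie_bracket (left_invariant x) (left_invariant y) A = A ** (x ** y - y ** x)"
    unfolding lie_bracket_def left_invariant_def[of x A] left_invariant_def[of y A] dl[OF x] dl[OF y]
    by (simp add: mm_simps matrix_mul_assoc)
  then have "nab (left_invariant z) A (lie_bracket (left_invariant x) (left_invariant y) A) = A ** Gam A (x ** y - y ** x) z"
    by (simp add: nab_left_invariant[OF A so_commutator[OF x y] z])
  then show ?thesis
    unfolding curvature_def curvature_op_def SO_cancel[OF A] e[OF x y] e[OF y x] K_def
    by (simp add: mm_simps skw_id x y)
qed

section \<open>Symmetries of the curvature\<close>

lemma K_antisym: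
  assumes A: "A \<in> SO"
  shows "K A y x z = - K A x y z"
proof -
  have "skw y ** skw x - skw x ** skw y = - (skw x ** skw y - skw y ** skw x)" by simp
  then show ?thesis unfolding K_def by (simp only: Gam_simps[OF A]) simp
qed

text \<open>By torsion-freeness \<open>Gam B y z - Gam B z y\<close> is the commutator of
  \<open>y\<close> and \<open>z\<close>, independent of the base point, so the \<open>DG\<close>
  terms cancel. The remaining terms are nested commutators that vanish by the Jacobi
  identity.\<close>

lemma K_bianchi:
  assumes A: "A \<in> SO" and x: "x \<in> so" and y: "y \<in> so" and z: "z \<in> so"
  shows "K A x y z + K A y z x + K A z x y = 0"
proof -
  have D: "DG A x y z = DG A x z y" if "x \<in> so" "y \<in> so" "z \<in> so" for x y z
  proof -
    have "dir_deriv (\<lambda>B. Gam B y z - Gam B z y) A (A ** x) = dir_deriv (\<lambda>B. y ** z - z ** y) A (A ** x)"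
      by (rule dir_deriv_cong[OF smooth_on_const A that(1)]) (simp add: torsion_Gam that)
    then show ?thesis unfolding DG_def skw_id[OF that(1)]
      using dir_deriv_diff[OF Gam_smooth[of y z] Gam_smooth[of z y] A that(1)]
        dir_deriv_const[OF A that(1), of "y ** z - z ** y"] by simp
  qed
  have T: "Gam A x (Gam A y z) - Gam A x (Gam A z y) - Gam A (y ** z - z ** y) x
      = x ** (y ** z - z ** y) - (y ** z - z ** y) ** x" if "x \<in> so" "y \<in> so" "z \<in> so" for x y z
    using torsion_Gam[OF A that(1) so_commutator[OF that(2,3)]] torsion_Gam[OF A that(2,3)]
    by (simp add: Gam_simps[OF A, symmetric])
  have "K A x y z + K A y z x + K A z x y =
      (Gam A x (Gam A y z) - Gam A x (Gam A z y) - Gam A (y ** z - z ** y) x)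
    + (Gam A y (Gam A z x) - Gam A y (Gam A x z) - Gam A (z ** x - x ** z) y)
    + (Gam A z (Gam A x y) - Gam A z (Gam A y x) - Gam A (x ** y - y ** x) z)"
    unfolding K_def by (simp add: skw_id x y z D)
  also have "\<dots> = 0"
    unfolding T[OF x y z] T[OF y z x] T[OF z x y] by (simp add: mm_simps matrix_mul_assoc)
  finally show ?thesis .
qed

text \<open>The function \<open>G B z w\<close> is differentiated along the left-invariant fields of
  \<open>x\<close> and \<open>y\<close> in both orders. The mixed products of two \<open>Gam\<close>
  terms are symmetric and cancel, and the commutator of the derivatives supplies the bracket term of
  the curvature.\<close>

lemma K_skew:
  assumes A: "A \<in> SO" and x: "x \<in> so" and y: "y \<in> so"
  shows "G A (K A x y z) w = - G A z (K A x y w)"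
proof -
  have e: "dir_deriv (\<lambda>B. dir_deriv (\<lambda>B. G B z w) B (B ** y)) A (A ** x) =
      G A (DG A x y z + Gam A x (Gam A y z)) w + G A (Gam A y z) (Gam A x w)
    + G A (Gam A x z) (Gam A y w) + G A z (DG A x y w + Gam A x (Gam A y w))"
    if x: "x \<in> so" and y: "y \<in> so" for x y
  proof -
    have s1: "smooth_on SO (\<lambda>B. G B (Gam B y z) w)" "smooth_on SO (\<lambda>B. G B z (Gam B y w))"
      by (intro bilin_field_smooth[OF bilin_field_G] smooth_on_ident Gam_smooth smooth_on_const; simp)+
    have "dir_deriv (\<lambda>B. dir_deriv (\<lambda>B. G B z w) B (B ** y)) A (A ** x)
      = dir_deriv (\<lambda>B. G B (Gam B y z) w + G B z (Gam B y w)) A (A ** x)"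
      by (rule dir_deriv_cong[OF smooth_on_add[OF s1] A x]) (simp add: dir_deriv_G y)
    also have "\<dots> = dir_deriv (\<lambda>B. G B (Gam B y z) w) A (A ** x) + dir_deriv (\<lambda>B. G B z (Gam B y w)) A (A ** x)"
      by (rule dir_deriv_add[OF s1 A x])
    finally show ?thesis
      unfolding bilin_field_dir_deriv[OF bilin_field_G Gam_smooth smooth_on_const A x]
        bilin_field_dir_deriv[OF bilin_field_G smooth_on_const Gam_smooth A x]
        dir_deriv_G[OF A x] dir_deriv_const[OF A x]
      by (simp add: DG_def skw_id x G_simps A)
  qed
  have "dir_deriv (\<lambda>B. dir_deriv (\<lambda>B. G B z w) B (B ** y)) A (A ** x) -
      dir_deriv (\<lambda>B. dir_deriv (\<lambda>B. G B z w) B (B ** x)) A (A ** y) =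
      G A (Gam A (x ** y - y ** x) z) w + G A z (Gam A (x ** y - y ** x) w)"
    unfolding dir_deriv_commutator(2)[OF G_smooth A x y] dir_deriv_G[OF A so_commutator[OF x y]] ..
  then show ?thesis unfolding e[OF x y] e[OF y x] K_def skw_id[OF x] skw_id[OF y]
    by (simp add: G_simps A)
qed

text \<open>The usual octahedron argument: four instances of the Bianchi identity are combined with
  the two antisymmetries.\<close>

lemma K_pair:
  assumes A: "A \<in> SO" and s: "x \<in> so" "y \<in> so" "z \<in> so" "w \<in> so"
  shows "G A (K A x y z) w = G A (K A z w x) y"
proof -
  define R where "R x y z w = G A (K A x y z) w" for x y z w
  have a1: "R y x z w = - R x y z w" for x y z w
    by (simp add: R_def K_antisym[OF A, of y x z] G_simps A)
  have a2: "R x y w z = - R x y z w" if "x \<in> so" "y \<in> so" for x y z w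
    unfolding R_def using K_skew[OF A that, of w z] G_sym[OF A] by simp
  have b: "R x y z w + R y z x w + R z x y w = 0" if "x \<in> so" "y \<in> so" "z \<in> so" for x y z w
    unfolding R_def using arg_cong[OF K_bianchi[OF A that], of "\<lambda>k. G A k w"] by (simp add: G_simps A)
  show ?thesis
    using b[OF s(1,2,3), of w] b[OF s(2,3,4), of x] b[OF s(3,4,1), of y] b[OF s(4,1,2), of z]
      a2[OF s(2,3), of x w] a2[OF s(3,4), of x y] a2[OF s(4,2), of x z] a2[OF s(4,1), of y z]
      a2[OF s(1,3), of y w] a2[OF s(1,2), of z w] a1[of w y x z] a1[of x z y w]
    unfolding R_def by linarith
qed

subsection \<open>Covariant derivatives of families of Lie algebra elements\<close>

text \<open>The covariant derivative of the field \<open>P x ** w x\<close> along the map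
  \<open>P\<close> in direction \<open>d\<close>, translated back to the identity.\<close>

definition cov :: "'a::real_normed_vector set \<Rightarrow> ('a \<Rightarrow> 'n sqmat) \<Rightarrow> 'a \<Rightarrow> ('a \<Rightarrow> 'n sqmat) \<Rightarrow> 'a \<Rightarrow> 'n sqmat" where
  "cov S P d w x = pd S d w x + Gam (P x) (logd S P d x) (w x)"

lemma pd_so:
  assumes "smooth_on S w" "\<And>x. x \<in> S \<Longrightarrow> w x \<in> so" "admissible S d" "x \<in> S"
  shows "pd S d w x \<in> so"
proof -
  have "skw (pd S d w x) = pd S d (\<lambda>x. skw (w x)) x"
    using pd_linear[OF bounded_linear_skw assms(1,3,4)] by simp
  also have "\<dots> = pd S d w x" by (rule pd_cong[OF assms(4)]) (simp add: skw_id assms(2))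
  finally show ?thesis using skw_so by metis
qed

lemma cov_so:
  assumes "smooth_on S w" "\<And>x. x \<in> S \<Longrightarrow> w x \<in> so" "\<And>x. x \<in> S \<Longrightarrow> P x \<in> SO" "admissible S d" "x \<in> S"
  shows "cov S P d w x \<in> so"
  unfolding cov_def by (intro so_closed pd_so assms Gam_so)

lemma smooth_on_cov:
  assumes P: "smooth_on S P" "\<And>x. x \<in> S \<Longrightarrow> P x \<in> SO" and "smooth_on S w" "admissible S d"
  shows "smooth_on S (cov S P d w)"
  unfolding cov_def
  by (intro smooth_on_add smooth_on_pd bilin_field_smooth[OF bilin_field_Gam P] smooth_on_logd assms)

lemma pd_G:
  assumes P: "smooth_on S P" "\<And>x. x \<in> S \<Longrightarrow> P x \<in> SO"
    and "smooth_on S u" "smooth_on S w" "admissible S d" "x \<in> S"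
  shows "pd S d (\<lambda>x. G (P x) (u x) (w x)) x = G (P x) (cov S P d u x) (w x) + G (P x) (u x) (cov S P d w x)"
proof -
  have Px: "P x \<in> SO" using P assms by auto
  have "pd S d (\<lambda>x. G (P x) (u x) (w x)) x = dir_deriv (\<lambda>B. G B (u x) (w x)) (P x) (P x ** logd S P d x)
      + G (P x) (pd S d u x) (w x) + G (P x) (u x) (pd S d w x)"
    by (rule bilin_field_pd[OF bilin_field_G assms])
  then show ?thesis
    using dir_deriv_G[OF Px, of "logd S P d x"] logd_so(1)[OF P assms(5,6)]
    by (simp add: G_simps Px cov_def)
qed

text \<open>The Maurer-Cartan equation. In each mixed derivative the second partial of
  \<open>P\<close> is symmetric, and differentiating the transposed factor leaves a product of two
  logarithmic derivatives.\<close>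

lemma pd_logd:
  assumes P: "smooth_on S P" "\<And>x. x \<in> S \<Longrightarrow> P x \<in> SO" and ab: "admissible S a" "admissible S b" and x: "x \<in> S"
  shows "pd S a (logd S P b) x - pd S b (logd S P a) x =
    - (logd S P a x ** logd S P b x - logd S P b x ** logd S P a x)"
proof -
  have e: "pd S a (logd S P b) x = transpose (P x) ** pd S a (pd S b P) x - logd S P a x ** logd S P b x"
    if a: "admissible S a" and b: "admissible S b" for a b
  proof -
    have "pd S a (logd S P b) x = transpose (P x) ** pd S a (pd S b P) x + transpose (pd S a P x) ** pd S b P x"
      unfolding logd_def
      using pd_bilinear[OF bounded_bilinear_matrix_mult smooth_on_compose_linear[OF bounded_linear_transpose P(1)] smooth_on_pd[OF P(1) b] a x]
        pd_linear[OF bounded_linear_transpose P(1) a x] by simp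
    also have "transpose (pd S a P x) ** pd S b P x = transpose (logd S P a x) ** (transpose (P x) ** (P x ** logd S P b x))"
      using logd_so(2)[OF P a x] logd_so(2)[OF P b x] by (simp add: matrix_transpose_mul matrix_mul_assoc)
    also have "\<dots> = - (logd S P a x ** logd S P b x)"
      using logd_so(1)[OF P a x] by (simp add: SO_cancel P(2) x so_def mm_simps)
    finally show ?thesis by simp
  qed
  show ?thesis unfolding e[OF ab] e[OF ab(2,1)] using pd_commute[OF P(1) ab x] by simp
qed

text \<open>The commutator in the Maurer-Cartan equation cancels against the one in
  \<open>torsion_Gam\<close>.\<close>

lemma cov_logd_commute:
  assumes P: "smooth_on S P" "\<And>x. x \<in> S \<Longrightarrow> P x \<in> SO" and ab: "admissible S a" "admissible S b" and x: "x \<in> S"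
  shows "cov S P a (logd S P b) x = cov S P b (logd S P a) x"
proof -
  have "cov S P a (logd S P b) x - cov S P b (logd S P a) x =
      (pd S a (logd S P b) x - pd S b (logd S P a) x)
      + (Gam (P x) (logd S P a x) (logd S P b x) - Gam (P x) (logd S P b x) (logd S P a x))"
    unfolding cov_def by simp
  also have "\<dots> = 0"
  proof -
    have h1: "pd S a (logd S P b) x - pd S b (logd S P a) x =
        - (logd S P a x ** logd S P b x - logd S P b x ** logd S P a x)" by (rule pd_logd[OF assms])
    have "logd S P a x \<in> so" "logd S P b x \<in> so"
      using logd_so(1)[OF P ab(1) x] logd_so(1)[OF P ab(2) x] by simp_all
    note h2 = torsion_Gam[OF P(2)[OF x] this]
    show ?thesis unfolding h1 h2 by simp
  qed
  finally show ?thesis by simp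
qed

text \<open>Second partials of \<open>w\<close> and the cross terms with one derivative of
  \<open>w\<close> are symmetric in \<open>a\<close> and \<open>b\<close>. The Maurer-Cartan
  equation turns the derivatives of the logarithmic derivatives into the bracket term of
  \<open>K\<close>.\<close>

lemma cov_commutator:
  assumes P: "smooth_on S P" "\<And>x. x \<in> S \<Longrightarrow> P x \<in> SO" and ab: "admissible S a" "admissible S b" and x: "x \<in> S"
    and w: "smooth_on S w"
  shows "cov S P a (cov S P b w) x - cov S P b (cov S P a w) x = K (P x) (logd S P a x) (logd S P b x) (w x)"
proof -
  have Px: "P x \<in> SO" by (rule P(2)[OF x])
  have e: "cov S P a (cov S P b w) x = pd S a (pd S b w) x
      + (DG (P x) (logd S P a x) (logd S P b x) (w x) + Gam (P x) (pd S a (logd S P b) x) (w x)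
         + Gam (P x) (logd S P b x) (pd S a w x))
      + (Gam (P x) (logd S P a x) (pd S b w x) + Gam (P x) (logd S P a x) (Gam (P x) (logd S P b x) (w x)))"
    if a: "admissible S a" and b: "admissible S b" for a b
  proof -
    have "pd S a (cov S P b w) x = pd S a (pd S b w) x + pd S a (\<lambda>x. Gam (P x) (logd S P b x) (w x)) x"
      unfolding cov_def[abs_def]
      by (intro pd_add a x smooth_on_pd w b bilin_field_smooth[OF bilin_field_Gam P] smooth_on_logd P(1))
    also have "pd S a (\<lambda>x. Gam (P x) (logd S P b x) (w x)) x = DG (P x) (logd S P a x) (logd S P b x) (w x)
        + Gam (P x) (pd S a (logd S P b) x) (w x) + Gam (P x) (logd S P b x) (pd S a w x)"
      using bilin_field_pd[OF bilin_field_Gam P smooth_on_logd[OF P(1) b] w a x]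
      by (simp add: DG_def skw_id logd_so(1)[OF P a x])
    finally show ?thesis unfolding cov_def[of S P a] by (simp only: cov_def[of S P b w x] Gam_simps[OF Px])
  qed
  have h1: "pd S a (logd S P b) x - pd S b (logd S P a) x =
      - (logd S P a x ** logd S P b x - logd S P b x ** logd S P a x)" by (rule pd_logd[OF P ab x])
  have "Gam (P x) (pd S a (logd S P b) x) (w x) - Gam (P x) (pd S b (logd S P a) x) (w x) =
      - Gam (P x) (logd S P a x ** logd S P b x - logd S P b x ** logd S P a x) (w x)"
    unfolding Gam_simps(3)[OF Px, symmetric] h1 by (rule Gam_simps(7)[OF Px])
  then show ?thesis
    unfolding e[OF ab] e[OF ab(2,1)] K_def
    using pd_commute[OF w ab x] logd_so(1)[OF P ab(1) x] logd_so(1)[OF P ab(2) x]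
    by (simp add: skw_id algebra_simps)
qed

section \<open>Comparison with the covariant derivative along a single curve\<close>

lemma covariant_deriv_trivialised:
  assumes "p s \<in> SO" "transpose (p s) ** V s \<in> so" "transpose (p s) ** velocity p s \<in> so"
  shows "covariant_deriv nab p V s = p s ** (velocity (\<lambda>r. transpose (p r) ** V r) s
    + Gam (p s) (transpose (p s) ** velocity p s) (transpose (p s) ** V s))"
proof -
  have "nab (left_invariant (transpose (p s) ** V s)) (p s) (p s ** (transpose (p s) ** velocity p s))
     = p s ** Gam (p s) (transpose (p s) ** velocity p s) (transpose (p s) ** V s)"
    by (rule nab_left_invariant[OF assms(1,3,2)])
  then show ?thesis unfolding covariant_deriv_def SO_cancel(2)[OF assms(1)]
    by (simp add: left_invariant_def mm_simps)
qed

text \<open>The curve and the field are restrictions of a family to a unit segment in direction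
  \<open>d\<close>, so one-variable derivatives become values of \<open>pd\<close>.\<close>

lemma covariant_deriv_cov:
  assumes P: "smooth_on S P" "\<And>x. x \<in> S \<Longrightarrow> P x \<in> SO" and w: "smooth_on S w" "\<And>x. x \<in> S \<Longrightarrow> w x \<in> so"
    and d: "admissible S d" and line: "\<And>r. r \<in> {0..1} \<Longrightarrow> x + r *\<^sub>R d \<in> S"
    and p: "\<And>r. r \<in> {0..1} \<Longrightarrow> p r = P (x + r *\<^sub>R d)"
    and V: "\<And>r. r \<in> {0..1} \<Longrightarrow> V r = P (x + r *\<^sub>R d) ** w (x + r *\<^sub>R d)" and s: "s \<in> {0..1}"
  shows "covariant_deriv nab p V s = P (x + s *\<^sub>R d) ** cov S P d w (x + s *\<^sub>R d)"
    "velocity p s = P (x + s *\<^sub>R d) ** logd S P d (x + s *\<^sub>R d)"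
proof -
  let ?x = "x + s *\<^sub>R d"
  note xS = line[OF s]
  have "velocity p s = pd S d P ?x" by (rule velocity_pd[OF P(1) d _ s]) (use line p in auto)
  then show v: "velocity p s = P ?x ** logd S P d ?x" using logd_so(2)[OF P d xS] by simp
  have V': "velocity (\<lambda>r. transpose (p r) ** V r) s = pd S d w ?x"
    by (rule velocity_pd[OF w(1) d _ s]) (use line p V in \<open>auto simp: SO_cancel P\<close>)
  have "p s \<in> SO" "transpose (p s) ** V s \<in> so" "transpose (p s) ** velocity p s \<in> so"
    using P(2)[OF xS] w(2)[OF xS] logd_so(1)[OF P d xS] by (simp_all add: v p[OF s] V[OF s] SO_cancel)
  from covariant_deriv_trivialised[where p=p and V=V and s=s, OF this]
  show "covariant_deriv nab p V s = P ?x ** cov S P d w ?x"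
    unfolding V' v p[OF s] V[OF s] cov_def by (simp add: SO_cancel P(2) xS)
qed

lemma riem_norm_square: "A \<in> SO \<Longrightarrow> u \<in> so \<Longrightarrow> (riem_norm g A (A ** u))\<^sup>2 = G A u u"
  using G_nonneg[of A u] by (simp add: riem_norm_def G_def skw_id)

end

section \<open>The first variation of the energy\<close>

lemma admissible_interval:
  "admissible {0..1::real} 1" "\<epsilon> > 0 \<Longrightarrow> admissible {-\<epsilon><..<\<epsilon>::real} 1"
proof -
  show "admissible {0..1::real} 1"
  proof (rule admissibleI)
    fix x :: real assume "x \<in> {0..1}"
    then show "\<exists>d. d \<noteq> 0 \<and> x + d *\<^sub>R 1 \<in> {0..1}"
      by (intro exI[of _ "if x = 0 then 1 else -x"]) auto
  qed auto
  assume "\<epsilon> > 0"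
  show "admissible {-\<epsilon><..<\<epsilon>::real} 1"
  proof (rule admissibleI)
    fix x :: real assume "x \<in> {-\<epsilon><..<\<epsilon>}"
    then show "\<exists>d. d \<noteq> 0 \<and> x + d *\<^sub>R 1 \<in> {-\<epsilon><..<\<epsilon>}"
      by (intro exI[of _ "(\<epsilon> - x) / 2"]) (auto simp: field_simps)
  qed auto
qed

lemma admissible_fst: "admissible S v \<Longrightarrow> admissible (S \<times> T) (v, 0)"
  unfolding admissible_def
  by (auto simp: islimpt_approachable)

lemma admissible_snd: "admissible T v \<Longrightarrow> admissible (S \<times> T) (0, v)"
  unfolding admissible_def
  by (auto simp: islimpt_approachable)

lemma pd_eq_0:
  assumes "admissible S v" "x \<in> S" "\<And>r. x + r *\<^sub>R v \<in> S \<Longrightarrow> f (x + r *\<^sub>R v) = f x"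
  shows "pd S v f x = 0"
proof -
  have "((\<lambda>r. f (x + r *\<^sub>R v)) has_vector_derivative 0) (at 0 within {r. x + r *\<^sub>R v \<in> S})"
    by (rule has_vector_derivative_transform[OF _ _ has_vector_derivative_const[of "f x"]]) (use assms in auto)
  from vector_derivative_within[OF _ this] show ?thesis
    using assms(1,2) by (auto simp: pd_def admissible_def trivial_limit_within)
qed

context riem_so
begin

text \<open>This and the next two definitions are the ingredients of the geodesic equations
  translated to the Lie algebra, where values at different base points lie in one vector
  space.\<close>

definition accel :: "(real \<Rightarrow> 'n sqmat) \<Rightarrow> real \<Rightarrow> 'n sqmat" where
  "accel p s = transpose (p s) ** covariant_deriv nab p (velocity p) s"

definition curvt :: "(real \<Rightarrow> 'n sqmat) \<Rightarrow> (real \<Rightarrow> real \<Rightarrow> 'n sqmat) \<Rightarrow> real \<Rightarrow> real \<Rightarrow> 'n sqmat" where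
  "curvt p q s t = transpose (p s) **
     curvature nab (p s) (q s t) (covariant_deriv nab p (\<lambda>r. q r t) s) (velocity p s)"

definition qacc :: "(real \<Rightarrow> 'n sqmat) \<Rightarrow> (real \<Rightarrow> real \<Rightarrow> 'n sqmat) \<Rightarrow> real \<Rightarrow> real \<Rightarrow> 'n sqmat" where
  "qacc p q s t = transpose (p s) ** covariant_deriv nab p (covariant_deriv nab p (\<lambda>r. q r t)) s"

text \<open>Used with families of two and of three parameters: the curve parameter runs along the
  segment from \<open>x\<close> in direction \<open>d\<close>, and the other coordinates of
  \<open>x\<close> are held fixed.\<close>

lemma trivialised_terms:
  assumes P: "smooth_on S P" "\<And>x. x \<in> S \<Longrightarrow> P x \<in> SO" and v: "smooth_on S v" "\<And>x. x \<in> S \<Longrightarrow> v x \<in> so"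
    and d: "admissible S d" and line: "\<And>r. r \<in> {0..1} \<Longrightarrow> x + r *\<^sub>R d \<in> S"
    and p: "\<And>r. r \<in> {0..1} \<Longrightarrow> p r = P (x + r *\<^sub>R d)"
    and q: "\<And>r. r \<in> {0..1} \<Longrightarrow> q r t = P (x + r *\<^sub>R d) ** v (x + r *\<^sub>R d)" and s: "s \<in> {0..1}"
  defines "y \<equiv> x + s *\<^sub>R d"
  shows "velocity p s = P y ** logd S P d y"
    "covariant_deriv nab p (\<lambda>r. q r t) s = P y ** cov S P d v y"
    "accel p s = cov S P d (logd S P d) y"
    "curvt p q s t = K (P y) (v y) (cov S P d v y) (logd S P d y)"
    "qacc p q s t = cov S P d (cov S P d v) y"
proof -
  have yS: "y \<in> S" unfolding y_def using line[OF s] .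
  have c: "covariant_deriv nab p V s = P (x + s *\<^sub>R d) ** cov S P d w (x + s *\<^sub>R d)"
    "velocity p s = P (x + s *\<^sub>R d) ** logd S P d (x + s *\<^sub>R d)"
    if "smooth_on S w" "\<And>x. x \<in> S \<Longrightarrow> w x \<in> so"
      "\<And>r. r \<in> {0..1} \<Longrightarrow> V r = P (x + r *\<^sub>R d) ** w (x + r *\<^sub>R d)" "s \<in> {0..1}" for V w s
    using covariant_deriv_cov[of S P w d x p V s] P that d line p by blast+
  have l: "smooth_on S (logd S P d)" "\<And>x. x \<in> S \<Longrightarrow> logd S P d x \<in> so"
    using smooth_on_logd[OF P(1) d] logd_so(1)[OF P d] by auto
  have w: "smooth_on S (cov S P d v)" "\<And>x. x \<in> S \<Longrightarrow> cov S P d v x \<in> so"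
    using smooth_on_cov[OF P v(1) d] cov_so[OF v P(2) d] by auto
  show vel: "velocity p s = P y ** logd S P d y" unfolding y_def by (rule c(2)[OF v q s])
  show cd: "covariant_deriv nab p (\<lambda>r. q r t) s = P y ** cov S P d v y" unfolding y_def by (rule c(1)[OF v q s])
  have vel': "velocity p r = P (x + r *\<^sub>R d) ** logd S P d (x + r *\<^sub>R d)" if "r \<in> {0..1}" for r
    by (rule c(2)[OF v q that])
  have "covariant_deriv nab p (velocity p) s = P y ** cov S P d (logd S P d) y"
    unfolding y_def by (rule c(1)[OF l vel' s])
  then show "accel p s = cov S P d (logd S P d) y"
    by (simp add: accel_def p[OF s] y_def[symmetric] SO_cancel P(2) yS)
  have cd': "covariant_deriv nab p (\<lambda>r. q r t) r = P (x + r *\<^sub>R d) ** cov S P d v (x + r *\<^sub>R d)" if "r \<in> {0..1}" for r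
    by (rule c(1)[OF v q that])
  have "covariant_deriv nab p (covariant_deriv nab p (\<lambda>r. q r t)) s = P y ** cov S P d (cov S P d v) y"
    unfolding y_def by (rule c(1)[OF w cd' s])
  then show "qacc p q s t = cov S P d (cov S P d v) y"
    by (simp add: qacc_def p[OF s] y_def[symmetric] SO_cancel P(2) yS)
  show "curvt p q s t = K (P y) (v y) (cov S P d v y) (logd S P d y)"
    unfolding curvt_def vel cd q[OF s] p[OF s] y_def[symmetric]
    by (simp add: curvature_eq_K P(2) yS v(2) w(2) l(2) SO_cancel)
qed

text \<open>The regularity shared by the pair of a path of curves and by the pair underlying any
  variation.\<close>

definition regular_pair :: "(real \<Rightarrow> 'n sqmat) \<Rightarrow> (real \<Rightarrow> real \<Rightarrow> 'n sqmat) \<Rightarrow> bool" where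
  "regular_pair p q \<longleftrightarrow> smooth_on {0..1} p \<and> smooth_on ({0..1} \<times> {0..1}) (\<lambda>(s, t). q s t) \<and>
     (\<forall>s\<in>{0..1}. p s \<in> SO) \<and> (\<forall>s\<in>{0..1}. \<forall>t\<in>{0..1}. q s t \<in> tangent_space (p s))"

text \<open>On the unit square, with \<open>p\<close> extended constantly in \<open>t\<close>,
  covariant differentiation in \<open>s\<close> is \<open>cov\<close> in direction
  \<open>(1, 0)\<close> for all \<open>t\<close> at once. The acceleration is then read off on the
  edge \<open>t = 0\<close>.\<close>

lemma regular_pair_terms:
  assumes "regular_pair p q"
  shows "smooth_on {0..1} (accel p)" "smooth_on ({0..1} \<times> {0..1}) (\<lambda>(s, t). curvt p q s t)"
    "smooth_on ({0..1} \<times> {0..1}) (\<lambda>(s, t). qacc p q s t)"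
    "s \<in> {0..1} \<Longrightarrow> accel p s \<in> so" "s \<in> {0..1} \<Longrightarrow> t \<in> {0..1} \<Longrightarrow> curvt p q s t \<in> so"
    "s \<in> {0..1} \<Longrightarrow> t \<in> {0..1} \<Longrightarrow> qacc p q s t \<in> so"
proof -
  note r = assms[unfolded regular_pair_def]
  let ?S = "{0..1} \<times> {0..1} :: (real \<times> real) set"
  define P where "P z = p (fst z)" for z :: "real \<times> real"
  define v where "v z = transpose (P z) ** (case z of (s, t) \<Rightarrow> q s t)" for z :: "real \<times> real"
  have d: "admissible ?S (1, 0)" by (rule admissible_fst[OF admissible_interval(1)])
  have P: "smooth_on ?S P" "\<And>z. z \<in> ?S \<Longrightarrow> P z \<in> SO"
    unfolding P_def using r
    by (auto intro!: smooth_on_compose[where T="{0..1}" and f=p and h=fst] smooth_on_linear[OF bounded_linear_fst])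
  have v: "smooth_on ?S v"
    unfolding v_def by (intro smooth_on_bilinear[OF bounded_bilinear_matrix_mult]
        smooth_on_compose_linear[OF bounded_linear_transpose] P) (use r in auto)
  have vs: "\<And>z. z \<in> ?S \<Longrightarrow> v z \<in> so"
    using r by (auto simp: v_def P_def tangent_space_iff)
  have t: "accel p s = cov ?S P (1,0) (logd ?S P (1,0)) (s, t)"
    "curvt p q s t = K (P (s, t)) (v (s, t)) (cov ?S P (1,0) v (s, t)) (logd ?S P (1,0) (s, t))"
    "qacc p q s t = cov ?S P (1,0) (cov ?S P (1,0) v) (s, t)" if "s \<in> {0..1}" "t \<in> {0..1}" for s t
    using trivialised_terms(3,4,5)[of ?S P v "(1,0)" "(0,t)" p q t s] P v vs d that r
    by (auto simp: P_def v_def SO_cancel)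
  note ls = smooth_on_logd[OF P(1) d] and lso = logd_so(1)[OF P d]
  note ws = smooth_on_cov[OF P v d] and wso = cov_so[OF v vs P(2) d]
  show "smooth_on ?S (\<lambda>(s, t). curvt p q s t)"
    by (rule smooth_on_cong[OF smooth_on_K[OF P v ws ls]]) (auto simp: t)
  show "smooth_on ?S (\<lambda>(s, t). qacc p q s t)"
    by (rule smooth_on_cong[OF smooth_on_cov[OF P ws d]]) (auto simp: t)
  have h: "smooth_on {0..1} (\<lambda>s. (s, 0::real))" by (intro smooth_on_Pair smooth_on_ident smooth_on_const)
  have c: "smooth_on ?S (cov ?S P (1,0) (logd ?S P (1,0)))" by (rule smooth_on_cov[OF P ls d])
  have "smooth_on {0..1} (\<lambda>s. cov ?S P (1,0) (logd ?S P (1,0)) (s, 0))"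
    by (rule smooth_on_compose[OF c h]) auto
  then show "smooth_on {0..1} (accel p)" by (rule smooth_on_cong) (use t(1)[of _ 0] in auto)
  show "accel p s \<in> so" if "s \<in> {0..1}"
    unfolding t(1)[OF that, of 0, simplified] by (rule cov_so[OF ls lso P(2) d]) (use that in auto)
  show "curvt p q s t \<in> so" if "s \<in> {0..1}" "t \<in> {0..1}"
    unfolding t(2)[OF that] by (rule K_so[OF P(2)]) (use that in auto)
  show "qacc p q s t \<in> so" if "s \<in> {0..1}" "t \<in> {0..1}"
    unfolding t(3)[OF that] by (rule cov_so[OF ws wso P(2) d]) (use that in auto)
qed

text \<open>The pair is the slice \<tau> = 0 of the variation, and slices of smooth families are
  smooth.\<close>

lemma variation_regular:
  assumes "variation p q \<epsilon> P Q"
  shows "regular_pair p q"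
proof -
  note v = assms[unfolded variation_def]
  have e: "0 \<in> {-\<epsilon><..<\<epsilon>}" using v by auto
  have "smooth_on {0..1} (\<lambda>s. case (0, s) of (\<tau>, s) \<Rightarrow> P \<tau> s)"
    by (rule smooth_on_Pair_arg[of "{-\<epsilon><..<\<epsilon>} \<times> {0..1}"]) (use v e in auto)
  then have 1: "smooth_on {0..1} p" by (rule smooth_on_cong) (use v in auto)
  have "smooth_on ({0..1} \<times> {0..1}) (\<lambda>z. case (0, z) of (\<tau>, s, t) \<Rightarrow> Q \<tau> s t)"
    by (rule smooth_on_Pair_arg[of "{-\<epsilon><..<\<epsilon>} \<times> {0..1} \<times> {0..1}"]) (use v e in auto)
  then have 2: "smooth_on ({0..1} \<times> {0..1}) (\<lambda>(s, t). q s t)" by (rule smooth_on_cong) (use v in auto)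
  have 3: "\<forall>s\<in>{0..1}. p s \<in> SO" using v e by metis
  have 4: "\<forall>s\<in>{0..1}. \<forall>t\<in>{0..1}. q s t \<in> tangent_space (p s)" using v e by metis
  show ?thesis unfolding regular_pair_def using 1 2 3 4 by blast
qed

definition base_field :: "(real \<Rightarrow> 'n sqmat) \<Rightarrow> (real \<Rightarrow> real \<Rightarrow> 'n sqmat) \<Rightarrow> real \<Rightarrow> 'n sqmat" where
  "base_field p P s = transpose (p s) ** vector_derivative (\<lambda>\<tau>. P \<tau> s) (at 0)"

text \<open>The vector \<zeta> of the overview in the trivialisation: the covariant derivative in
  \<tau>, at \<tau> = 0, of the field \<open>Q\<close> along the curve of base points;
  \<open>base_field\<close> is \<eta>.\<close>

definition srv_field ::
  "(real \<Rightarrow> 'n sqmat) \<Rightarrow> (real \<Rightarrow> real \<Rightarrow> 'n sqmat) \<Rightarrow> (real \<Rightarrow> real \<Rightarrow> 'n sqmat) \<Rightarrow> (real \<Rightarrow> real \<Rightarrow> real \<Rightarrow> 'n sqmat)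
     \<Rightarrow> real \<Rightarrow> real \<Rightarrow> 'n sqmat" where
  "srv_field p q P Q s t = vector_derivative (\<lambda>\<tau>. transpose (P \<tau> s) ** Q \<tau> s t) (at 0)
     + Gam (p s) (base_field p P s) (transpose (p s) ** q s t)"

lemma first_variation:
  assumes var: "variation p q \<epsilon> P Q"
  defines "\<eta> \<equiv> base_field p P" and "\<zeta> \<equiv> srv_field p q P Q"
  shows "((\<lambda>\<tau>. energy g nab (P \<tau>) (Q \<tau>)) has_real_derivative
    - integral {0..1} (\<lambda>s. integral {0..1} (\<lambda>t.
        G (p s) (\<eta> s) (accel p s + curvt p q s t) + G (p s) (\<zeta> s t) (qacc p q s t)))) (at 0)"
proof -
  note v = var[unfolded variation_def]
  have eps: "\<epsilon> > 0" and e: "0 \<in> {-\<epsilon><..<\<epsilon>}" using v by auto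
  let ?I = "{-\<epsilon><..<\<epsilon>}" and ?J = "{0..1::real}"
  \<comment> \<open>The product is nested to the left so that \<open>t\<close> and then
    \<open>s\<close> is the last component, as integration over the last component requires.\<close>
  let ?X = "(?I \<times> ?J) \<times> ?J"
  define d\<tau> ds :: "(real \<times> real) \<times> real" where "d\<tau> = ((1, 0), 0)" and "ds = ((0, 1), 0)"
  have adm: "admissible ?X d\<tau>" "admissible ?X ds" "admissible (?I \<times> ?J) (1, 0)" "admissible (?I \<times> ?J) (0, 1)"
    unfolding d\<tau>_def ds_def by (intro admissible_fst admissible_snd admissible_interval eps)+
  define A where "A z = (case z of ((\<tau>, s), t) \<Rightarrow> P \<tau> s)" for z :: "(real \<times> real) \<times> real"
  define u where "u z = (case z of ((\<tau>, s), t) \<Rightarrow> transpose (P \<tau> s) ** Q \<tau> s t)" for z :: "(real \<times> real) \<times> real"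
  have A: "smooth_on ?X A" "\<And>z. z \<in> ?X \<Longrightarrow> A z \<in> SO"
  proof -
    have "smooth_on ?X (\<lambda>z. case fst z of (\<tau>, s) \<Rightarrow> P \<tau> s)"
      by (rule smooth_on_compose[where T="?I \<times> ?J"]) (use v in \<open>auto intro: smooth_on_linear[OF bounded_linear_fst]\<close>)
    then show "smooth_on ?X A" by (rule smooth_on_cong) (auto simp: A_def)
    show "\<And>z. z \<in> ?X \<Longrightarrow> A z \<in> SO" using v by (auto simp: A_def)
  qed
  have u: "smooth_on ?X u" "\<And>z. z \<in> ?X \<Longrightarrow> u z \<in> so"
  proof -
    have L: "bounded_linear (\<lambda>z::(real \<times> real) \<times> real. (fst (fst z), snd (fst z), snd z))"
      by (intro bounded_linear_Pair bounded_linear_fst_comp bounded_linear_snd_comp bounded_linear_fst bounded_linear_snd)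
    have "smooth_on ?X (\<lambda>z. case (fst (fst z), snd (fst z), snd z) of (\<tau>, s, t) \<Rightarrow> Q \<tau> s t)"
      by (rule smooth_on_compose[where T="?I \<times> ?J \<times> ?J", OF _ smooth_on_linear[OF L]]) (use v in auto)
    then have "smooth_on ?X (\<lambda>z. transpose (A z) ** (case (fst (fst z), snd (fst z), snd z) of (\<tau>, s, t) \<Rightarrow> Q \<tau> s t))"
      by (intro smooth_on_bilinear[OF bounded_bilinear_matrix_mult] smooth_on_compose_linear[OF bounded_linear_transpose] A)
    then show "smooth_on ?X u" by (rule smooth_on_cong) (auto simp: u_def A_def)
    show "\<And>z. z \<in> ?X \<Longrightarrow> u z \<in> so" using v by (auto simp: u_def tangent_space_iff[symmetric])
  qed
  \<comment> \<open>The four trivialised fields are the velocity in \<open>s\<close>, the variation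
    field of the base points, and the covariant derivatives of the square root velocity in
    \<open>s\<close> and in \<tau>.\<close>
  define \<sigma> where "\<sigma> = logd ?X A ds"
  define \<rho> where "\<rho> = logd ?X A d\<tau>"
  define w where "w = cov ?X A ds u"
  define z where "z = cov ?X A d\<tau> u"
  have sm: "smooth_on ?X \<sigma>" "smooth_on ?X \<rho>" "smooth_on ?X w" "smooth_on ?X z"
    unfolding \<sigma>_def \<rho>_def w_def z_def by (intro smooth_on_logd smooth_on_cov A u adm; assumption?)+
  have so: "\<sigma> x \<in> so" "\<rho> x \<in> so" "w x \<in> so" "z x \<in> so" if "x \<in> ?X" for x
    unfolding \<sigma>_def \<rho>_def w_def z_def using that logd_so(1)[OF A adm(1)] logd_so(1)[OF A adm(2)]
      cov_so[OF u A(2) adm(1)] cov_so[OF u A(2) adm(2)] by auto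
  have line: "((\<tau>, 0), t) + r *\<^sub>R ds = ((\<tau>, r), t)" for \<tau> t r :: real by (simp add: ds_def)
  have terms: "velocity (P \<tau>) s = P \<tau> s ** \<sigma> ((\<tau>, s), t)"
    "covariant_deriv nab (P \<tau>) (\<lambda>r. Q \<tau> r t) s = P \<tau> s ** w ((\<tau>, s), t)"
    "accel (P \<tau>) s = cov ?X A ds \<sigma> ((\<tau>, s), t)"
    "curvt (P \<tau>) (Q \<tau>) s t = K (P \<tau> s) (u ((\<tau>, s), t)) (w ((\<tau>, s), t)) (\<sigma> ((\<tau>, s), t))"
    "qacc (P \<tau>) (Q \<tau>) s t = cov ?X A ds w ((\<tau>, s), t)"
    if \<tau>: "\<tau> \<in> ?I" and s: "s \<in> ?J" and t: "t \<in> ?J" for \<tau> s t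
  proof -
    have q: "Q \<tau> r t = A (((\<tau>, 0), t) + r *\<^sub>R ds) ** u (((\<tau>, 0), t) + r *\<^sub>R ds)" if "r \<in> ?J" for r
      unfolding line using A(2)[of "((\<tau>, r), t)"] \<tau> t that by (simp add: A_def u_def SO_cancel)
    have i: "((\<tau>, 0), t) + r *\<^sub>R ds \<in> ?X" if "r \<in> ?J" for r
      unfolding line using \<tau> t that by auto
    have p: "P \<tau> r = A (((\<tau>, 0), t) + r *\<^sub>R ds)" if "r \<in> ?J" for r
      unfolding line by (simp add: A_def)
    have As: "A ((\<tau>, s), t) = P \<tau> s" by (simp add: A_def)
    note T = trivialised_terms[where S="?X" and P=A and v=u and d=ds and x="((\<tau>, 0), t)" and p="P \<tau>" and q="Q \<tau>" and t=t and s=s,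
        OF A u adm(2) i p q s, unfolded line As, folded \<sigma>_def w_def]
    show "velocity (P \<tau>) s = P \<tau> s ** \<sigma> ((\<tau>, s), t)"
      "covariant_deriv nab (P \<tau>) (\<lambda>r. Q \<tau> r t) s = P \<tau> s ** w ((\<tau>, s), t)"
      "accel (P \<tau>) s = cov ?X A ds \<sigma> ((\<tau>, s), t)"
      "curvt (P \<tau>) (Q \<tau>) s t = K (P \<tau> s) (u ((\<tau>, s), t)) (w ((\<tau>, s), t)) (\<sigma> ((\<tau>, s), t))"
      "qacc (P \<tau>) (Q \<tau>) s t = cov ?X A ds w ((\<tau>, s), t)"
      using T by simp_all
  qed
  \<comment> \<open>\<open>en\<close> is the energy density, \<open>k\<close> the quantity whose
    \<open>s\<close>-derivative integrates to a boundary term, and \<open>m\<close> the integrand of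
    the claimed formula.\<close>
  define en where "en x = (1/2) *\<^sub>R (G (A x) (\<sigma> x) (\<sigma> x) + G (A x) (w x) (w x))" for x
  define k where "k x = G (A x) (\<sigma> x) (\<rho> x) + G (A x) (w x) (z x)" for x
  define m where "m x = G (A x) (\<rho> x) (cov ?X A ds \<sigma> x + K (A x) (u x) (w x) (\<sigma> x))
      + G (A x) (z x) (cov ?X A ds w x)" for x
  have GS: "smooth_on ?X (\<lambda>x. G (A x) (a x) (b x))" if "smooth_on ?X a" "smooth_on ?X b" for a b
    by (rule bilin_field_smooth[OF bilin_field_G A that])
  have en: "smooth_on ?X en" and k: "smooth_on ?X k" and m: "smooth_on ?X m"
    unfolding en_def k_def m_def
    by (intro smooth_on_scaleR smooth_on_const smooth_on_add GS sm smooth_on_cov smooth_on_K A u adm; assumption?)+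
  have key: "pd ?X d\<tau> en x = pd ?X ds k x - m x" if x: "x \<in> ?X" for x
  proof -
    note Ax = A(2)[OF x]
    have 1: "cov ?X A d\<tau> \<sigma> x = cov ?X A ds \<rho> x"
      unfolding \<sigma>_def \<rho>_def by (rule cov_logd_commute[OF A adm(1,2) x])
    have 2: "cov ?X A d\<tau> w x = cov ?X A ds z x + K (A x) (\<rho> x) (\<sigma> x) (u x)"
      using cov_commutator[OF A adm(1,2) x u(1)] unfolding w_def z_def \<rho>_def \<sigma>_def diff_eq_eq by (simp add: add.commute)
    have g1: "pd ?X d\<tau> (\<lambda>x. G (A x) (\<sigma> x) (\<sigma> x)) x = 2 * G (A x) (\<sigma> x) (cov ?X A d\<tau> \<sigma> x)"
      using pd_G[OF A sm(1) sm(1) adm(1) x] G_sym[OF Ax] by simp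
    have g2: "pd ?X d\<tau> (\<lambda>x. G (A x) (w x) (w x)) x = 2 * G (A x) (w x) (cov ?X A d\<tau> w x)"
      using pd_G[OF A sm(3) sm(3) adm(1) x] G_sym[OF Ax] by simp
    have g3: "pd ?X ds (\<lambda>x. G (A x) (\<sigma> x) (\<rho> x)) x = G (A x) (cov ?X A ds \<sigma> x) (\<rho> x) + G (A x) (\<sigma> x) (cov ?X A ds \<rho> x)"
      by (rule pd_G[OF A sm(1) sm(2) adm(2) x])
    have g4: "pd ?X ds (\<lambda>x. G (A x) (w x) (z x)) x = G (A x) (cov ?X A ds w x) (z x) + G (A x) (w x) (cov ?X A ds z x)"
      by (rule pd_G[OF A sm(3) sm(4) adm(2) x])
    have s: "smooth_on ?X (\<lambda>x. G (A x) (\<sigma> x) (\<sigma> x) + G (A x) (w x) (w x))"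
      by (intro smooth_on_add GS sm)
    have "pd ?X d\<tau> en x = (1/2) *\<^sub>R pd ?X d\<tau> (\<lambda>x. G (A x) (\<sigma> x) (\<sigma> x) + G (A x) (w x) (w x)) x"
      unfolding en_def[abs_def] by (rule pd_linear[OF bounded_linear_scaleR_right s adm(1) x])
    also have "\<dots> = G (A x) (\<sigma> x) (cov ?X A d\<tau> \<sigma> x) + G (A x) (w x) (cov ?X A d\<tau> w x)"
      using pd_add[OF GS[OF sm(1) sm(1)] GS[OF sm(3) sm(3)] adm(1) x] by (simp add: g1 g2)
    finally have E: "pd ?X d\<tau> en x = G (A x) (\<sigma> x) (cov ?X A ds \<rho> x) + G (A x) (w x) (cov ?X A ds z x)
        + G (A x) (w x) (K (A x) (\<rho> x) (\<sigma> x) (u x))"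
      by (simp add: 1 2 G_simps Ax)
    \<comment> \<open>Pair symmetry brings \<rho> into the third argument of \<open>K\<close>; skew
      symmetry then releases it, at the cost of the sign.\<close>
    have "G (A x) (w x) (K (A x) (\<rho> x) (\<sigma> x) (u x)) = G (A x) (K (A x) (\<rho> x) (\<sigma> x) (u x)) (w x)"
      by (rule G_sym[OF Ax])
    also have "\<dots> = G (A x) (K (A x) (u x) (w x) (\<rho> x)) (\<sigma> x)"
      by (rule K_pair[OF Ax so(2)[OF x] so(1)[OF x] u(2)[OF x] so(3)[OF x]])
    also have "\<dots> = - G (A x) (\<rho> x) (K (A x) (u x) (w x) (\<sigma> x))"
      by (rule K_skew[OF Ax u(2)[OF x] so(3)[OF x]])
    finally have R: "G (A x) (w x) (K (A x) (\<rho> x) (\<sigma> x) (u x)) = - G (A x) (\<rho> x) (K (A x) (u x) (w x) (\<sigma> x))" .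
    have "pd ?X ds k x = pd ?X ds (\<lambda>x. G (A x) (\<sigma> x) (\<rho> x)) x + pd ?X ds (\<lambda>x. G (A x) (w x) (z x)) x"
      unfolding k_def[abs_def] by (rule pd_add[OF GS[OF sm(1) sm(2)] GS[OF sm(3) sm(4)] adm(2) x])
    then show ?thesis
      unfolding E R g3 g4 m_def
      by (simp add: G_simps Ax G_sym[OF Ax, of "\<rho> x" "cov ?X A ds \<sigma> x"] G_sym[OF Ax, of "z x"])
  qed
  \<comment> \<open>The squared speed of the base point does not depend on \<open>t\<close>; as the
    interval has length 1, it may be moved under the integral over \<open>t\<close>.\<close>
  have energy: "energy g nab (P \<tau>) (Q \<tau>) = integral ?J (\<lambda>s. integral ?J (\<lambda>t. en ((\<tau>, s), t)))" if \<tau>: "\<tau> \<in> ?I" for \<tau>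
  proof -
    have "(riem_norm g (P \<tau> s) (velocity (P \<tau>) s))\<^sup>2 +
        integral ?J (\<lambda>t. (riem_norm g (P \<tau> s) (covariant_deriv nab (P \<tau>) (\<lambda>r. Q \<tau> r t) s))\<^sup>2)
      = 2 * integral ?J (\<lambda>t. en ((\<tau>, s), t))" if s: "s \<in> ?J" for s
    proof -
      let ?n = "(riem_norm g (P \<tau> s) (velocity (P \<tau>) s))\<^sup>2"
      have PS: "P \<tau> s \<in> SO" using v \<tau> s by blast
      have x: "((\<tau>, s), t) \<in> ?X" if "t \<in> ?J" for t using \<tau> s that by auto
      have n: "?n = G (P \<tau> s) (\<sigma> ((\<tau>, s), t)) (\<sigma> ((\<tau>, s), t))" if "t \<in> ?J" for t
        unfolding terms(1)[OF \<tau> s that] by (rule riem_norm_square[OF PS so(1)[OF x[OF that]]])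
      have c: "(riem_norm g (P \<tau> s) (covariant_deriv nab (P \<tau>) (\<lambda>r. Q \<tau> r t) s))\<^sup>2 =
          G (P \<tau> s) (w ((\<tau>, s), t)) (w ((\<tau>, s), t))" if "t \<in> ?J" for t
        unfolding terms(2)[OF \<tau> s that] by (rule riem_norm_square[OF PS so(3)[OF x[OF that]]])
      have enx: "en ((\<tau>, s), t) = (1/2) * (?n + (riem_norm g (P \<tau> s) (covariant_deriv nab (P \<tau>) (\<lambda>r. Q \<tau> r t) s))\<^sup>2)"
        if "t \<in> ?J" for t unfolding c[OF that] n[OF that] en_def by (simp add: A_def)
      have "smooth_on ?J (\<lambda>t. en ((\<tau>, s), t))" by (rule smooth_on_Pair_arg[OF en x])
      then have ei: "(\<lambda>t. en ((\<tau>, s), t)) integrable_on ?J"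
        by (intro integrable_continuous_real smooth_on_imp_continuous_on)
      have "integral ?J (\<lambda>t. (riem_norm g (P \<tau> s) (covariant_deriv nab (P \<tau>) (\<lambda>r. Q \<tau> r t) s))\<^sup>2)
        = integral ?J (\<lambda>t. 2 * en ((\<tau>, s), t) - ?n)"
        by (rule integral_cong) (simp add: enx field_simps)
      also have "\<dots> = 2 * integral ?J (\<lambda>t. en ((\<tau>, s), t)) - ?n"
        using ei by (subst integral_diff) (auto intro: integrable_on_mult_right)
      finally show ?thesis by simp
    qed
    then have "integral ?J (\<lambda>s. (riem_norm g (P \<tau> s) (velocity (P \<tau>) s))\<^sup>2 +
        integral ?J (\<lambda>t. (riem_norm g (P \<tau> s) (covariant_deriv nab (P \<tau>) (\<lambda>r. Q \<tau> r t) s))\<^sup>2))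
      = integral ?J (\<lambda>s. 2 * integral ?J (\<lambda>t. en ((\<tau>, s), t)))"
      by (intro integral_cong)
    then show ?thesis by (simp add: energy_def)
  qed
  let ?en1 = "\<lambda>y. integral ?J (\<lambda>t. en (y, t))" and ?k1 = "\<lambda>y. integral ?J (\<lambda>t. k (y, t))"
  have en1: "smooth_on (?I \<times> ?J) ?en1" and k1: "smooth_on (?I \<times> ?J) ?k1"
    by (rule smooth_on_integral01(1)[OF en], rule smooth_on_integral01(1)[OF k])
  have en2: "smooth_on ?I (\<lambda>\<tau>. integral ?J (\<lambda>s. ?en1 (\<tau>, s)))" by (rule smooth_on_integral01(1)[OF en1])
  have "((\<lambda>\<tau>. energy g nab (P \<tau>) (Q \<tau>)) has_vector_derivative
      pd ?I 1 (\<lambda>\<tau>. integral ?J (\<lambda>s. ?en1 (\<tau>, s))) (0 + 0 *\<^sub>R 1)) (at 0 within ?I)"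
    by (rule pd_has_vector_derivative[OF en2 admissible_interval(2)[OF eps] _ e]) (auto simp: energy)
  then have D: "((\<lambda>\<tau>. energy g nab (P \<tau>) (Q \<tau>)) has_real_derivative
      pd ?I 1 (\<lambda>\<tau>. integral ?J (\<lambda>s. ?en1 (\<tau>, s))) 0) (at 0)"
    using e by (simp add: at_within_open[OF e] has_real_derivative_iff_has_vector_derivative)
  have "pd ?I 1 (\<lambda>\<tau>. integral ?J (\<lambda>s. ?en1 (\<tau>, s))) 0 = integral ?J (\<lambda>s. pd (?I \<times> ?J) (1, 0) ?en1 (0, s))"
    by (rule smooth_on_integral01(2)[OF en1 admissible_interval(2)[OF eps] adm(3) e])
  also have "\<dots> = integral ?J (\<lambda>s. pd (?I \<times> ?J) (0, 1) ?k1 (0, s) - integral ?J (\<lambda>t. m ((0, s), t)))"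
  proof (rule integral_cong)
    fix s assume s: "s \<in> ?J"
    have y: "(0, s) \<in> ?I \<times> ?J" using e s by auto
    have x: "((0, s), t) \<in> ?X" if "t \<in> ?J" for t using e s that by auto
    have "pd (?I \<times> ?J) (1, 0) ?en1 (0, s) = integral ?J (\<lambda>t. pd ?X d\<tau> en ((0, s), t))"
      using smooth_on_integral01(2)[OF en adm(3) _ y] adm(1) by (simp add: d\<tau>_def)
    also have "\<dots> = integral ?J (\<lambda>t. pd ?X ds k ((0, s), t) - m ((0, s), t))"
      by (rule integral_cong) (use key x in auto)
    also have "\<dots> = integral ?J (\<lambda>t. pd ?X ds k ((0, s), t)) - integral ?J (\<lambda>t. m ((0, s), t))"
    proof (rule integral_diff)
      show "(\<lambda>t. pd ?X ds k ((0, s), t)) integrable_on ?J"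
        by (intro integrable_continuous_real smooth_on_imp_continuous_on smooth_on_Pair_arg[OF smooth_on_pd[OF k adm(2)] x])
      show "(\<lambda>t. m ((0, s), t)) integrable_on ?J"
        by (intro integrable_continuous_real smooth_on_imp_continuous_on smooth_on_Pair_arg[OF m x])
    qed
    also have "integral ?J (\<lambda>t. pd ?X ds k ((0, s), t)) = pd (?I \<times> ?J) (0, 1) ?k1 (0, s)"
      using smooth_on_integral01(2)[OF k adm(4) _ y] adm(2) by (simp add: ds_def)
    finally show "pd (?I \<times> ?J) (1, 0) ?en1 (0, s) = pd (?I \<times> ?J) (0, 1) ?k1 (0, s) - integral ?J (\<lambda>t. m ((0, s), t))" .
  qed
  also have "\<dots> = integral ?J (\<lambda>s. pd (?I \<times> ?J) (0, 1) ?k1 (0, s)) - integral ?J (\<lambda>s. integral ?J (\<lambda>t. m ((0, s), t)))"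
  proof (rule integral_diff)
    show "(\<lambda>s. pd (?I \<times> ?J) (0, 1) ?k1 (0, s)) integrable_on ?J"
      by (intro integrable_continuous_real smooth_on_imp_continuous_on smooth_on_Pair_arg[OF smooth_on_pd[OF k1 adm(4)]]) (use e in auto)
    show "(\<lambda>s. integral ?J (\<lambda>t. m ((0, s), t))) integrable_on ?J"
      by (intro integrable_continuous_real smooth_on_imp_continuous_on smooth_on_Pair_arg[OF smooth_on_integral01(1)[OF m]]) (use e in auto)
  qed
  \<comment> \<open>The integral is the difference of \<open>k\<close>, integrated over
    \<open>t\<close>, at the two ends. There the variation is constant in \<tau>, so \<rho> and
    \<open>z\<close> vanish.\<close>
  also have "integral ?J (\<lambda>s. pd (?I \<times> ?J) (0, 1) ?k1 (0, s)) = 0"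
  proof -
    have "((\<lambda>s. ?k1 (0, s)) has_vector_derivative pd (?I \<times> ?J) (0, 1) ?k1 ((0, 0) + s *\<^sub>R (0, 1))) (at s within ?J)"
      if "s \<in> ?J" for s
      by (rule pd_has_vector_derivative[OF k1 adm(4) _ that]) (use e in auto)
    then have "((\<lambda>s. pd (?I \<times> ?J) (0, 1) ?k1 (0, s)) has_integral ?k1 (0, 1) - ?k1 (0, 0)) ?J"
      by (intro fundamental_theorem_of_calculus) auto
    moreover have "?k1 (0, s) = 0" if s: "s \<in> {0, 1}" for s
    proof -
      have "k ((0, s), t) = 0" if t: "t \<in> ?J" for t
      proof -
        have x: "((0, s), t) \<in> ?X" using e s t by auto
        have "pd ?X d\<tau> A ((0, s), t) = 0"
          by (rule pd_eq_0[OF adm(1) x]) (use v s e in \<open>auto simp: A_def d\<tau>_def\<close>)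
        then have r0: "\<rho> ((0, s), t) = 0" by (simp add: \<rho>_def logd_def mm_simps)
        have "pd ?X d\<tau> u ((0, s), t) = 0"
          by (rule pd_eq_0[OF adm(1) x]) (use v s t e in \<open>auto simp: u_def d\<tau>_def\<close>)
        then have z0: "z ((0, s), t) = 0"
          using r0 A(2)[OF x] by (simp add: z_def cov_def \<rho>_def[symmetric] Gam_simps)
        show ?thesis using A(2)[OF x] by (simp add: k_def r0 z0 G_simps)
      qed
      then have "?k1 (0, s) = integral ?J (\<lambda>t. 0)" by (intro integral_cong) auto
      then show ?thesis by simp
    qed
    ultimately show ?thesis by (simp add: integral_unique)
  qed
  finally have F: "pd ?I 1 (\<lambda>\<tau>. integral ?J (\<lambda>s. ?en1 (\<tau>, s))) 0 =
      0 - integral ?J (\<lambda>s. integral ?J (\<lambda>t. m ((0, s), t)))" .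
  have mI: "integral ?J (\<lambda>s. integral ?J (\<lambda>t. m ((0, s), t))) = integral ?J (\<lambda>s. integral ?J (\<lambda>t.
        G (p s) (\<eta> s) (accel p s + curvt p q s t) + G (p s) (\<zeta> s t) (qacc p q s t)))"
  proof -
    have st: "P 0 s = p s" "Q 0 s t = q s t" if "s \<in> ?J" "t \<in> ?J" for s t using v that by auto
    have set: "{r. ((0, s), t) + r *\<^sub>R d\<tau> \<in> ?X} = ?I" if "s \<in> ?J" "t \<in> ?J" for s t
      using that by (auto simp: d\<tau>_def)
    have rho: "\<rho> ((0, s), t) = \<eta> s" if "s \<in> ?J" "t \<in> ?J" for s t
      unfolding \<rho>_def logd_def \<eta>_def base_field_def pd_def set[OF that] at_within_open[OF e open_greaterThanLessThan]
      using st[OF that] by (simp add: A_def d\<tau>_def)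
    have zeta: "z ((0, s), t) = \<zeta> s t" if "s \<in> ?J" "t \<in> ?J" for s t
      unfolding z_def cov_def \<zeta>_def srv_field_def \<eta>_def[symmetric] \<rho>_def[symmetric] rho[OF that] pd_def set[OF that]
        at_within_open[OF e open_greaterThanLessThan]
      using st[OF that] by (simp add: A_def u_def d\<tau>_def)
    have sdir: "p r = P 0 r" "q r t = Q 0 r t" if "r \<in> ?J" "t \<in> ?J" for r t using st[OF that] by auto
    \<comment> \<open>\<open>P 0\<close> and \<open>Q 0\<close> agree with \<open>p\<close> and
      \<open>q\<close> only on the unit interval, so the identities are derived anew for
      \<open>p\<close> and \<open>q\<close> and not rewritten from \<open>terms\<close>.\<close>
    have T: "accel p s = cov ?X A ds \<sigma> ((0, s), t)"
        "curvt p q s t = K (P 0 s) (u ((0, s), t)) (w ((0, s), t)) (\<sigma> ((0, s), t))"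
        "qacc p q s t = cov ?X A ds w ((0, s), t)" if s: "s \<in> ?J" and t: "t \<in> ?J" for s t
    proof -
      have i: "((0, 0), t) + r *\<^sub>R ds \<in> ?X" if "r \<in> ?J" for r
        unfolding line using e t that by auto
      have p: "p r = A (((0, 0), t) + r *\<^sub>R ds)" if "r \<in> ?J" for r
        unfolding line using sdir[OF that t] by (simp add: A_def)
      have q: "q r t = A (((0, 0), t) + r *\<^sub>R ds) ** u (((0, 0), t) + r *\<^sub>R ds)" if "r \<in> ?J" for r
        unfolding line using A(2)[of "((0, r), t)"] e t that sdir[OF that t] by (simp add: A_def u_def SO_cancel)
      have As: "A ((0, s), t) = P 0 s" by (simp add: A_def)
      note T = trivialised_terms[where S="?X" and P=A and v=u and d=ds and x="((0, 0), t)" and p=p and q=q and t=t and s=s,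
        OF A u adm(2) i p q s, unfolded line As, folded \<sigma>_def w_def]
      show "accel p s = cov ?X A ds \<sigma> ((0, s), t)"
        "curvt p q s t = K (P 0 s) (u ((0, s), t)) (w ((0, s), t)) (\<sigma> ((0, s), t))"
        "qacc p q s t = cov ?X A ds w ((0, s), t)" using T by simp_all
    qed
    have "m ((0, s), t) = G (p s) (\<eta> s) (accel p s + curvt p q s t) + G (p s) (\<zeta> s t) (qacc p q s t)"
      if "s \<in> ?J" "t \<in> ?J" for s t
    proof -
      have As: "A ((0, s), t) = P 0 s" by (simp add: A_def)
      show ?thesis unfolding m_def rho[OF that] zeta[OF that] T[OF that] As st(1)[OF that] ..
    qed
    then show "integral ?J (\<lambda>s. integral ?J (\<lambda>t. m ((0, s), t))) = integral ?J (\<lambda>s. integral ?J (\<lambda>t.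
        G (p s) (\<eta> s) (accel p s + curvt p q s t) + G (p s) (\<zeta> s t) (qacc p q s t)))"
      by (intro integral_cong)
  qed
  show "((\<lambda>\<tau>. energy g nab (P \<tau>) (Q \<tau>)) has_real_derivative
    - integral {0..1} (\<lambda>s. integral {0..1} (\<lambda>t.
        G (p s) (\<eta> s) (accel p s + curvt p q s t) + G (p s) (\<zeta> s t) (qacc p q s t)))) (at 0)"
    using D unfolding F mI by simp
qed

end

section \<open>Linear differential equations with a parameter\<close>

text \<open>Caratheodory's form of differentiability: a difference quotient that extends
  continuously to \<open>x\<close> has the derivative as its value there. It differentiates
  solutions with respect to the parameter.\<close>

lemma has_vector_derivative_factor:
  assumes "open S" "x \<in> S" "\<And>y. y \<in> S \<Longrightarrow> f y - f x = (y - x) *\<^sub>R c y" "isCont c x"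
  shows "(f has_vector_derivative c x) (at x)"
proof -
  have "((\<lambda>h. c (x + h)) \<longlongrightarrow> c x) (at 0)" using assms(4) by (simp add: isCont_iff)
  then have "((\<lambda>h. norm (c (x + h) - c x)) \<longlongrightarrow> 0) (at 0)"
    by (simp add: LIM_zero_iff tendsto_norm_zero_iff)
  moreover have "\<forall>\<^sub>F h in at 0. norm (c (x + h) - c x) = norm (f (x + h) - f x - h *\<^sub>R c x) / norm h"
  proof -
    have "\<forall>\<^sub>F y in at x. y \<in> S" using assms(1,2) by (rule eventually_at_in_open')
    then have "\<forall>\<^sub>F h in at 0. x + h \<in> S" by (subst (asm) at_to_0) (simp add: eventually_filtermap add.commute)
    moreover have "\<forall>\<^sub>F h in at (0::real). h \<noteq> 0" by (simp add: eventually_at_filter)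
    ultimately show ?thesis
    proof eventually_elim
      case (elim h)
      have "f (x + h) - f x - h *\<^sub>R c x = h *\<^sub>R (c (x + h) - c x)"
        using assms(3)[OF elim(1)] by (simp add: algebra_simps)
      then show ?case using elim(2) by simp
    qed
  qed
  ultimately have "((\<lambda>h. norm (f (x + h) - f x - h *\<^sub>R c x) / norm h) \<longlongrightarrow> 0) (at 0)"
    by (rule Lim_transform_eventually)
  then show ?thesis
    by (simp add: has_vector_derivative_def has_derivative_at bounded_linear_scaleR_left)
qed

text \<open>Written as \<open>t \<integral>\<^sub>0\<^sup>1 f(\<theta> t) d\<theta>\<close>, the antiderivative of \<open>f\<close> vanishing at \<open>0\<close> is an integral over
  a fixed interval, so that it depends smoothly on parameters and on \<open>t\<close>.\<close>

lemma has_vector_derivative_scaled_integral: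
  fixes f :: "real \<Rightarrow> 'c::banach"
  assumes "continuous_on {a<..<b} f" "a < 0" "0 < b" "t \<in> {a<..<b}"
  shows "((\<lambda>t. t *\<^sub>R integral {0..1} (\<lambda>\<theta>. f (\<theta> * t))) has_vector_derivative f t) (at t)"
proof -
  define c where "c = (a + min 0 t) / 2"
  define d where "d = (b + max 0 t) / 2"
  have cd: "a < c" "c < 0" "c < t" "0 < d" "t < d" "d < b" using assms(2-4)
    by (auto simp: c_def d_def min_def max_def field_simps)
  have "continuous_on {c..d} f" by (rule continuous_on_subset[OF assms(1)]) (use cd in auto)
  then obtain F where F: "\<And>x. x \<in> {c..d} \<Longrightarrow> (F has_vector_derivative f x) (at x within {c..d})"
    by (rule antiderivative_continuous) blast
  have eq: "r *\<^sub>R integral {0..1} (\<lambda>\<theta>. f (\<theta> * r)) = F r - F 0" if r: "r \<in> {c<..<d}" for r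
  proof -
    have mem: "\<theta> * r \<in> {c..d}" if "\<theta> \<in> {0..1}" for \<theta>
    proof -
      have "\<theta> * r \<in> closed_segment 0 r" using that by (auto simp: in_segment)
      moreover have "closed_segment 0 r \<subseteq> {c..d}" using r cd by (auto simp: closed_segment_eq_real_ivl)
      ultimately show ?thesis by blast
    qed
    have "((\<lambda>\<theta>. F (\<theta> * r)) has_vector_derivative r *\<^sub>R f (\<theta> * r)) (at \<theta> within {0..1})" if "\<theta> \<in> {0..1}" for \<theta>
    proof -
      have "((\<lambda>\<theta>. \<theta> * r) has_vector_derivative r) (at \<theta> within {0..1})"
        by (auto intro!: derivative_eq_intros)
      moreover have "(F has_vector_derivative f (\<theta> * r)) (at (\<theta> * r) within (\<lambda>\<theta>. \<theta> * r) ` {0..1})"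
        by (rule has_vector_derivative_within_subset[OF F[OF mem[OF that]]]) (use mem in auto)
      ultimately show ?thesis by (auto simp: o_def dest: vector_diff_chain_within)
    qed
    then have "((\<lambda>\<theta>. r *\<^sub>R f (\<theta> * r)) has_integral F (1 * r) - F (0 * r)) {0..1}"
      by (intro fundamental_theorem_of_calculus) auto
    then show ?thesis by (simp add: integral_unique flip: integral_cmul)
  qed
  have "(F has_vector_derivative f t) (at t)"
    using F[of t] cd by (simp add: at_within_Icc_at)
  then have "((\<lambda>r. F r - F 0) has_vector_derivative f t) (at t)"
    using has_vector_derivative_diff_const by blast
  then show ?thesis
    by (rule has_vector_derivative_transform_within_open[of _ _ _ "{c<..<d}"]) (use eq cd in auto)
qed

lemma mult_mem_interval:
  fixes t :: real
  assumes "a < 0" "0 < b" "t \<in> {a<..<b}" "\<theta> \<in> {0..1}"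
  shows "\<theta> * t \<in> {a<..<b}"
proof -
  have "\<theta> * t \<in> closed_segment 0 t" using assms(4) by (auto simp: in_segment)
  moreover have "closed_segment 0 t \<subseteq> {a<..<b}" using assms by (auto simp: closed_segment_eq_real_ivl)
  ultimately show ?thesis by blast
qed

text \<open>Picard iteration, organised as a series: \<open>Y n\<close> is the \<open>n\<close>-fold
  iterated integral of \<open>L\<close> applied to \<open>y0\<close>, bounded by the
  \<open>n\<close>-th term of an exponential series. The hypothesis on compositions expresses
  continuity of \<open>L\<close> without a topology on operators; the applications are left and
  right multiplication by an operator.\<close>

lemma linear_ode_exists:
  fixes L :: "real \<times> real \<Rightarrow> 'c::banach \<Rightarrow> 'c"
  assumes ab: "a < 0" "0 < b" and W: "W = {a<..<b} \<times> {a<..<b}"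
    and lin: "\<And>z. z \<in> W \<Longrightarrow> linear (L z)" and bound: "\<And>z y. z \<in> W \<Longrightarrow> norm (L z y) \<le> M * norm y"
    and cont: "\<And>f. continuous_on W f \<Longrightarrow> continuous_on W (\<lambda>z. L z (f z))" and M: "M \<ge> 0"
  shows "\<exists>y. continuous_on W y \<and> (\<forall>s\<in>{a<..<b}. y (s, 0) = y0) \<and>
    (\<forall>s\<in>{a<..<b}. \<forall>t\<in>{a<..<b}. ((\<lambda>t. y (s, t)) has_vector_derivative L (s, t) (y (s, t))) (at t))"
proof -
  define Y where "Y = rec_nat (\<lambda>z. y0) (\<lambda>n Yn z. snd z *\<^sub>R integral {0..1} (\<lambda>\<theta>. L (fst z, \<theta> * snd z) (Yn (fst z, \<theta> * snd z))))"
  have Y0: "Y 0 = (\<lambda>z. y0)" by (simp add: Y_def)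
  have YS: "Y (Suc n) = (\<lambda>z. snd z *\<^sub>R integral {0..1} (\<lambda>\<theta>. L (fst z, \<theta> * snd z) (Y n (fst z, \<theta> * snd z))))" for n
    by (simp add: Y_def)
  have mem: "(fst z, \<theta> * snd z) \<in> W" if "z \<in> W" "\<theta> \<in> {0..1}" for z \<theta>
    using that mult_mem_interval[OF ab, of "snd z" \<theta>] by (auto simp: W)
  have cline: "continuous_on {0..1} (\<lambda>\<theta>. f (fst z, \<theta> * snd z))" if "continuous_on W f" "z \<in> W" for f :: "real \<times> real \<Rightarrow> 'c" and z
    by (rule continuous_on_compose2[OF that(1)]) (use mem that in \<open>auto intro!: continuous_intros\<close>)
  have Yc: "continuous_on W (Y n)" for n
  proof (induction n)
    case 0 then show ?case by (simp add: Y0)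
  next
    case (Suc n)
    have "continuous_on (W \<times> cbox 0 1) (\<lambda>p. L (fst (fst p), snd p * snd (fst p)) (Y n (fst (fst p), snd p * snd (fst p))))"
      by (rule continuous_on_compose2[OF cont[OF Suc]]) (use mem in \<open>auto intro!: continuous_intros\<close>)
    then have "continuous_on W (\<lambda>z. integral (cbox 0 1) (\<lambda>\<theta>. L (fst z, \<theta> * snd z) (Y n (fst z, \<theta> * snd z))))"
      by (intro integral_continuous_on_param) (simp add: split_beta)
    then show ?case unfolding YS by (auto intro!: continuous_intros)
  qed
  have Yb: "z \<in> W \<Longrightarrow> norm (Y n z) \<le> (M * \<bar>snd z\<bar>) ^ n / fact n * norm y0" for n z
  proof (induction n arbitrary: z)
    case 0 then show ?case by (simp add: Y0)
  next
    case (Suc n)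
    let ?t = "\<bar>snd z\<bar>"
    let ?c = "M * (M * ?t) ^ n / fact n * norm y0"
    have "((\<lambda>\<theta>::real. \<theta> ^ n) has_integral (1 ^ Suc n / real (Suc n) - 0 ^ Suc n / real (Suc n))) {0..1}"
      by (rule fundamental_theorem_of_calculus)
         (auto intro!: derivative_eq_intros simp: has_real_derivative_iff_has_vector_derivative[symmetric],
          cases n, auto simp: field_simps)
    then have pw: "((\<lambda>\<theta>::real. \<theta> ^ n * ?c) has_integral (1 / real (Suc n)) * ?c) {0..1}"
      by (intro has_integral_mult_left) simp
    have "norm (integral {0..1} (\<lambda>\<theta>. L (fst z, \<theta> * snd z) (Y n (fst z, \<theta> * snd z)))) \<le> integral {0..1} (\<lambda>\<theta>. \<theta> ^ n * ?c)"
    proof (rule integral_norm_bound_integral)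
      show "(\<lambda>\<theta>. L (fst z, \<theta> * snd z) (Y n (fst z, \<theta> * snd z))) integrable_on {0..1}"
        using cline[OF cont[OF Yc] Suc.prems] by (rule integrable_continuous_real)
      show "(\<lambda>\<theta>. \<theta> ^ n * ?c) integrable_on {0..1}" using pw by blast
      fix \<theta> :: real assume \<theta>: "\<theta> \<in> {0..1}"
      have "norm (L (fst z, \<theta> * snd z) (Y n (fst z, \<theta> * snd z))) \<le> M * norm (Y n (fst z, \<theta> * snd z))"
        by (rule bound[OF mem[OF Suc.prems \<theta>]])
      also have "\<dots> \<le> M * ((M * \<bar>\<theta> * snd z\<bar>) ^ n / fact n * norm y0)"
        using Suc.IH[OF mem[OF Suc.prems \<theta>]] M by (intro mult_left_mono) auto
      also have "\<dots> = \<theta> ^ n * ?c" using \<theta> by (simp add: abs_mult power_mult_distrib)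
      finally show "norm (L (fst z, \<theta> * snd z) (Y n (fst z, \<theta> * snd z))) \<le> \<theta> ^ n * ?c" .
    qed
    also have "\<dots> = (1 / real (Suc n)) * ?c" using pw by (rule integral_unique)
    finally have I: "norm (integral {0..1} (\<lambda>\<theta>. L (fst z, \<theta> * snd z) (Y n (fst z, \<theta> * snd z)))) \<le> (1 / real (Suc n)) * ?c" .
    have "norm (Y (Suc n) z) = ?t * norm (integral {0..1} (\<lambda>\<theta>. L (fst z, \<theta> * snd z) (Y n (fst z, \<theta> * snd z))))"
      by (simp add: YS)
    also have "\<dots> \<le> ?t * ((1 / real (Suc n)) * ?c)"
      by (rule mult_left_mono[OF I abs_ge_zero])
    also have "\<dots> = (M * ?t) ^ Suc n / fact (Suc n) * norm y0"
      by (simp add: field_simps)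
    finally show ?case .
  qed
  define R where "R = max \<bar>a\<bar> \<bar>b\<bar>"
  have Yb': "norm (Y n z) \<le> (M * R) ^ n / fact n * norm y0" if "z \<in> W" for n z
  proof -
    have "\<bar>snd z\<bar> \<le> R" using that by (auto simp: W R_def)
    then have "(M * \<bar>snd z\<bar>) ^ n \<le> (M * R) ^ n" using M by (intro power_mono mult_left_mono) auto
    then have "(M * \<bar>snd z\<bar>) ^ n / fact n * norm y0 \<le> (M * R) ^ n / fact n * norm y0"
      by (intro mult_right_mono divide_right_mono) auto
    with Yb[OF that, of n] show ?thesis by simp
  qed
  have "summable (\<lambda>n. (M * R) ^ n / fact n * norm y0)"
    using summable_exp[of "M * R"] by (intro summable_mult2) (simp add: divide_inverse mult.commute)
  then have ul: "uniform_limit W (\<lambda>n z. \<Sum>i<n. Y i z) (\<lambda>z. suminf (\<lambda>i. Y i z)) sequentially"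
    by (intro Weierstrass_m_test) (use Yb' in auto)
  define y where "y z = suminf (\<lambda>i. Y i z)" for z
  note ul = ul[folded y_def]
  have yc: "continuous_on W y"
    by (rule uniform_limit_theorem[OF _ ul]) (auto intro!: always_eventually continuous_on_sum Yc)
  have ieq: "y (s, t) = y0 + t *\<^sub>R integral {0..1} (\<lambda>\<theta>. L (s, \<theta> * t) (y (s, \<theta> * t)))" if st: "(s, t) \<in> W" for s t
  proof -
    let ?h = "\<lambda>\<theta>. L (s, \<theta> * t) (y (s, \<theta> * t))"
    let ?hN = "\<lambda>N \<theta>. L (s, \<theta> * t) (\<Sum>i<N. Y i (s, \<theta> * t))"
    have m: "(s, \<theta> * t) \<in> W" if "\<theta> \<in> {0..1}" for \<theta> using mem[OF st that] by simp
    have uh: "uniform_limit {0..1} ?hN ?h sequentially"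
    proof (rule uniform_limitI)
      fix e :: real assume e: "e > 0"
      \<comment> \<open>The denominator \<open>M + 1\<close> is positive also for
        \<open>M = 0\<close> and leaves a strict inequality after multiplication by
        \<open>M\<close>.\<close>
      have "e / (M + 1) > 0" using e M by simp
      from uniform_limitD[OF ul this]
      show "\<forall>\<^sub>F n in sequentially. \<forall>\<theta>\<in>{0..1}. dist (?hN n \<theta>) (?h \<theta>) < e"
      proof eventually_elim
        case (elim n)
        show ?case
        proof
          fix \<theta> :: real assume \<theta>: "\<theta> \<in> {0..1}"
          have "dist (?hN n \<theta>) (?h \<theta>) = norm (L (s, \<theta> * t) ((\<Sum>i<n. Y i (s, \<theta> * t)) - y (s, \<theta> * t)))"
            by (simp add: dist_norm linear_diff[OF lin[OF m[OF \<theta>]]])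
          also have "\<dots> \<le> M * dist (\<Sum>i<n. Y i (s, \<theta> * t)) (y (s, \<theta> * t))"
            unfolding dist_norm by (rule bound[OF m[OF \<theta>]])
          also have "\<dots> \<le> M * (e / (M + 1))"
            using elim m[OF \<theta>] M by (intro mult_left_mono) auto
          also have "\<dots> < e" using e M by (simp add: field_simps)
          finally show "dist (?hN n \<theta>) (?h \<theta>) < e" .
        qed
      qed
    qed
    have ci: "continuous_on {0..1} (\<lambda>\<theta>. L (s, \<theta> * t) (Y i (s, \<theta> * t)))" for i
      using cline[OF cont[OF Yc] st] by simp
    have hN: "?hN N \<theta> = (\<Sum>i<N. L (s, \<theta> * t) (Y i (s, \<theta> * t)))" if "\<theta> \<in> {0..1}" for N \<theta>
      by (rule linear_sum[OF lin[OF m[OF that]]])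
    have ch: "continuous_on {0..1} (?hN N)" for N
    proof -
      have "continuous_on W (\<lambda>z. \<Sum>i<N. Y i z)" by (intro continuous_on_sum Yc)
      from cline[OF cont[OF this] st] show ?thesis by simp
    qed
    obtain I H where I: "\<And>n. (?hN n has_integral I n) {0..1}" and H: "(?h has_integral H) {0..1}" and IH: "I \<longlonglongrightarrow> H"
      using uniform_limit_integral[OF uh ch trivial_limit_sequentially] by blast
    \<comment> \<open>Integration shifts the index of the series by one, so the integral of a
      partial sum is the next partial sum without its initial term \<open>y0\<close>.\<close>
    have In: "t *\<^sub>R I n = (\<Sum>i<Suc n. Y i (s, t)) - y0" for n
    proof -
      have "I n = integral {0..1} (?hN n)" using I[of n] by (simp add: integral_unique)
      also have "\<dots> = integral {0..1} (\<lambda>\<theta>. \<Sum>i<n. L (s, \<theta> * t) (Y i (s, \<theta> * t)))"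
        by (rule integral_cong) (rule hN)
      also have "\<dots> = (\<Sum>i<n. integral {0..1} (\<lambda>\<theta>. L (s, \<theta> * t) (Y i (s, \<theta> * t))))"
        by (rule integral_sum) (auto intro: integrable_continuous_real ci)
      finally have "t *\<^sub>R I n = (\<Sum>i<n. Y (Suc i) (s, t))" by (simp add: YS scaleR_sum_right)
      then show ?thesis by (simp add: sum.lessThan_Suc_shift Y0 del: sum.lessThan_Suc)
    qed
    have "(\<lambda>n. \<Sum>i<n. Y i (s, t)) \<longlonglongrightarrow> y (s, t)" by (rule tendsto_uniform_limitI[OF ul st])
    then have "(\<lambda>n. (\<Sum>i<Suc n. Y i (s, t)) - y0) \<longlonglongrightarrow> y (s, t) - y0"
      by (intro tendsto_diff tendsto_const LIMSEQ_Suc)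
    moreover have "(\<lambda>n. t *\<^sub>R I n) \<longlonglongrightarrow> t *\<^sub>R H" by (intro tendsto_scaleR tendsto_const IH)
    ultimately have "y (s, t) - y0 = t *\<^sub>R H" unfolding In by (rule LIMSEQ_unique)
    then show ?thesis using H by (simp add: integral_unique algebra_simps)
  qed
  have "((\<lambda>t. y (s, t)) has_vector_derivative L (s, t) (y (s, t))) (at t)" if s: "s \<in> {a<..<b}" and t: "t \<in> {a<..<b}" for s t
  proof -
    have "continuous_on {a<..<b} (\<lambda>t. L (s, t) (y (s, t)))"
      by (rule continuous_on_compose2[OF cont[OF yc]]) (use s in \<open>auto simp: W intro!: continuous_intros\<close>)
    from has_vector_derivative_scaled_integral[OF this ab t]
    have "((\<lambda>t. y0 + t *\<^sub>R integral {0..1} (\<lambda>\<theta>. L (s, \<theta> * t) (y (s, \<theta> * t)))) has_vector_derivative L (s, t) (y (s, t))) (at t)"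
      using has_vector_derivative_add[OF has_vector_derivative_const[of y0]] by fastforce
    then show ?thesis
      by (rule has_vector_derivative_transform_within_open[of _ _ _ "{a<..<b}"]) (use s t ieq W in auto)
  qed
  moreover have "y (s, 0) = y0" if "s \<in> {a<..<b}" for s using ieq[of s 0] that ab by (simp add: W)
  ultimately show ?thesis using yc by blast
qed

text \<open>Total differentiability at a point from one partial derivative there and joint
  continuity of the other. The differential equation supplies the latter for free.\<close>

lemma has_derivative_real_pair:
  fixes f :: "real \<times> real \<Rightarrow> 'c::banach"
  assumes "open S" "open J" "convex J" "s \<in> S" "t \<in> J"
    and "((\<lambda>s. f (s, t)) has_vector_derivative fs) (at s)"
    and ft: "\<And>s t. s \<in> S \<Longrightarrow> t \<in> J \<Longrightarrow> ((\<lambda>t. f (s, t)) has_vector_derivative ft (s, t)) (at t)"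
    and c: "continuous_on (S \<times> J) ft"
  shows "(f has_derivative (\<lambda>v. fst v *\<^sub>R fs + snd v *\<^sub>R ft (s, t))) (at (s, t))"
proof -
  have "((\<lambda>(s, t). f (s, t)) has_derivative (\<lambda>(h, k). h *\<^sub>R fs + blinfun_apply (blinfun_scaleR_left (ft (s, t))) k)) (at (s, t) within S \<times> J)"
  proof (rule has_derivative_partialsI[where fy="\<lambda>s t. blinfun_scaleR_left (ft (s, t))"])
    show "((\<lambda>s. f (s, t)) has_derivative (\<lambda>h. h *\<^sub>R fs)) (at s within S)"
      using assms(6) by (auto simp: has_vector_derivative_def intro: has_derivative_at_withinI)
    show "((\<lambda>t. f (s, t)) has_derivative blinfun_apply (blinfun_scaleR_left (ft (s, t)))) (at t within J)"
      if "s \<in> S" "t \<in> J" for s t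
      using ft[OF that] by (auto simp: has_vector_derivative_def blinfun_scaleR_left.rep_eq intro: has_derivative_at_withinI)
    have "continuous_on (S \<times> J) (\<lambda>z. blinfun_scaleR_left (ft z))"
      by (rule bounded_linear.continuous_on[OF bounded_linear_blinfun_scaleR_left c])
    then show "continuous (at (s, t) within S \<times> J) (\<lambda>(s, t). blinfun_scaleR_left (ft (s, t)))"
      using assms(4,5) by (auto simp: continuous_on_eq_continuous_within case_prod_beta')
  qed (use assms in auto)
  moreover have "at (s, t) within S \<times> J = at (s, t)"
    using assms by (intro at_within_open) (auto intro: open_Times)
  ultimately show ?thesis by (simp add: case_prod_beta' blinfun_scaleR_left.rep_eq)
qed

lemma Ck_on_scaled_integral:
  fixes h :: "real \<times> real \<Rightarrow> 'c::banach"
  assumes ab: "a < 0" "0 < b" and W: "W = {a<..<b} \<times> {a<..<b}" and h: "Ck_on k h W"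
  shows "Ck_on k (\<lambda>z. snd z *\<^sub>R integral {0..1} (\<lambda>\<theta>. h (fst z, \<theta> * snd z))) W"
proof -
  let ?m = "\<lambda>p :: (real \<times> real) \<times> real. (fst (fst p), snd p * snd (fst p))"
  define V where "V = {p. ?m p \<in> W}"
  have oW: "open W" unfolding W by (intro open_Times open_greaterThanLessThan)
  have oV: "open V" unfolding V_def by (rule open_Collect_mem[OF oW]) (auto intro!: continuous_intros)
  have WV: "W \<times> {0..1} \<subseteq> V"
    using mult_mem_interval[OF ab] by (auto simp: V_def W)
  have m: "Ck_on k ?m V"
  proof -
    have 1: "Ck_on k (\<lambda>p::(real \<times> real) \<times> real. (fst (fst p), 0::real)) V"
      by (rule Ck_on_linear) (intro bounded_linear_Pair bounded_linear_fst_comp bounded_linear_fst bounded_linear_zero)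
    have "bounded_linear (\<lambda>p::(real \<times> real) \<times> real. (0::real, snd (fst p)))"
      by (intro bounded_linear_Pair bounded_linear_snd_comp bounded_linear_fst bounded_linear_zero)
    then have 2: "Ck_on k (\<lambda>p::(real \<times> real) \<times> real. snd p *\<^sub>R (0::real, snd (fst p))) V"
      by (intro Ck_on_bilinear[OF bounded_bilinear_scaleR] Ck_on_linear bounded_linear_snd)
    from Ck_on_add[OF 1 2] show ?thesis by simp
  qed
  have "Ck_on k (\<lambda>p. h (?m p)) V"
    by (rule Ck_on_compose[OF _ h m]) (auto simp: V_def)
  from Ck_on_integral01[OF oV oW WV this]
  have "Ck_on k (\<lambda>z. integral {0..1} (\<lambda>\<theta>. h (fst z, \<theta> * snd z))) W" by simp
  then show ?thesis
    by (rule Ck_on_bilinear[OF bounded_bilinear_scaleR Ck_on_linear[OF bounded_linear_snd]])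
qed

section \<open>Fundamental solutions and their smooth dependence on the parameter\<close>

lemma blinfun_left_inverse_imp_right:
  fixes f h :: "'e::euclidean_space \<Rightarrow>\<^sub>L 'e"
  assumes "f o\<^sub>L h = id_blinfun"
  shows "h o\<^sub>L f = id_blinfun"
proof -
  have "blinfun_apply f \<circ> blinfun_apply h = id"
    using arg_cong[OF assms, of blinfun_apply] by (simp add: fun_eq_iff id_blinfun.rep_eq)
  then have "blinfun_apply h \<circ> blinfun_apply f = id"
    using linear_inverse_left[of "blinfun_apply f" "blinfun_apply h"]
    by (simp add: bounded_linear.linear[OF blinfun.bounded_linear_right])
  then show ?thesis by (intro blinfun_eqI) (simp add: fun_eq_iff id_blinfun.rep_eq)
qed

lemma const_if_vector_derivative_0:
  fixes f :: "real \<Rightarrow> 'c::real_normed_vector"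
  assumes "\<And>t. t \<in> {a<..<b} \<Longrightarrow> (f has_vector_derivative 0) (at t)" "s \<in> {a<..<b}" "t \<in> {a<..<b}"
  shows "f s = f t"
  using has_vector_derivative_zero_constant[of "{a<..<b}" f] assms has_vector_derivative_at_within
  by (metis convex_real_interval(8))

interpretation bc: bounded_bilinear "(o\<^sub>L) :: ('b::real_normed_vector \<Rightarrow>\<^sub>L 'c::real_normed_vector) \<Rightarrow> ('a::real_normed_vector \<Rightarrow>\<^sub>L 'b) \<Rightarrow> _"
  by (rule bounded_bilinear_blinfun_compose)

lemma blinfun_compose_simps:
  "(f o\<^sub>L h) o\<^sub>L k = f o\<^sub>L (h o\<^sub>L k)" "id_blinfun o\<^sub>L f = f" "f o\<^sub>L id_blinfun = f"
  by (auto intro!: blinfun_eqI simp: id_blinfun.rep_eq)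

text \<open>\<Psi> solves the adjoint equation, so its product with \<Phi> is constant and \<Psi> is
  the inverse. Comparing solutions for two parameters gives Duhamel's formula for the derivative in
  \<open>s\<close>. It expresses all first derivatives by \<Phi>, \<Psi>, \<open>A\<close> and its
  \<open>s\<close>-derivative, so regularity improves by one order at a time.\<close>

lemma fundamental_solution_box:
  fixes A :: "real \<times> real \<Rightarrow> 'e::euclidean_space \<Rightarrow>\<^sub>L 'e"
  assumes ab: "a < 0" "0 < b" and W: "W = {a<..<b} \<times> {a<..<b}"
    and A: "\<And>k. Ck_on k A W" and M': "\<forall>z\<in>W. norm (A z) \<le> M"
  shows "\<exists>\<Phi> \<Psi>. (\<forall>k. Ck_on k \<Phi> W \<and> Ck_on k \<Psi> W) \<and> (\<forall>s\<in>{a<..<b}. \<Phi> (s, 0) = id_blinfun \<and> \<Psi> (s, 0) = id_blinfun) \<and>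
    (\<forall>z\<in>W. \<Psi> z o\<^sub>L \<Phi> z = id_blinfun \<and> \<Phi> z o\<^sub>L \<Psi> z = id_blinfun) \<and>
    (\<forall>s\<in>{a<..<b}. \<forall>t\<in>{a<..<b}. ((\<lambda>t. \<Phi> (s, t)) has_vector_derivative A (s, t) o\<^sub>L \<Phi> (s, t)) (at t) \<and>
       ((\<lambda>t. \<Psi> (s, t)) has_vector_derivative - (\<Psi> (s, t) o\<^sub>L A (s, t))) (at t))"
proof -
  let ?J = "{a<..<b}"
  have M: "\<And>z. z \<in> W \<Longrightarrow> norm (A z) \<le> M" using M' by blast
  have oW: "open W" unfolding W by (intro open_Times open_greaterThanLessThan)
  have "norm (A (0, 0)) \<le> M" using M ab by (auto simp: W)
  then have M0: "M \<ge> 0" using norm_ge_zero[of "A (0, 0)"] by linarith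
  have Ac: "continuous_on W A" by (rule Ck_on_imp_continuous_on[OF A[of 0]])
  have "\<exists>y. continuous_on W y \<and> (\<forall>s\<in>?J. y (s, 0) = (id_blinfun :: 'e \<Rightarrow>\<^sub>L 'e)) \<and>
    (\<forall>s\<in>?J. \<forall>t\<in>?J. ((\<lambda>t. y (s, t)) has_vector_derivative A (s, t) o\<^sub>L y (s, t)) (at t))"
  proof (rule linear_ode_exists[OF ab W _ _ _ M0])
    show "linear ((o\<^sub>L) (A z))" for z by (rule bounded_linear.linear[OF bc.bounded_linear_right])
    show "norm (A z o\<^sub>L y) \<le> M * norm y" if "z \<in> W" for z and y :: "'e \<Rightarrow>\<^sub>L 'e"
      using norm_blinfun_compose[of "A z" y] mult_right_mono[OF M[OF that] norm_ge_zero[of y]] by linarith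
    show "continuous_on W (\<lambda>z. A z o\<^sub>L f z)" if "continuous_on W f" for f :: "real \<times> real \<Rightarrow> 'e \<Rightarrow>\<^sub>L 'e"
      by (rule bc.continuous_on[OF Ac that])
  qed
  then obtain \<Phi> where \<Phi>c: "continuous_on W \<Phi>" and \<Phi>0: "\<And>s. s \<in> ?J \<Longrightarrow> \<Phi> (s, 0) = (id_blinfun :: 'e \<Rightarrow>\<^sub>L 'e)"
    and \<Phi>d: "\<And>s t. s \<in> ?J \<Longrightarrow> t \<in> ?J \<Longrightarrow> ((\<lambda>t. \<Phi> (s, t)) has_vector_derivative A (s, t) o\<^sub>L \<Phi> (s, t)) (at t)"
    by blast
  have "\<exists>y. continuous_on W y \<and> (\<forall>s\<in>?J. y (s, 0) = (id_blinfun :: 'e \<Rightarrow>\<^sub>L 'e)) \<and>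
    (\<forall>s\<in>?J. \<forall>t\<in>?J. ((\<lambda>t. y (s, t)) has_vector_derivative - (y (s, t) o\<^sub>L A (s, t))) (at t))"
  proof (rule linear_ode_exists[OF ab W _ _ _ M0])
    show "linear (\<lambda>y :: 'e \<Rightarrow>\<^sub>L 'e. - (y o\<^sub>L A z))" for z
      by (rule bounded_linear.linear[OF bounded_linear_minus[OF bc.bounded_linear_left]])
    show "norm (- (y o\<^sub>L A z)) \<le> M * norm y" if "z \<in> W" for z and y :: "'e \<Rightarrow>\<^sub>L 'e"
      using norm_blinfun_compose[of y "A z"] mult_left_mono[OF M[OF that] norm_ge_zero[of y]]
      by (simp add: mult.commute)
    show "continuous_on W (\<lambda>z. - (f z o\<^sub>L A z))" if "continuous_on W f" for f :: "real \<times> real \<Rightarrow> 'e \<Rightarrow>\<^sub>L 'e"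
      by (intro continuous_on_minus bc.continuous_on[OF that Ac])
  qed
  then obtain \<Psi> where \<Psi>c: "continuous_on W \<Psi>" and \<Psi>0: "\<And>s. s \<in> ?J \<Longrightarrow> \<Psi> (s, 0) = (id_blinfun :: 'e \<Rightarrow>\<^sub>L 'e)"
    and \<Psi>d: "\<And>s t. s \<in> ?J \<Longrightarrow> t \<in> ?J \<Longrightarrow> ((\<lambda>t. \<Psi> (s, t)) has_vector_derivative - (\<Psi> (s, t) o\<^sub>L A (s, t))) (at t)"
    by blast
  \<comment> \<open>The inverse for one parameter is paired with the solution for another. At equal
    parameters the derivative is 0; otherwise it carries the difference of the coefficients.\<close>
  have Nd: "((\<lambda>t. \<Psi> (s, t) o\<^sub>L \<Phi> (s', t)) has_vector_derivative
      \<Psi> (s, t) o\<^sub>L ((A (s', t) - A (s, t)) o\<^sub>L \<Phi> (s', t))) (at t)"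
    if "s \<in> ?J" "s' \<in> ?J" "t \<in> ?J" for s s' t
    using bc.has_vector_derivative[OF \<Psi>d[OF that(1,3)] \<Phi>d[OF that(2,3)]]
    by (simp add: blinfun_compose_simps bc.diff_left bc.diff_right bc.minus_left)
  have zJ: "0 \<in> ?J" using ab by simp
  have inv: "\<Psi> z o\<^sub>L \<Phi> z = id_blinfun" if z: "z \<in> W" for z
  proof -
    obtain s t where z: "z = (s, t)" "s \<in> ?J" "t \<in> ?J" using z by (auto simp: W)
    have "\<Psi> (s, t) o\<^sub>L \<Phi> (s, t) = \<Psi> (s, 0) o\<^sub>L \<Phi> (s, 0)"
      using Nd[OF z(2,2)] by (intro const_if_vector_derivative_0[OF _ z(3) zJ]) (simp add: bc.zero_left bc.zero_right)
    then show ?thesis by (simp add: z(1) \<Phi>0[OF z(2)] \<Psi>0[OF z(2)] blinfun_compose_simps)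
  qed
  note inv' = blinfun_left_inverse_imp_right[OF inv]
  define As where "As z = frechet_derivative A (at z) (1, 0)" for z
  have AsC: "Ck_on k As W" for k unfolding As_def by (rule Ck_on_frechet(2)[OF oW A])
  have Asc: "continuous_on W As" by (rule Ck_on_imp_continuous_on[OF AsC[of 0]])
  have seg: "s + u * (s' - s) \<in> ?J" if "s \<in> ?J" "s' \<in> ?J" "u \<in> {0..1}" for s s' u
  proof -
    have "(1 - u) *\<^sub>R s + u *\<^sub>R s' \<in> ?J" using that by (intro convexD[OF convex_real_interval(8)]) auto
    then show ?thesis by (simp add: algebra_simps)
  qed
  \<comment> \<open>Hadamard's lemma: the difference of \<open>A\<close> at two parameters is their
    difference times this continuous mean of the derivative.\<close>
  define B where "B s z = integral {0..1} (\<lambda>u. As (s + u * (fst z - s), snd z))" for s z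
  have hadamard: "A (s', r) - A (s, r) = (s' - s) *\<^sub>R B s (s', r)" if s: "s \<in> ?J" "s' \<in> ?J" and r: "r \<in> ?J" for s s' r
  proof -
    have "((\<lambda>u. A (s + u * (s' - s), r)) has_vector_derivative (s' - s) *\<^sub>R As (s + u * (s' - s), r)) (at u within {0..1})"
      if u: "u \<in> {0..1}" for u
    proof -
      have m: "(s + u * (s' - s), r) \<in> W" using seg[OF s u] r by (auto simp: W)
      have d: "(A has_derivative frechet_derivative A (at (s + u * (s' - s), r))) (at (s + u * (s' - s), r))"
        by (rule Ck_on_frechet(1)[OF oW A m])
      have "((\<lambda>u. A (s + u * (s' - s), r)) has_derivative (\<lambda>h. frechet_derivative A (at (s + u * (s' - s), r)) (h * (s' - s), 0))) (at u)"
        by (rule has_derivative_compose[where g=A and f="\<lambda>u. (s + u * (s' - s), r)", OF _ d]) (auto intro!: derivative_eq_intros)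
      moreover have "(h * (s' - s), 0) = (h * (s' - s)) *\<^sub>R (1, 0 :: real)" for h by simp
      ultimately have "((\<lambda>u. A (s + u * (s' - s), r)) has_derivative (\<lambda>h. (h * (s' - s)) *\<^sub>R As (s + u * (s' - s), r))) (at u)"
        unfolding As_def by (simp only: linear_cmul[OF has_derivative_linear[OF d]])
      then show ?thesis by (auto simp: has_vector_derivative_def intro: has_derivative_at_withinI)
    qed
    then have "((\<lambda>u. (s' - s) *\<^sub>R As (s + u * (s' - s), r)) has_integral A (s + 1 * (s' - s), r) - A (s + 0 * (s' - s), r)) {0..1}"
      by (intro fundamental_theorem_of_calculus) auto
    from integral_unique[OF this] show ?thesis by (simp add: B_def)
  qed
  have Bc: "continuous_on W (B s)" if "s \<in> ?J" for s
  proof -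
    have "continuous_on (W \<times> cbox 0 1) (\<lambda>p. As (s + snd p * (fst (fst p) - s), snd (fst p)))"
      by (rule continuous_on_compose2[OF Asc]) (use seg that in \<open>auto simp: W intro!: continuous_intros\<close>)
    then have "continuous_on W (\<lambda>z. integral (cbox 0 1) (\<lambda>u. As (s + u * (fst z - s), snd z)))"
      by (intro integral_continuous_on_param) (simp add: split_beta)
    then show ?thesis by (simp add: B_def[abs_def])
  qed
  \<comment> \<open>The difference quotient of the product in the parameter. Its continuity uses
    only that \<Phi> and \<Psi> are continuous, so no differentiability in \<open>s\<close> is
    presupposed.\<close>
  define kk where "kk s t s' = t *\<^sub>R integral {0..1} (\<lambda>\<theta>. \<Psi> (s, \<theta> * t) o\<^sub>L (B s (s', \<theta> * t) o\<^sub>L \<Phi> (s', \<theta> * t)))" for s t s'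
  have mulJ: "\<theta> * t \<in> ?J" if "t \<in> ?J" "\<theta> \<in> {0..1}" for \<theta> t using mult_mem_interval[OF ab that] .
  have kc: "continuous_on ?J (kk s t)" if s: "s \<in> ?J" and t: "t \<in> ?J" for s t
  proof -
    have "continuous_on (?J \<times> cbox 0 1) (\<lambda>p. \<Psi> (s, snd p * t) o\<^sub>L (B s (fst p, snd p * t) o\<^sub>L \<Phi> (fst p, snd p * t)))"
      by (intro bc.continuous_on continuous_on_compose2[OF \<Psi>c] continuous_on_compose2[OF \<Phi>c] continuous_on_compose2[OF Bc[OF s]])
         (use mulJ s t in \<open>auto simp: W intro!: continuous_intros\<close>)
    then have "continuous_on ?J (\<lambda>s'. integral (cbox 0 1) (\<lambda>\<theta>. \<Psi> (s, \<theta> * t) o\<^sub>L (B s (s', \<theta> * t) o\<^sub>L \<Phi> (s', \<theta> * t))))"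
      by (intro integral_continuous_on_param) (simp add: split_beta)
    then show ?thesis by (auto simp: kk_def[abs_def] intro!: continuous_intros)
  qed
  have N: "\<Psi> (s, t) o\<^sub>L \<Phi> (s', t) = id_blinfun + (s' - s) *\<^sub>R kk s t s'"
    if s: "s \<in> ?J" "s' \<in> ?J" and t: "t \<in> ?J" for s s' t
  proof -
    let ?f = "\<lambda>t. \<Psi> (s, t) o\<^sub>L ((A (s', t) - A (s, t)) o\<^sub>L \<Phi> (s', t))"
    have fc: "continuous_on ?J ?f"
      by (intro bc.continuous_on continuous_on_diff continuous_on_compose2[OF \<Psi>c] continuous_on_compose2[OF \<Phi>c] continuous_on_compose2[OF Ac])
         (use s in \<open>auto simp: W intro!: continuous_intros\<close>)
    let ?D = "\<lambda>t. (\<Psi> (s, t) o\<^sub>L \<Phi> (s', t)) - t *\<^sub>R integral {0..1} (\<lambda>\<theta>. ?f (\<theta> * t))"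
    have "(?D has_vector_derivative 0) (at t)" if t: "t \<in> ?J" for t
      using has_vector_derivative_diff[OF Nd[OF s t] has_vector_derivative_scaled_integral[OF fc ab t]] by simp
    from const_if_vector_derivative_0[OF this t zJ]
    have "\<Psi> (s, t) o\<^sub>L \<Phi> (s', t) = id_blinfun + t *\<^sub>R integral {0..1} (\<lambda>\<theta>. ?f (\<theta> * t))"
      using \<Psi>0[OF s(1)] \<Phi>0[OF s(2)] by (simp add: blinfun_compose_simps algebra_simps)
    also have "integral {0..1} (\<lambda>\<theta>. ?f (\<theta> * t)) =
        integral {0..1} (\<lambda>\<theta>. (s' - s) *\<^sub>R (\<Psi> (s, \<theta> * t) o\<^sub>L (B s (s', \<theta> * t) o\<^sub>L \<Phi> (s', \<theta> * t))))"
      by (rule integral_cong) (simp add: hadamard[OF s mulJ[OF t]] bc.scaleR_left bc.scaleR_right)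
    finally show ?thesis by (simp add: kk_def scaleR_left_commute)
  qed
  have \<Phi>diff: "\<Phi> (s', t) - \<Phi> (s, t) = (s' - s) *\<^sub>R (\<Phi> (s, t) o\<^sub>L kk s t s')"
    if s: "s \<in> ?J" "s' \<in> ?J" and t: "t \<in> ?J" for s s' t
  proof -
    have st: "(s, t) \<in> W" using s t by (simp add: W)
    have "\<Phi> (s', t) = \<Phi> (s, t) o\<^sub>L (\<Psi> (s, t) o\<^sub>L \<Phi> (s', t))"
      by (simp add: blinfun_compose_simps(1)[symmetric] inv'[OF st] blinfun_compose_simps(2))
    then show ?thesis unfolding N[OF s t] by (simp add: bc.add_right bc.scaleR_right blinfun_compose_simps)
  qed
  have \<Psi>diff: "\<Psi> (s', t) - \<Psi> (s, t) = (s' - s) *\<^sub>R (- (\<Psi> (s', t) o\<^sub>L (\<Phi> (s, t) o\<^sub>L (kk s t s' o\<^sub>L \<Psi> (s, t)))))"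
    if s: "s \<in> ?J" "s' \<in> ?J" and t: "t \<in> ?J" for s s' t
  proof -
    have st: "(s, t) \<in> W" "(s', t) \<in> W" using s t by (auto simp: W)
    \<comment> \<open>The resolvent identity for a difference of inverses.\<close>
    have "\<Psi> (s', t) - \<Psi> (s, t) = - (\<Psi> (s', t) o\<^sub>L ((\<Phi> (s', t) - \<Phi> (s, t)) o\<^sub>L \<Psi> (s, t)))"
      using inv[OF st(2)] inv'[OF st(1)]
      by (simp add: bc.diff_left bc.diff_right blinfun_compose_simps(3) flip: blinfun_compose_simps(1))
         (simp add: blinfun_compose_simps)
    then show ?thesis unfolding \<Phi>diff[OF s t] by (simp add: bc.scaleR_left bc.scaleR_right blinfun_compose_simps)
  qed
  \<comment> \<open>The value of the difference quotient \<open>kk\<close> at coinciding parameters,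
    an integral of \<Psi>, \<open>As\<close> and \<Phi>.\<close>
  define V where "V z = snd z *\<^sub>R integral {0..1} (\<lambda>\<theta>. \<Psi> (fst z, \<theta> * snd z) o\<^sub>L (As (fst z, \<theta> * snd z) o\<^sub>L \<Phi> (fst z, \<theta> * snd z)))" for z
  have kkV: "kk s t s = V (s, t)" for s t by (simp add: kk_def V_def B_def)
  have isC: "isCont f s" if "continuous_on ?J f" "s \<in> ?J" for f :: "real \<Rightarrow> 'e \<Rightarrow>\<^sub>L 'e" and s
    using that by (simp add: continuous_on_eq_continuous_at)
  have \<Phi>s: "((\<lambda>s. \<Phi> (s, t)) has_vector_derivative \<Phi> (s, t) o\<^sub>L V (s, t)) (at s)" if s: "s \<in> ?J" and t: "t \<in> ?J" for s t
    unfolding kkV[symmetric]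
    by (rule has_vector_derivative_factor[where S="?J" and c="\<lambda>s'. \<Phi> (s, t) o\<^sub>L kk s t s'"])
       (use s t \<Phi>diff in \<open>auto intro!: isC bc.continuous_on continuous_on_const kc\<close>)
  have \<Psi>s: "((\<lambda>s. \<Psi> (s, t)) has_vector_derivative - (V (s, t) o\<^sub>L \<Psi> (s, t))) (at s)" if s: "s \<in> ?J" and t: "t \<in> ?J" for s t
  proof -
    have c: "continuous_on ?J (\<lambda>s'. - (\<Psi> (s', t) o\<^sub>L (\<Phi> (s, t) o\<^sub>L (kk s t s' o\<^sub>L \<Psi> (s, t)))))"
      by (intro continuous_on_minus bc.continuous_on continuous_on_const kc[OF s t] continuous_on_compose2[OF \<Psi>c])
         (use t in \<open>auto simp: W intro!: continuous_intros\<close>)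
    have "((\<lambda>s. \<Psi> (s, t)) has_vector_derivative - (\<Psi> (s, t) o\<^sub>L (\<Phi> (s, t) o\<^sub>L (kk s t s o\<^sub>L \<Psi> (s, t))))) (at s)"
      by (rule has_vector_derivative_factor[where S="?J" and c="\<lambda>s'. - (\<Psi> (s', t) o\<^sub>L (\<Phi> (s, t) o\<^sub>L (kk s t s' o\<^sub>L \<Psi> (s, t))))"])
         (use s t \<Psi>diff isC[OF c s] in auto)
    moreover have "\<Psi> (s, t) o\<^sub>L (\<Phi> (s, t) o\<^sub>L (kk s t s o\<^sub>L \<Psi> (s, t))) = V (s, t) o\<^sub>L \<Psi> (s, t)"
      using inv[of "(s, t)"] s t
      by (simp add: blinfun_compose_simps(1)[symmetric] W kkV) (simp add: blinfun_compose_simps)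
    ultimately show ?thesis by simp
  qed
  have cA\<Phi>: "continuous_on (?J \<times> ?J) (\<lambda>z. A z o\<^sub>L \<Phi> z)" using bc.continuous_on[OF Ac \<Phi>c] by (simp add: W)
  have c\<Psi>A: "continuous_on (?J \<times> ?J) (\<lambda>z. - (\<Psi> z o\<^sub>L A z))"
    using continuous_on_minus[OF bc.continuous_on[OF \<Psi>c Ac]] by (simp add: W)
  have \<Phi>D: "(\<Phi> has_derivative (\<lambda>v. fst v *\<^sub>R (\<Phi> z o\<^sub>L V z) + snd v *\<^sub>R (A z o\<^sub>L \<Phi> z))) (at z)" if z: "z \<in> W" for z
  proof -
    obtain s t where z: "z = (s, t)" "s \<in> ?J" "t \<in> ?J" using z by (auto simp: W)
    show ?thesis unfolding z(1)
      using has_derivative_real_pair[OF open_greaterThanLessThan open_greaterThanLessThan convex_real_interval(8) z(2,3) \<Phi>s[OF z(2,3)] _ cA\<Phi>] \<Phi>d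
      by simp
  qed
  have \<Psi>D: "(\<Psi> has_derivative (\<lambda>v. fst v *\<^sub>R - (V z o\<^sub>L \<Psi> z) + snd v *\<^sub>R - (\<Psi> z o\<^sub>L A z))) (at z)" if z: "z \<in> W" for z
  proof -
    obtain s t where z: "z = (s, t)" "s \<in> ?J" "t \<in> ?J" using z by (auto simp: W)
    show ?thesis unfolding z(1)
      using has_derivative_real_pair[OF open_greaterThanLessThan open_greaterThanLessThan convex_real_interval(8) z(2,3) \<Psi>s[OF z(2,3)] _ c\<Psi>A] \<Psi>d
      by simp
  qed
  have neg: "Ck_on k f W \<Longrightarrow> Ck_on k (\<lambda>z. - f z) W" for k and f :: "real \<times> real \<Rightarrow> 'e \<Rightarrow>\<^sub>L 'e"
    using Ck_on_bilinear[OF bounded_bilinear_scaleR Ck_on_const[of k "-1::real" W], of f] by simp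
  \<comment> \<open>If \<Phi> and \<Psi> are of class \<open>k\<close>, so is \<open>V\<close>,
    hence so are the derivatives of both; this makes them of class \<open>k + 1\<close>.\<close>
  have C: "Ck_on k \<Phi> W \<and> Ck_on k \<Psi> W" for k
  proof (induction k)
    case 0 then show ?case using \<Phi>c \<Psi>c by simp
  next
    case (Suc k)
    note cb = Ck_on_bilinear[OF bounded_bilinear_blinfun_compose]
    have \<Phi>k: "Ck_on k \<Phi> W" and \<Psi>k: "Ck_on k \<Psi> W" using Suc by auto
    have "Ck_on k (\<lambda>z. \<Psi> z o\<^sub>L (As z o\<^sub>L \<Phi> z)) W" by (intro cb \<Phi>k \<Psi>k AsC)
    from Ck_on_scaled_integral[OF ab W this] have Vk: "Ck_on k V W" by (simp add: V_def[abs_def])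
    have "Ck_on k (\<lambda>z. fst v *\<^sub>R (\<Phi> z o\<^sub>L V z) + snd v *\<^sub>R (A z o\<^sub>L \<Phi> z)) W" for v :: "real \<times> real"
      by (intro Ck_on_add Ck_on_bilinear[OF bounded_bilinear_scaleR] Ck_on_const cb \<Phi>k Vk A)
    then have "Ck_on (Suc k) \<Phi> W" using \<Phi>D by (intro Ck_on_SucI)
    moreover have "Ck_on k (\<lambda>z. fst v *\<^sub>R - (V z o\<^sub>L \<Psi> z) + snd v *\<^sub>R - (\<Psi> z o\<^sub>L A z)) W" for v :: "real \<times> real"
      by (intro Ck_on_add Ck_on_bilinear[OF bounded_bilinear_scaleR] Ck_on_const neg cb \<Psi>k Vk A)
    then have "Ck_on (Suc k) \<Psi> W" using \<Psi>D by (intro Ck_on_SucI)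
    ultimately show ?case ..
  qed
  show ?thesis
    by (intro exI[of _ \<Phi>] exI[of _ \<Psi>] conjI allI ballI) (simp_all add: C \<Phi>0 \<Psi>0 inv inv' \<Phi>d \<Psi>d)
qed

lemma unit_square_box:
  assumes "open U" "{0..1} \<times> {0..1} \<subseteq> (U :: (real \<times> real) set)"
  obtains d where "d > 0" "{-d..1+d} \<times> {-d..1+d} \<subseteq> U"
proof -
  have "compact ({0..1} \<times> {0..1::real} :: (real \<times> real) set)" by (intro compact_Times compact_Icc)
  then obtain e where e: "e > 0" "(\<Union>x\<in>{0..1} \<times> {0..1}. ball x e) \<subseteq> U"
    using compact_subset_open_imp_ball_epsilon_subset[OF _ assms] by blast
  \<comment> \<open>Clamping both coordinates to the unit interval moves a point of the enlarged
    square by at most \<open>d\<close> in each of them, in total by at most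
    \<open>e / 2\<close>.\<close>
  define d where "d = e / 4"
  have "{-d..1+d} \<times> {-d..1+d} \<subseteq> (\<Union>x\<in>{0..1} \<times> {0..1}. ball x e)"
  proof
    fix z :: "real \<times> real" assume z: "z \<in> {-d..1+d} \<times> {-d..1+d}"
    define c where "c r = max 0 (min 1 r)" for r :: real
    have zz: "fst z \<in> {-d..1+d}" "snd z \<in> {-d..1+d}" using z by auto
    have cr: "c r \<in> {0..1}" "\<bar>c r - r\<bar> \<le> d" if "r \<in> {-d..1+d}" for r
      using that e by (auto simp: c_def d_def min_def max_def)
    have "dist (c (fst z), c (snd z)) z \<le> \<bar>c (fst z) - fst z\<bar> + \<bar>c (snd z) - snd z\<bar>"
      using sqrt_sum_squares_le_sum_abs by (cases z) (auto simp: dist_Pair_Pair dist_real_def)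
    also have "\<dots> \<le> d + d" by (intro add_mono cr zz)
    also have "\<dots> < e" using e by (simp add: d_def)
    finally have "dist (c (fst z), c (snd z)) z < e" .
    moreover have "(c (fst z), c (snd z)) \<in> {0..1} \<times> {0..1}" using cr(1)[OF zz(1)] cr(1)[OF zz(2)] by simp
    ultimately show "z \<in> (\<Union>x\<in>{0..1} \<times> {0..1}. ball x e)" by (intro UN_I[of "(c (fst z), c (snd z))"]) auto
  qed
  then show thesis using e by (intro that[of d]) (auto simp: d_def)
qed

lemma fundamental_solution:
  fixes A :: "real \<times> real \<Rightarrow> 'e::euclidean_space \<Rightarrow>\<^sub>L 'e"
  assumes A: "smooth_on ({0..1} \<times> {0..1}) A"
  obtains \<Phi> \<Psi> where "smooth_on ({0..1} \<times> {0..1}) \<Phi>" "smooth_on ({0..1} \<times> {0..1}) \<Psi>"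
    "\<And>s. s \<in> {0..1} \<Longrightarrow> \<Phi> (s, 0) = id_blinfun \<and> \<Psi> (s, 0) = id_blinfun"
    "\<And>s t. s \<in> {0..1} \<Longrightarrow> t \<in> {0..1} \<Longrightarrow> \<Psi> (s, t) o\<^sub>L \<Phi> (s, t) = id_blinfun \<and> \<Phi> (s, t) o\<^sub>L \<Psi> (s, t) = id_blinfun"
    "\<And>s t. s \<in> {0..1} \<Longrightarrow> t \<in> {0..1} \<Longrightarrow> ((\<lambda>t. \<Phi> (s, t)) has_vector_derivative A (s, t) o\<^sub>L \<Phi> (s, t)) (at t within {0..1})"
    "\<And>s t. s \<in> {0..1} \<Longrightarrow> t \<in> {0..1} \<Longrightarrow> ((\<lambda>t. \<Psi> (s, t)) has_vector_derivative - (\<Psi> (s, t) o\<^sub>L A (s, t))) (at t within {0..1})"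
proof -
  obtain U F where F: "open U" "{0..1} \<times> {0..1} \<subseteq> U" "\<And>k. Ck_on k F U" "\<And>x. x \<in> {0..1} \<times> {0..1} \<Longrightarrow> F x = A x"
    using A by (rule smooth_onE) blast
  obtain d where d: "d > 0" "{-d..1+d} \<times> {-d..1+d} \<subseteq> U" using unit_square_box[OF F(1,2)] by blast
  define W where "W = {-d<..<1+d} \<times> {-d<..<1+d}"
  have WK: "W \<subseteq> {-d..1+d} \<times> {-d..1+d}" by (auto simp: W_def)
  have TW: "{0..1} \<times> {0..1} \<subseteq> W" using d by (auto simp: W_def)
  have oW: "open W" unfolding W_def by (intro open_Times open_greaterThanLessThan)
  have FW: "Ck_on k F W" for k by (rule Ck_on_subset[OF _ F(3)]) (use WK d in blast)
  \<comment> \<open>The operators need a uniform bound on the open box; compactness of its closure,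
    still inside the domain of the extension, gives one.\<close>
  have "continuous_on ({-d..1+d} \<times> {-d..1+d}) F"
    using Ck_on_imp_continuous_on[OF F(3)[of 0]] d(2) by (rule continuous_on_subset)
  then have "bounded (F ` ({-d..1+d} \<times> {-d..1+d}))"
    by (intro compact_imp_bounded compact_continuous_image compact_Times compact_Icc)
  then obtain M where M: "\<And>z. z \<in> {-d..1+d} \<times> {-d..1+d} \<Longrightarrow> norm (F z) \<le> M"
    unfolding bounded_iff by blast
  have M': "\<forall>z\<in>W. norm (F z) \<le> M" using M WK by blast
  have nd: "- d < 0" "0 < 1 + d" using d by auto
  obtain \<Phi> \<Psi> where "(\<forall>k. Ck_on k \<Phi> W \<and> Ck_on k \<Psi> W) \<and> (\<forall>s\<in>{-d<..<1+d}. \<Phi> (s, 0) = id_blinfun \<and> \<Psi> (s, 0) = id_blinfun) \<and>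
    (\<forall>z\<in>W. \<Psi> z o\<^sub>L \<Phi> z = id_blinfun \<and> \<Phi> z o\<^sub>L \<Psi> z = id_blinfun) \<and>
    (\<forall>s\<in>{-d<..<1+d}. \<forall>t\<in>{-d<..<1+d}. ((\<lambda>t. \<Phi> (s, t)) has_vector_derivative F (s, t) o\<^sub>L \<Phi> (s, t)) (at t) \<and>
       ((\<lambda>t. \<Psi> (s, t)) has_vector_derivative - (\<Psi> (s, t) o\<^sub>L F (s, t))) (at t))"
    using fundamental_solution_box[OF nd W_def FW M'] by (elim exE) (rule that)
  then have C: "\<And>k. Ck_on k \<Phi> W" "\<And>k. Ck_on k \<Psi> W"
    and 0: "\<And>s. s \<in> {-d<..<1+d} \<Longrightarrow> \<Phi> (s, 0) = id_blinfun \<and> \<Psi> (s, 0) = id_blinfun"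
    and inv: "\<And>z. z \<in> W \<Longrightarrow> \<Psi> z o\<^sub>L \<Phi> z = id_blinfun \<and> \<Phi> z o\<^sub>L \<Psi> z = id_blinfun"
    and D: "\<And>s t. s \<in> {-d<..<1+d} \<Longrightarrow> t \<in> {-d<..<1+d} \<Longrightarrow>
       ((\<lambda>t. \<Phi> (s, t)) has_vector_derivative F (s, t) o\<^sub>L \<Phi> (s, t)) (at t) \<and>
       ((\<lambda>t. \<Psi> (s, t)) has_vector_derivative - (\<Psi> (s, t) o\<^sub>L F (s, t))) (at t)"
    by simp_all
  have J: "s \<in> {-d<..<1+d}" if "s \<in> {0..1}" for s using that d by auto
  have D': "((\<lambda>t. \<Phi> (s, t)) has_vector_derivative A (s, t) o\<^sub>L \<Phi> (s, t)) (at t within {0..1})"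
    "((\<lambda>t. \<Psi> (s, t)) has_vector_derivative - (\<Psi> (s, t) o\<^sub>L A (s, t))) (at t within {0..1})"
    if "s \<in> {0..1}" "t \<in> {0..1}" for s t
    using D[OF J[OF that(1)] J[OF that(2)]] F(4)[of "(s, t)"] that
    by (auto intro: has_vector_derivative_at_within)
  have inv2: "\<Psi> (s, t) o\<^sub>L \<Phi> (s, t) = id_blinfun \<and> \<Phi> (s, t) o\<^sub>L \<Psi> (s, t) = id_blinfun"
    if "s \<in> {0..1}" "t \<in> {0..1}" for s t by (rule inv) (use that TW in auto)
  show thesis
    by (rule that[of \<Phi> \<Psi>])
       (use smooth_onI[OF oW TW C(1)] smooth_onI[OF oW TW C(2)] 0 J inv2 D' in auto)
qed

section \<open>The square root velocity representation\<close>

lemma smooth_has_velocity: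
  assumes "smooth_on {0..1} f" "t \<in> {0..1}"
  shows "(f has_vector_derivative velocity f t) (at t within {0..1})"
proof -
  have "(f has_vector_derivative pd {0..1} 1 f (0 + t *\<^sub>R 1)) (at t within {0..1})"
    by (rule pd_has_vector_derivative[OF assms(1) admissible_interval(1) _ assms(2)]) auto
  then show ?thesis using velocity_eqI[OF _ assms(2)] by metis
qed

lemma const_within_unit_interval:
  fixes f :: "real \<Rightarrow> 'c::real_normed_vector"
  assumes "\<And>t. t \<in> {0..1} \<Longrightarrow> (f has_vector_derivative 0) (at t within {0..1})" "s \<in> {0..1}" "t \<in> {0..1}"
  shows "f s = f t"
  using has_vector_derivative_zero_constant[OF convex_real_interval(5), of 0 1 f] assms by metis

context riem_so
begin

text \<open>In the trivialisation a parallel field solves a linear equation with coefficient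
  \<open>- Gam\<close>. Its fundamental solution \<Phi> transports from 0 to \<open>t\<close>, so
  the inverse \<Psi> transports back to the starting point, smoothly in both parameters and without
  creating zeros.\<close>

lemma srvf_regular:
  assumes c: "path_of_curves c" and p: "p = (\<lambda>s. c s 0)" and q: "q = (\<lambda>s t. srvf g nab (c s) t)"
  shows "regular_pair p q" and "\<And>s t. s \<in> {0..1} \<Longrightarrow> t \<in> {0..1} \<Longrightarrow> q s t \<noteq> 0"
proof -
  let ?J = "{0..1::real}"
  let ?T = "?J \<times> ?J"
  define C where "C z = c (fst z) (snd z)" for z
  have C: "smooth_on ?T C" "\<And>z. z \<in> ?T \<Longrightarrow> C z \<in> SO"
    using c by (auto simp: path_of_curves_def C_def[abs_def] case_prod_beta' curve_space_def)
  have adm: "admissible ?T (0, 1)" by (rule admissible_snd[OF admissible_interval(1)])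
  define \<xi> where "\<xi> = logd ?T C (0, 1)"
  have \<xi>: "smooth_on ?T \<xi>" "\<And>z. z \<in> ?T \<Longrightarrow> \<xi> z \<in> so"
    unfolding \<xi>_def using smooth_on_logd[OF C(1) adm] logd_so(1)[OF C adm] by auto
  have vel: "velocity (c s) t = C (s, t) ** \<xi> (s, t)" if s: "s \<in> ?J" and t: "t \<in> ?J" for s t
  proof -
    have "velocity (c s) t = pd ?T (0, 1) C ((s, 0) + t *\<^sub>R (0, 1))"
      by (rule velocity_pd[OF C(1) adm _ t]) (use s in \<open>auto simp: C_def\<close>)
    then show ?thesis unfolding \<xi>_def using logd_so(2)[OF C adm, of "(s, t)"] s t by simp
  qed
  have \<xi>n: "\<xi> z \<noteq> 0" if "z \<in> ?T" for z
  proof -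
    have "velocity (c (fst z)) (snd z) \<noteq> 0" using c that by (auto simp: path_of_curves_def curve_space_def)
    then show ?thesis using vel[of "fst z" "snd z"] that by (auto simp: mm_simps)
  qed
  define n where "n z = G (C z) (\<xi> z) (\<xi> z)" for z
  have npos: "n z > 0" if "z \<in> ?T" for z
    unfolding n_def by (rule G_pos[OF C(2) \<xi>(2) \<xi>n]) (use that in auto)
  have nsm: "smooth_on ?T n" unfolding n_def[abs_def] by (rule bilin_field_smooth[OF bilin_field_G C \<xi>(1) \<xi>(1)])
  \<comment> \<open>The square root of the norm is the fourth root of the squared norm
    \<open>n\<close>.\<close>
  define u where "u z = (n z powr (-1/4)) *\<^sub>R \<xi> z" for z
  have u: "smooth_on ?T u" "\<And>z. z \<in> ?T \<Longrightarrow> u z \<in> so" "\<And>z. z \<in> ?T \<Longrightarrow> u z \<noteq> 0"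
  proof -
    have "smooth_on ?T (\<lambda>z. n z powr (-1/4))"
      by (rule smooth_on_compose[OF smooth_on_real_powr nsm]) (use npos in auto)
    then show "smooth_on ?T u" unfolding u_def[abs_def] by (rule smooth_on_scaleR[OF _ \<xi>(1)])
    show "\<And>z. z \<in> ?T \<Longrightarrow> u z \<in> so" unfolding u_def by (intro so_closed \<xi>(2))
    show "u z \<noteq> 0" if "z \<in> ?T" for z using npos[OF that] \<xi>n[OF that] by (auto simp: u_def)
  qed
  have unit: "(1 / sqrt (riem_norm g (c s t) (velocity (c s) t))) *\<^sub>R velocity (c s) t = C (s, t) ** u (s, t)"
    if s: "s \<in> ?J" and t: "t \<in> ?J" for s t
  proof -
    have z: "(s, t) \<in> ?T" using s t by auto
    have "riem_norm g (c s t) (velocity (c s) t) = sqrt (n (s, t))"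
      unfolding riem_norm_def n_def G_def vel[OF s t] skw_id[OF \<xi>(2)[OF z]] by (simp add: C_def)
    moreover have "sqrt (sqrt (n (s, t))) = n (s, t) powr (1/4)"
      using npos[OF z] by (simp add: powr_half_sqrt[symmetric] powr_powr)
    ultimately have "1 / sqrt (riem_norm g (c s t) (velocity (c s) t)) = n (s, t) powr (-1/4)"
      by (simp add: powr_minus_divide[symmetric])
    then show ?thesis unfolding vel[OF s t] u_def by (simp add: mm_simps)
  qed
  \<comment> \<open>The operator is assembled from rank-one operators, one for each basis matrix, so
    that its smooth dependence on \<open>z\<close> as an operator is visible.\<close>
  define A :: "real \<times> real \<Rightarrow> 'n sqmat \<Rightarrow>\<^sub>L 'n sqmat" where
    "A z = (\<Sum>b\<in>Basis. blinfun_scaleR_left (- Gam (C z) (\<xi> z) b) o\<^sub>L blinfun_inner_left b)" for z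
  have Asm: "smooth_on ?T A"
    unfolding A_def[abs_def]
    by (intro smooth_on_sum smooth_on_bilinear[OF bounded_bilinear_blinfun_compose] smooth_on_const
        smooth_on_compose_linear[OF bounded_linear_blinfun_scaleR_left] smooth_on_minus
        bilin_field_smooth[OF bilin_field_Gam C \<xi>(1)])
  have Aap: "blinfun_apply (A z) v = - Gam (C z) (\<xi> z) v" if z: "z \<in> ?T" for z v
  proof -
    have "linear (Gam (C z) (\<xi> z))" using Gam_bilinear[OF C(2)[OF z]] by (simp add: bilinear_def)
    from linear_eq_sum_Basis[OF this, of v] show ?thesis
      by (simp add: A_def blinfun.sum_left blinfun_inner_left.rep_eq sum_negf)
  qed
  obtain \<Phi> \<Psi> where FS: "smooth_on ?T \<Phi>" "smooth_on ?T \<Psi>"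
    "\<And>s. s \<in> ?J \<Longrightarrow> \<Phi> (s, 0) = id_blinfun \<and> \<Psi> (s, 0) = id_blinfun"
    "\<And>s t. s \<in> ?J \<Longrightarrow> t \<in> ?J \<Longrightarrow> \<Psi> (s, t) o\<^sub>L \<Phi> (s, t) = id_blinfun \<and> \<Phi> (s, t) o\<^sub>L \<Psi> (s, t) = id_blinfun"
    "\<And>s t. s \<in> ?J \<Longrightarrow> t \<in> ?J \<Longrightarrow> ((\<lambda>t. \<Phi> (s, t)) has_vector_derivative A (s, t) o\<^sub>L \<Phi> (s, t)) (at t within ?J)"
    "\<And>s t. s \<in> ?J \<Longrightarrow> t \<in> ?J \<Longrightarrow> ((\<lambda>t. \<Psi> (s, t)) has_vector_derivative - (\<Psi> (s, t) o\<^sub>L A (s, t))) (at t within ?J)"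
    by (rule fundamental_solution[OF Asm]) blast
  have PsPh: "\<Psi> (s, t) (\<Phi> (s, t) v) = v" "\<Phi> (s, t) (\<Psi> (s, t) v) = v" if "s \<in> ?J" "t \<in> ?J" for s t v
    using FS(4)[OF that] by (metis blinfun_apply_blinfun_compose blinfun_apply_id_blinfun)+
  have Phv: "((\<lambda>t. \<Phi> (s, t) v) has_vector_derivative - Gam (C (s, t)) (\<xi> (s, t)) (\<Phi> (s, t) v)) (at t within ?J)"
    if "s \<in> ?J" "t \<in> ?J" for s t v
    using bounded_linear.has_vector_derivative[OF bounded_bilinear.bounded_linear_left[OF bounded_bilinear_blinfun_apply] FS(5)[OF that], of v]
      Aap[of "(s, t)"] that by simp
  \<comment> \<open>The right-hand side of the equation is always skew, so the part of a solution
    outside \<open>so\<close> is constant. Hence \<Phi> and \<Psi> both preserve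
    \<open>so\<close>.\<close>
  have N: "\<Phi> (s, t) v - skw (\<Phi> (s, t) v) = v - skw v" if s: "s \<in> ?J" and t: "t \<in> ?J" for s t v
  proof -
    let ?N = "\<lambda>x. x - skw x"
    have bl: "bounded_linear ?N" by (intro bounded_linear_sub bounded_linear_ident bounded_linear_skw)
    have "((\<lambda>t. ?N (\<Phi> (s, t) v)) has_vector_derivative 0) (at t within ?J)" if t: "t \<in> ?J" for t
    proof -
      have "- Gam (C (s, t)) (\<xi> (s, t)) (\<Phi> (s, t) v) \<in> so" using C(2)[of "(s, t)"] s t by (intro so_closed Gam_so) auto
      then show ?thesis
        using bounded_linear.has_vector_derivative[OF bl Phv[OF s t, of v]] by (simp add: skw_id)
    qed
    from const_within_unit_interval[OF this t, of 0] show ?thesis using FS(3)[OF s] by simp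
  qed
  have Nso: "x \<in> so \<longleftrightarrow> x - skw x = 0" for x using skw_id[of x] skw_so[of x] by (metis eq_iff_diff_eq_0)
  have Phso: "\<Phi> (s, t) v \<in> so" "\<Psi> (s, t) v \<in> so" if "s \<in> ?J" "t \<in> ?J" "v \<in> so" for s t v
  proof -
    show "\<Phi> (s, t) v \<in> so" using N[OF that(1,2), of v] that(3) unfolding Nso by simp
    show "\<Psi> (s, t) v \<in> so" using N[OF that(1,2), of "\<Psi> (s, t) v"] that(3) unfolding Nso PsPh[OF that(1,2)] by simp
  qed
  have q': "q s t = C (s, 0) ** \<Psi> (s, t) (u (s, t))" if s: "s \<in> ?J" and t: "t \<in> ?J" for s t
  proof -
    have z: "(s, r) \<in> ?T" if "r \<in> ?J" for r using s that by auto
    have cSO: "c s r \<in> SO" if "r \<in> ?J" for r using C(2)[OF z[OF that]] by (simp add: C_def)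
    have tvel: "transpose (c s r) ** velocity (c s) r = \<xi> (s, r)" if "r \<in> ?J" for r
      unfolding vel[OF s that] using cSO[OF that] by (simp add: C_def SO_cancel)
    \<comment> \<open>The initial value for which the parallel field attains the given vector at
      \<open>t\<close>.\<close>
    define y where "y = \<Psi> (s, t) (u (s, t))"
    have y: "y \<in> so" unfolding y_def by (rule Phso(2)[OF s t u(2)[OF z[OF t]]])
    define V where "V r = c s r ** \<Phi> (s, r) y" for r
    have "smooth_on ?J (\<lambda>r. C (s, r) ** \<Phi> (s, r) y)"
      by (intro smooth_on_bilinear[OF bounded_bilinear_matrix_mult] smooth_on_bilinear[OF bounded_bilinear_blinfun_apply]
          smooth_on_const smooth_on_Pair_arg[OF C(1) z] smooth_on_Pair_arg[OF FS(1) z])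
    then have Vsm: "smooth_on ?J V" by (rule smooth_on_cong) (simp add: V_def C_def)
    have Vx: "transpose (c s r) ** V r = \<Phi> (s, r) y" if "r \<in> ?J" for r
      using cSO[OF that] by (simp add: V_def SO_cancel)
    have "parallel_field nab (c s) V"
      unfolding parallel_field_def
    proof (intro conjI ballI Vsm)
      fix r assume r: "r \<in> ?J"
      show "V r \<in> tangent_space (c s r)" unfolding V_def by (rule mult_tangent[OF Phso(1)[OF s r y]])
      have "velocity (\<lambda>r. transpose (c s r) ** V r) r = velocity (\<lambda>r. \<Phi> (s, r) y) r"
        by (rule velocity_cong[OF Vx r])
      also have "\<dots> = - Gam (c s r) (\<xi> (s, r)) (\<Phi> (s, r) y)"
        using velocity_eqI[OF Phv[OF s r] r] by (simp add: C_def)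
      finally have v: "velocity (\<lambda>r. transpose (c s r) ** V r) r = - Gam (c s r) (\<xi> (s, r)) (\<Phi> (s, r) y)" .
      have m: "transpose (c s r) ** V r \<in> so" "transpose (c s r) ** velocity (c s) r \<in> so"
        using Phso(1)[OF s r y] \<xi>(2)[OF z[OF r]] by (simp_all add: Vx[OF r] tvel[OF r])
      show "covariant_deriv nab (c s) V r = 0"
        using covariant_deriv_trivialised[where p="c s" and V=V and s=r, OF cSO[OF r] m] unfolding v
        by (simp add: tvel[OF r] Vx[OF r] mm_simps)
    qed
    moreover have "V t = C (s, t) ** u (s, t)" by (simp add: V_def C_def y_def PsPh[OF s t])
    moreover have "V 0 = C (s, 0) ** y" using FS(3)[OF s] by (simp add: V_def C_def)
    \<comment> \<open>Uniqueness, as the definite description demands: applying \<Psi> to the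
      coordinates of any parallel field gives a constant, which fixes the value at 0.\<close>
    moreover have "w = C (s, 0) ** y"
      if W: "parallel_field nab (c s) W" "W t = C (s, t) ** u (s, t)" "W 0 = w" for W w
    proof -
      define x where "x r = transpose (c s r) ** W r" for r
      have xso: "x r \<in> so" if "r \<in> ?J" for r
      proof -
        have "W r \<in> tangent_space (c s r)" using W(1) that unfolding parallel_field_def by blast
        then show ?thesis unfolding x_def by (simp only: tangent_space_iff[OF cSO[OF that]])
      qed
      have "smooth_on ?J (\<lambda>r. transpose (C (s, r)) ** W r)"
        using W(1) unfolding parallel_field_def
        by (intro smooth_on_bilinear[OF bounded_bilinear_matrix_mult] smooth_on_compose_linear[OF bounded_linear_transpose]
          smooth_on_Pair_arg[OF C(1) z]) auto
      then have xsm: "smooth_on ?J x" by (rule smooth_on_cong) (simp add: x_def C_def)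
      have xd: "(x has_vector_derivative A (s, r) (x r)) (at r within ?J)" if r: "r \<in> ?J" for r
      proof -
        have m: "transpose (c s r) ** W r \<in> so" "transpose (c s r) ** velocity (c s) r \<in> so"
          using xso[OF r] \<xi>(2)[OF z[OF r]] by (simp_all add: x_def tvel[OF r])
        have "covariant_deriv nab (c s) W r = 0" using W(1) r unfolding parallel_field_def by blast
        then have "c s r ** (velocity x r + Gam (c s r) (\<xi> (s, r)) (x r)) = 0"
          using covariant_deriv_trivialised[where p="c s" and V=W and s=r, OF cSO[OF r] m]
          unfolding tvel[OF r] by (simp add: x_def[abs_def])
        then have "transpose (c s r) ** (c s r ** (velocity x r + Gam (c s r) (\<xi> (s, r)) (x r))) = 0"
          by (simp add: mm_simps)
        then have "velocity x r = A (s, r) (x r)"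
          unfolding SO_cancel(1)[OF cSO[OF r]] Aap[OF z[OF r]] by (simp add: C_def add_eq_0_iff2)
        then show ?thesis using smooth_has_velocity[OF xsm r] by simp
      qed
      have "((\<lambda>r. \<Psi> (s, r) (x r)) has_vector_derivative 0) (at r within ?J)" if r: "r \<in> ?J" for r
        using bounded_bilinear.has_vector_derivative[OF bounded_bilinear_blinfun_apply FS(6)[OF s r] xd[OF r]]
        by (simp add: blinfun.minus_left)
      from const_within_unit_interval[OF this t, of 0]
      have "\<Psi> (s, t) (x t) = x 0" using FS(3)[OF s] by simp
      moreover have "x t = u (s, t)" unfolding x_def W(2) using cSO[OF t] by (simp add: C_def SO_cancel)
      ultimately have "x 0 = y" by (simp add: y_def)
      then have "c s 0 ** (transpose (c s 0) ** W 0) = c s 0 ** y" by (simp add: x_def)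
      then show ?thesis using cSO[of 0] W(3) by (simp add: SO_cancel C_def)
    qed
    ultimately have "parallel_transport nab (c s) t 0 (C (s, t) ** u (s, t)) = C (s, 0) ** y"
      unfolding parallel_transport_def by (intro the_equality) blast+
    then show ?thesis unfolding q srvf_def unit[OF s t] y_def .
  qed
  have C0: "smooth_on ?J (\<lambda>s. C (s, 0))"
  proof (rule smooth_on_compose[OF C(1)])
    show "smooth_on ?J (\<lambda>s. (s, 0::real))" by (intro smooth_on_Pair smooth_on_ident smooth_on_const)
  qed auto
  have psm: "smooth_on ?J p" by (rule smooth_on_cong[OF C0]) (simp add: p C_def)
  have pSO: "p s \<in> SO" if "s \<in> ?J" for s using C(2)[of "(s, 0)"] that by (simp add: p C_def)
  have "smooth_on ?T (\<lambda>z. C (fst z, 0))"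
    by (rule smooth_on_compose[OF C0 smooth_on_linear[OF bounded_linear_fst]]) auto
  then have "smooth_on ?T (\<lambda>z. C (fst z, 0) ** \<Psi> z (u z))"
    by (intro smooth_on_bilinear[OF bounded_bilinear_matrix_mult] smooth_on_bilinear[OF bounded_bilinear_blinfun_apply] FS(2) u(1))
  then have qsm: "smooth_on ?T (\<lambda>(s, t). q s t)" by (rule smooth_on_cong) (auto simp: q')
  have qt: "q s t \<in> tangent_space (p s)" if "s \<in> ?J" "t \<in> ?J" for s t
    unfolding q'[OF that] using mult_tangent[OF Phso(2)[OF that u(2)], of "(s, t)"] that by (simp add: p C_def)
  show "regular_pair p q" unfolding regular_pair_def using psm qsm pSO qt by blast
  \<comment> \<open>Transport is invertible, and the transported vector is a positive multiple of
    the velocity, which does not vanish.\<close>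
  show "q s t \<noteq> 0" if s: "s \<in> ?J" and t: "t \<in> ?J" for s t
  proof
    assume "q s t = 0"
    then have "transpose (C (s, 0)) ** (C (s, 0) ** \<Psi> (s, t) (u (s, t))) = 0" unfolding q'[OF s t] by (simp add: mm_simps)
    then have "\<Psi> (s, t) (u (s, t)) = 0" using C(2)[of "(s, 0)"] s by (simp add: SO_cancel)
    then have "u (s, t) = 0" using PsPh(2)[OF s t, of "u (s, t)"] by (simp add: blinfun.zero_right)
    then show False using u(3)[of "(s, t)"] s t by simp
  qed
qed

section \<open>The geodesic equations\<close>

lemma regular_pair_integrable:
  assumes "regular_pair p q" "s \<in> {0..1}"
  shows "continuous_on {0..1} (curvt p q s)" "curvt p q s integrable_on {0..1}"
proof -
  have "smooth_on {0..1} (\<lambda>t. case (s, t) of (s, t) \<Rightarrow> curvt p q s t)"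
    by (rule smooth_on_Pair_arg[OF regular_pair_terms(2)[OF assms(1)]]) (use assms in auto)
  then show c: "continuous_on {0..1} (curvt p q s)" by (auto dest: smooth_on_imp_continuous_on)
  then show "curvt p q s integrable_on {0..1}" by (rule integrable_continuous_real)
qed

lemma G_bounded_linear: "A \<in> SO \<Longrightarrow> bounded_linear (G A u)"
  using G_bilinear[of A] by (simp add: bilinear_def linear_conv_bounded_linear)

lemma integral_G_curvt:
  assumes r: "regular_pair p q" and s: "s \<in> {0..1}"
  shows "integral {0..1} (\<lambda>t. G (p s) x (accel p s + curvt p q s t)) = G (p s) x (accel p s + integral {0..1} (curvt p q s))"
proof -
  have ps: "p s \<in> SO" using r s by (auto simp: regular_pair_def)
  have i: "(\<lambda>t. accel p s + curvt p q s t) integrable_on {0..1}"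
    by (intro integrable_add integrable_const_ivl regular_pair_integrable(2)[OF r s])
  have "integral {0..1} (\<lambda>t. accel p s + curvt p q s t) = accel p s + integral {0..1} (curvt p q s)"
    using regular_pair_integrable(2)[OF r s] by (subst integral_add) (auto intro: integrable_const_ivl)
  with integral_linear[OF i G_bounded_linear[OF ps, of x]] show ?thesis by (simp add: o_def)
qed

lemma first_equation_trivialised:
  assumes r: "regular_pair p q" and s: "s \<in> {0..1}"
  shows "covariant_deriv nab p (velocity p) s
       + integral {0..1} (\<lambda>t. curvature nab (p s) (q s t) (covariant_deriv nab p (\<lambda>r. q r t) s) (velocity p s))
     = p s ** (accel p s + integral {0..1} (curvt p q s))"
proof -
  have ps: "p s \<in> SO" using r s by (auto simp: regular_pair_def)
  have "integral {0..1} (\<lambda>t. curvature nab (p s) (q s t) (covariant_deriv nab p (\<lambda>r. q r t) s) (velocity p s))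
      = integral {0..1} (\<lambda>t. p s ** curvt p q s t)"
    by (simp add: curvt_def SO_cancel ps)
  also have "\<dots> = p s ** integral {0..1} (curvt p q s)"
    using integral_linear[OF regular_pair_integrable(2)[OF r s] mm.bounded_linear_right] by (simp add: o_def)
  finally show ?thesis by (simp add: accel_def mm_simps SO_cancel ps)
qed

text \<open>The regularity of the pair is read off from the variation at hand. The first equation
  holds only after integration over \<open>t\<close>, which suffices because the variation of the
  base point does not depend on \<open>t\<close>.\<close>

lemma geodesic_if_equations:
  assumes E1: "\<And>s. s \<in> {0..1} \<Longrightarrow> covariant_deriv nab p (velocity p) s
       + integral {0..1} (\<lambda>t. curvature nab (p s) (q s t) (covariant_deriv nab p (\<lambda>r. q r t) s) (velocity p s)) = 0"
    and E2: "\<And>s t. s \<in> {0..1} \<Longrightarrow> t \<in> {0..1} \<Longrightarrow> covariant_deriv nab p (covariant_deriv nab p (\<lambda>r. q r t)) s = 0"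
  shows "geodesic g nab p q"
  unfolding geodesic_def
proof (intro allI impI)
  fix \<epsilon> P Q assume var: "variation p q \<epsilon> P Q"
  have r: "regular_pair p q" by (rule variation_regular[OF var])
  have Z: "accel p s + integral {0..1} (curvt p q s) = 0" if s: "s \<in> {0..1}" for s
  proof -
    have ps: "p s \<in> SO" using r s by (auto simp: regular_pair_def)
    have "p s ** (accel p s + integral {0..1} (curvt p q s)) = 0"
      using E1[OF s] first_equation_trivialised[OF r s] by simp
    then have "transpose (p s) ** (p s ** (accel p s + integral {0..1} (curvt p q s))) = 0" by (simp only: mm_simps)
    then show ?thesis by (simp only: SO_cancel(1)[OF ps])
  qed
  have "integral {0..1} (\<lambda>t. G (p s) x (accel p s + curvt p q s t) + G (p s) (\<zeta> t) (qacc p q s t)) = 0"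
    if s: "s \<in> {0..1}" for s x \<zeta>
  proof -
    have ps: "p s \<in> SO" using r s by (auto simp: regular_pair_def)
    have "integral {0..1} (\<lambda>t. G (p s) x (accel p s + curvt p q s t) + G (p s) (\<zeta> t) (qacc p q s t))
        = integral {0..1} (\<lambda>t. G (p s) x (accel p s + curvt p q s t))"
      by (rule integral_cong) (simp add: qacc_def E2[OF s] mm_simps G_simps ps)
    also have "\<dots> = 0" using integral_G_curvt[OF r s, of x] Z[OF s] by (simp add: G_simps ps)
    finally show ?thesis .
  qed
  note z = this
  have "integral {0..1} (\<lambda>s. integral {0..1} (\<lambda>t.
        G (p s) (base_field p P s) (accel p s + curvt p q s t) + G (p s) (srv_field p q P Q s t) (qacc p q s t))) = integral {0..1} (\<lambda>s::real. 0)"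
  proof (rule integral_cong)
    fix s :: real assume s: "s \<in> {0..1}"
    from z[OF s, of "base_field p P s" "srv_field p q P Q s"]
    show "integral {0..1} (\<lambda>t. G (p s) (base_field p P s) (accel p s + curvt p q s t) + G (p s) (srv_field p q P Q s t) (qacc p q s t)) = 0" .
  qed
  then show "((\<lambda>\<tau>. energy g nab (P \<tau>) (Q \<tau>)) has_real_derivative 0) (at 0)"
    using first_variation[OF var] by simp
qed

end

text \<open>The weight is positive only in the open interval; continuity carries the conclusion to
  the end points.\<close>

lemma vanishes_if_weighted_integral_0:
  fixes F :: "real \<Rightarrow> real"
  assumes c: "continuous_on {0..1} F" and "\<And>s. s \<in> {0..1} \<Longrightarrow> F s \<ge> 0"
    and "integral {0..1} (\<lambda>s. (s * (1 - s)) * F s) = 0" and s: "s \<in> {0..1}"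
  shows "F s = 0"
proof -
  have w: "\<forall>s\<in>{0..1}. (s * (1 - s)) * F s = 0"
  proof (rule integral_eq_0_iff[THEN iffD1])
    show "continuous_on {0..1} (\<lambda>s. (s * (1 - s)) * F s)" using c by (auto intro!: continuous_intros)
  qed (use assms in auto)
  have z: "F s = 0" if "s \<in> {0<..<1}" for s using bspec[OF w, of s] that by auto
  show ?thesis
    by (rule continuous_constant_on_closure[of "{0<..<1}" F 0]) (use c z s in auto)
qed

context riem_so
begin

lemma geodesic_imp_second_equation:
  assumes geo: "geodesic g nab p q" and r: "regular_pair p q" and q0: "\<And>s t. s \<in> {0..1} \<Longrightarrow> t \<in> {0..1} \<Longrightarrow> q s t \<noteq> 0"
    and s: "s \<in> {0..1}" and t: "t \<in> {0..1}"
  shows "qacc p q s t = 0"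
proof -
  let ?J = "{0..1::real}"
  note rr = r[unfolded regular_pair_def]
  note terms = regular_pair_terms[OF r]
  let ?\<chi> = "\<lambda>s::real. s * (1 - s)"
  \<comment> \<open>Keeping the base points fixed makes \<eta> zero, so the first variation contains
    only the second equation.\<close>
  define P where "P \<tau> s = p s" for \<tau> :: real and s
  define \<psi> where "\<psi> s t = p s ** qacc p q s t" for s t
  define Q where "Q \<tau> s t = q s t + (\<tau> * ?\<chi> s) *\<^sub>R \<psi> s t" for \<tau> s t
  have fs: "smooth_on (I \<times> ?J) (\<lambda>z. p (snd z))" for I :: "real set"
    by (rule smooth_on_compose[where T="?J" and f=p and h=snd]) (use rr in \<open>auto intro: smooth_on_linear[OF bounded_linear_snd]\<close>)
  have psm: "smooth_on (?J \<times> ?J) (\<lambda>z. p (fst z))"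
    by (rule smooth_on_compose[where T="?J" and f=p and h=fst]) (use rr in \<open>auto intro: smooth_on_linear[OF bounded_linear_fst]\<close>)
  have \<psi>sm: "smooth_on (?J \<times> ?J) (\<lambda>(s, t). \<psi> s t)"
    by (rule smooth_on_cong[OF smooth_on_bilinear[OF bounded_bilinear_matrix_mult psm terms(3)]]) (auto simp: \<psi>_def)
  have qc: "continuous_on (?J \<times> ?J) (\<lambda>(s, t). q s t)" using rr smooth_on_imp_continuous_on by blast
  have comp: "compact (?J \<times> ?J)" by (intro compact_Times compact_Icc)
  have "bounded ((\<lambda>(s, t). \<psi> s t) ` (?J \<times> ?J))"
    by (intro compact_imp_bounded compact_continuous_image comp smooth_on_imp_continuous_on \<psi>sm)
  then obtain M where M0: "M > 0" and M: "\<And>s t. s \<in> ?J \<Longrightarrow> t \<in> ?J \<Longrightarrow> norm (\<psi> s t) \<le> M"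
    unfolding bounded_pos by auto
  obtain z0 where z0: "z0 \<in> ?J \<times> ?J" "\<And>z. z \<in> ?J \<times> ?J \<Longrightarrow> norm (case z0 of (s, t) \<Rightarrow> q s t) \<le> norm (case z of (s, t) \<Rightarrow> q s t)"
    using continuous_attains_inf[OF comp _ continuous_on_norm[OF qc]] by auto
  define m where "m = norm (case z0 of (s, t) \<Rightarrow> q s t)"
  have m0: "m > 0" using z0(1) q0 by (auto simp: m_def)
  have m: "m \<le> norm (q s t)" if "s \<in> ?J" "t \<in> ?J" for s t using z0(2)[of "(s, t)"] that by (simp add: m_def)
  \<comment> \<open>\<open>m\<close> bounds the norm of \<open>q\<close> from below and
    \<open>M\<close> that of \<psi> from above on the compact square, and the weight is at most 1.
    For \<bar>\<tau>\<bar> < \<epsilon> the perturbation is smaller than \<open>q\<close>, so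
    \<open>Q\<close> has no zeros.\<close>
  define \<epsilon> where "\<epsilon> = m / M"
  have e0: "\<epsilon> > 0" using m0 M0 by (simp add: \<epsilon>_def)
  let ?I = "{-\<epsilon><..<\<epsilon>}"
  have tan: "Q \<tau> s t \<in> tangent_space (p s)" if "s \<in> ?J" "t \<in> ?J" for \<tau> s t
  proof -
    have ps: "p s \<in> SO" using rr that by blast
    have "transpose (p s) ** q s t \<in> so" using rr that by (auto simp: tangent_space_iff[OF ps, symmetric])
    then show ?thesis using terms(6)[OF that]
      by (simp add: Q_def \<psi>_def tangent_space_iff[OF ps] mm_simps SO_cancel[OF ps] so_closed)
  qed
  have nz: "Q \<tau> s t \<noteq> 0" if \<tau>: "\<tau> \<in> ?I" and st: "s \<in> ?J" "t \<in> ?J" for \<tau> s t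
  proof
    assume "Q \<tau> s t = 0"
    then have "q s t = - ((\<tau> * ?\<chi> s) *\<^sub>R \<psi> s t)" by (simp add: Q_def eq_neg_iff_add_eq_0)
    then have "norm (q s t) = \<bar>\<tau>\<bar> * (\<bar>?\<chi> s\<bar> * norm (\<psi> s t))" by (simp add: abs_mult)
    also have "\<dots> \<le> \<bar>\<tau>\<bar> * (1 * M)"
      using st M[OF st] by (intro mult_left_mono mult_mono) (auto simp: abs_mult intro: mult_le_one)
    also have "\<dots> < \<epsilon> * M" using \<tau> M0 by auto
    also have "\<dots> = m" using M0 by (simp add: \<epsilon>_def)
    finally show False using m[OF st] by simp
  qed
  have var: "variation p q \<epsilon> P Q"
    unfolding variation_def
  proof (intro conjI ballI)
    show "smooth_on (?I \<times> ?J) (\<lambda>(\<tau>, s). P \<tau> s)"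
      using fs[of ?I] by (simp add: P_def case_prod_beta')
    let ?X = "?I \<times> ?J \<times> ?J"
    have l: "smooth_on ?X (\<lambda>z. snd z)" "smooth_on ?X (\<lambda>z. fst z)" "smooth_on ?X (\<lambda>z. fst (snd z))"
      by (intro smooth_on_linear bounded_linear_snd bounded_linear_fst bounded_linear_fst_comp)+
    have 1: "smooth_on ?X (\<lambda>z. case snd z of (s, t) \<Rightarrow> q s t)"
      by (rule smooth_on_compose[OF _ l(1)]) (use rr in auto)
    have 2: "smooth_on ?X (\<lambda>z. case snd z of (s, t) \<Rightarrow> \<psi> s t)"
      by (rule smooth_on_compose[OF \<psi>sm l(1)]) auto
    have "smooth_on ?X (\<lambda>z. (case snd z of (s, t) \<Rightarrow> q s t) + (fst z * ?\<chi> (fst (snd z))) *\<^sub>R (case snd z of (s, t) \<Rightarrow> \<psi> s t))"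
      by (intro smooth_on_add smooth_on_scaleR smooth_on_mult smooth_on_diff smooth_on_const 1 2 l)
    then show "smooth_on ?X (\<lambda>(\<tau>, s, t). Q \<tau> s t)" by (rule smooth_on_cong) (auto simp: Q_def)
  next
    fix \<tau> s assume "\<tau> \<in> ?I" "s \<in> {0, 1::real}"
    then show "P \<tau> s = p s" "\<And>t. Q \<tau> s t = q s t" by (auto simp: P_def Q_def)
  qed (use e0 rr tan nz in \<open>auto simp: P_def\<close>, auto simp: Q_def)
  have D0: "((\<lambda>\<tau>. energy g nab (P \<tau>) (Q \<tau>)) has_real_derivative 0) (at 0)"
    using geo var unfolding geodesic_def by blast
  have eta: "base_field p P s = 0" for s
    by (simp add: base_field_def P_def mm_simps)
  have zeta: "srv_field p q P Q s t = ?\<chi> s *\<^sub>R qacc p q s t"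
    if "s \<in> ?J" for s t
  proof -
    have ps: "p s \<in> SO" using rr that by blast
    have "(\<lambda>\<tau>. transpose (P \<tau> s) ** Q \<tau> s t) = (\<lambda>\<tau>. transpose (p s) ** q s t + (\<tau> * ?\<chi> s) *\<^sub>R qacc p q s t)"
      by (simp add: P_def Q_def \<psi>_def mm_simps SO_cancel[OF ps])
    moreover have "((\<lambda>\<tau>. transpose (p s) ** q s t + (\<tau> * ?\<chi> s) *\<^sub>R qacc p q s t) has_vector_derivative ?\<chi> s *\<^sub>R qacc p q s t) (at 0)"
      unfolding has_vector_derivative_def by (auto intro!: derivative_eq_intros)
    ultimately show ?thesis by (simp add: srv_field_def eta Gam_simps[OF ps] vector_derivative_at)
  qed
  define F where "F s = integral ?J (\<lambda>t. G (p s) (qacc p q s t) (qacc p q s t))" for s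
  have Gsm: "smooth_on (?J \<times> ?J) (\<lambda>z. G (p (fst z)) (case z of (s, t) \<Rightarrow> qacc p q s t) (case z of (s, t) \<Rightarrow> qacc p q s t))"
    by (rule bilin_field_smooth[OF bilin_field_G psm _ terms(3) terms(3)]) (use rr in auto)
  have Fc: "continuous_on ?J F"
    using smooth_on_imp_continuous_on[OF smooth_on_integral01(1)[OF Gsm]] by (simp add: F_def[abs_def])
  have Gn: "G (p s) (qacc p q s t) (qacc p q s t) \<ge> 0" if "s \<in> ?J" "t \<in> ?J" for s t
    using G_nonneg[OF _ terms(6)[OF that]] rr that by blast
  have Gc: "continuous_on ?J (\<lambda>t. G (p s) (qacc p q s t) (qacc p q s t))" if "s \<in> ?J" for s
    using smooth_on_imp_continuous_on[OF smooth_on_Pair_arg[OF Gsm, of ?J s]] that by simp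
  have Fn: "F s \<ge> 0" if "s \<in> ?J" for s
    unfolding F_def by (rule integral_nonneg[OF integrable_continuous_real[OF Gc[OF that]]]) (rule Gn[OF that])
  have "integral ?J (\<lambda>s. integral ?J (\<lambda>t. G (p s) (base_field p P s) (accel p s + curvt p q s t)
      + G (p s) (srv_field p q P Q s t) (qacc p q s t))) =
     integral ?J (\<lambda>s. ?\<chi> s * F s)"
  proof (rule integral_cong)
    fix s assume s: "s \<in> ?J"
    have ps: "p s \<in> SO" using rr s by blast
    show "integral ?J (\<lambda>t. G (p s) (base_field p P s) (accel p s + curvt p q s t)
      + G (p s) (srv_field p q P Q s t) (qacc p q s t)) = ?\<chi> s * F s"
      unfolding eta zeta[OF s] F_def by (simp add: G_simps[OF ps])
  qed
  with first_variation[OF var] have "((\<lambda>\<tau>. energy g nab (P \<tau>) (Q \<tau>)) has_real_derivative - integral ?J (\<lambda>s. ?\<chi> s * F s)) (at 0)"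
    by simp
  from DERIV_unique[OF this D0] have "integral ?J (\<lambda>s. ?\<chi> s * F s) = 0" by simp
  \<comment> \<open>Positivity is exploited twice: the weighted integral over \<open>s\<close>
    forces the inner integral to vanish, and this forces its integrand to vanish for each
    \<open>t\<close>.\<close>
  from vanishes_if_weighted_integral_0[OF Fc Fn this s] have "integral ?J (\<lambda>t. G (p s) (qacc p q s t) (qacc p q s t)) = 0"
    by (simp add: F_def)
  then have "\<forall>t\<in>{0..1}. G (p s) (qacc p q s t) (qacc p q s t) = 0"
    using integral_eq_0_iff[of 0 1 "\<lambda>t. G (p s) (qacc p q s t) (qacc p q s t)"] Gc[OF s] Gn[OF s] by simp
  then have "G (p s) (qacc p q s t) (qacc p q s t) = 0" using t by auto
  then show ?thesis using G_eq_0[OF _ terms(6)[OF s t], of "p s"] rr s by auto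
qed

text \<open>It suffices to test against the generators of plane rotations: they span the Lie
  algebra, and each has an explicit one-parameter group inside \<open>SO\<close>.\<close>

lemma geodesic_imp_first_equation:
  assumes geo: "geodesic g nab p q" and r: "regular_pair p q" and q0: "\<And>s t. s \<in> {0..1} \<Longrightarrow> t \<in> {0..1} \<Longrightarrow> q s t \<noteq> 0"
    and E2: "\<And>s t. s \<in> {0..1} \<Longrightarrow> t \<in> {0..1} \<Longrightarrow> qacc p q s t = 0" and s: "s \<in> {0..1}"
  shows "accel p s + integral {0..1} (curvt p q s) = 0"
proof -
  let ?J = "{0..1::real}"
  note rr = r[unfolded regular_pair_def]
  note terms = regular_pair_terms[OF r]
  let ?\<chi> = "\<lambda>s::real. s * (1 - s)"
  define Z where "Z s = accel p s + integral ?J (curvt p q s)" for s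
  have Zsm: "smooth_on ?J Z"
    using smooth_on_add[OF terms(1) smooth_on_integral01(1)[OF terms(2)]] by (simp add: Z_def[abs_def])
  have "G (p s) (gen i j) (Z s) = 0" if s: "s \<in> ?J" for s i j
  proof -
    define B :: "'n sqmat" where "B = gen i j"
    have B: "B \<in> so" "B ** B ** B = - B" by (simp_all add: B_def gen_so gen_cube)
    \<comment> \<open>With \<open>F\<close> itself as amplitude of the rotation, the first variation
      becomes minus the weighted integral of the square of \<open>F\<close>.\<close>
    define F where "F s = G (p s) B (Z s)" for s
    have Fsm: "smooth_on ?J F"
      unfolding F_def[abs_def] by (rule bilin_field_smooth[OF bilin_field_G _ _ smooth_on_const Zsm]) (use rr in auto)
    define P where "P \<tau> s = p s ** rot B (\<tau> * (?\<chi> s * F s))" for \<tau> s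
    \<comment> \<open>The square root velocity is carried along by left translation: its trivialised
      value does not change with \<tau>, so tangency and the absence of zeros persist for every
      \<tau>, and 1 serves as \<epsilon>.\<close>
    define Q where "Q \<tau> s t = P \<tau> s ** (transpose (p s) ** q s t)" for \<tau> s t
    have PSO: "P \<tau> s \<in> SO" if "s \<in> ?J" for \<tau> s
      unfolding P_def using rr that by (intro SO_mult rot_SO B) auto
    let ?I = "{-1<..<1::real}"
    have var: "variation p q 1 P Q"
      unfolding variation_def
    proof (intro conjI ballI)
      have P: "smooth_on X (\<lambda>z. P (a z) (b z))"
        if a: "smooth_on X a" and b: "smooth_on X b" and bX: "\<And>z. z \<in> X \<Longrightarrow> b z \<in> ?J"
        for X :: "'a::euclidean_space set" and a b
      proof -
        have pb: "smooth_on X (\<lambda>z. p (b z))" "smooth_on X (\<lambda>z. F (b z))"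
          using smooth_on_compose[OF _ b bX] rr Fsm by blast+
        show ?thesis unfolding P_def
          by (intro smooth_on_bilinear[OF bounded_bilinear_matrix_mult] smooth_on_rot smooth_on_mult smooth_on_diff
              smooth_on_const a b pb)
      qed
      show "smooth_on (?I \<times> ?J) (\<lambda>(\<tau>, s). P \<tau> s)"
      proof -
        have "smooth_on (?I \<times> ?J) (\<lambda>z. P (fst z) (snd z))"
          by (rule P[OF smooth_on_linear[OF bounded_linear_fst] smooth_on_linear[OF bounded_linear_snd]]) auto
        then show ?thesis by (simp add: case_prod_beta')
      qed
      let ?X = "?I \<times> ?J \<times> ?J"
      have l: "smooth_on ?X (\<lambda>z. snd z)" "smooth_on ?X (\<lambda>z. fst z)" "smooth_on ?X (\<lambda>z. fst (snd z))"
        by (intro smooth_on_linear bounded_linear_snd bounded_linear_fst bounded_linear_fst_comp)+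
      have 1: "smooth_on ?X (\<lambda>z. case snd z of (s, t) \<Rightarrow> q s t)"
        by (rule smooth_on_compose[OF _ l(1)]) (use rr in auto)
      have 2: "smooth_on ?X (\<lambda>z. P (fst z) (fst (snd z)))" by (rule P[OF l(2,3)]) auto
      have 3: "smooth_on ?X (\<lambda>z. p (fst (snd z)))" by (rule smooth_on_compose[OF _ l(3)]) (use rr in auto)
      have "smooth_on ?X (\<lambda>z. P (fst z) (fst (snd z)) ** (transpose (p (fst (snd z))) ** (case snd z of (s, t) \<Rightarrow> q s t)))"
        by (intro smooth_on_bilinear[OF bounded_bilinear_matrix_mult] smooth_on_compose_linear[OF bounded_linear_transpose] 1 2 3)
      then show "smooth_on ?X (\<lambda>(\<tau>, s, t). Q \<tau> s t)" by (rule smooth_on_cong) (auto simp: Q_def)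
    next
      fix \<tau> s assume "\<tau> \<in> ?I" and s: "s \<in> {0, 1::real}"
      then have ps: "p s \<in> SO" using rr by auto
      show "P \<tau> s = p s" "\<And>t. Q \<tau> s t = q s t" using s ps by (auto simp: P_def Q_def SO_cancel)
    next
      fix \<tau> s t assume "\<tau> \<in> ?I" and s: "s \<in> ?J" and t: "t \<in> ?J"
      have ps: "p s \<in> SO" using rr s by blast
      have v: "transpose (p s) ** q s t \<in> so" using rr s t by (auto simp: tangent_space_iff[OF ps, symmetric])
      then show "Q \<tau> s t \<in> tangent_space (P \<tau> s)" unfolding Q_def by (rule mult_tangent)
      show "Q \<tau> s t \<noteq> 0"
      proof
        assume "Q \<tau> s t = 0"
        then have "transpose (P \<tau> s) ** (P \<tau> s ** (transpose (p s) ** q s t)) = 0" by (simp add: Q_def mm_simps)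
        then have "p s ** (transpose (p s) ** q s t) = 0" by (simp add: SO_cancel[OF PSO[OF s]] mm_simps)
        then show False using q0[OF s t] by (simp add: SO_cancel[OF ps])
      qed
    next
      fix s assume s: "s \<in> ?J"
      then have ps: "p s \<in> SO" using rr by auto
      show "P 0 s = p s" "\<And>t. Q 0 s t = q s t" using ps by (auto simp: P_def Q_def SO_cancel)
    qed (use PSO in auto)
    have D0: "((\<lambda>\<tau>. energy g nab (P \<tau>) (Q \<tau>)) has_real_derivative 0) (at 0)"
      using geo var unfolding geodesic_def by blast
    have eta: "base_field p P s = (?\<chi> s * F s) *\<^sub>R B" if "s \<in> ?J" for s
    proof -
      have ps: "p s \<in> SO" using rr that by blast
      have "((\<lambda>\<tau>. rot B (\<tau> * (?\<chi> s * F s))) has_vector_derivative (?\<chi> s * F s) *\<^sub>R B) (at 0)"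
        unfolding rot_def has_vector_derivative_def by (auto intro!: derivative_eq_intros)
      from bounded_linear.has_vector_derivative[OF mm.bounded_linear_right this, of "p s"]
      have "vector_derivative (\<lambda>\<tau>. P \<tau> s) (at 0) = p s ** ((?\<chi> s * F s) *\<^sub>R B)"
        unfolding P_def by (rule vector_derivative_at)
      then show ?thesis by (simp only: base_field_def SO_cancel[OF ps])
    qed
    have "integral ?J (\<lambda>s. integral ?J (\<lambda>t. G (p s) (base_field p P s) (accel p s + curvt p q s t)
        + G (p s) (srv_field p q P Q s t) (qacc p q s t))) =
       integral ?J (\<lambda>s. ?\<chi> s * (F s)\<^sup>2)"
    proof (rule integral_cong)
      fix s assume s: "s \<in> ?J"
      have ps: "p s \<in> SO" using rr s by blast
      \<comment> \<open>The second equation, known by now, eliminates \<open>srv_field\<close>,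
        whose value for this variation is never computed.\<close>
      have "integral ?J (\<lambda>t. G (p s) (base_field p P s) (accel p s + curvt p q s t)
        + G (p s) (srv_field p q P Q s t) (qacc p q s t))
        = integral ?J (\<lambda>t. G (p s) ((?\<chi> s * F s) *\<^sub>R B) (accel p s + curvt p q s t))"
        by (rule integral_cong) (simp add: E2[OF s] eta[OF s] G_simps(10)[OF ps])
      also have "\<dots> = ?\<chi> s * (F s)\<^sup>2"
        unfolding integral_G_curvt[OF r s] Z_def[symmetric] by (simp add: G_simps(5)[OF ps] F_def power2_eq_square)
      finally show "integral ?J (\<lambda>t. G (p s) (base_field p P s) (accel p s + curvt p q s t)
        + G (p s) (srv_field p q P Q s t) (qacc p q s t))
        = ?\<chi> s * (F s)\<^sup>2" .
    qed
    with first_variation[OF var] have "((\<lambda>\<tau>. energy g nab (P \<tau>) (Q \<tau>)) has_real_derivative - integral ?J (\<lambda>s. ?\<chi> s * (F s)\<^sup>2)) (at 0)"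
      by simp
    from DERIV_unique[OF this D0] have i0: "integral ?J (\<lambda>s. ?\<chi> s * (F s)\<^sup>2) = 0" by simp
    have "continuous_on ?J (\<lambda>s. (F s)\<^sup>2)" by (intro continuous_on_power smooth_on_imp_continuous_on Fsm)
    then have "(F s)\<^sup>2 = 0" by (rule vanishes_if_weighted_integral_0[OF _ _ i0 s]) simp
    then show ?thesis by (simp add: F_def B_def)
  qed
  then have g0: "G (p s) (gen i j) (Z s) = 0" for i j using s by blast
  have ps: "p s \<in> SO" using rr s by blast
  have Zso: "Z s \<in> so"
  proof -
    have "skw (Z s) = Z s"
    proof -
      have "skw (integral ?J (curvt p q s)) = integral ?J (\<lambda>t. skw (curvt p q s t))"
        using integral_linear[OF regular_pair_integrable(2)[OF r s] bounded_linear_skw] by (simp add: o_def)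
      also have "\<dots> = integral ?J (curvt p q s)"
        by (rule integral_cong) (simp add: skw_id terms(5)[OF s])
      finally show ?thesis by (simp add: Z_def skw_add skw_id terms(4)[OF s])
    qed
    then show ?thesis using skw_so by metis
  qed
  define L where "L x = G (p s) x (Z s)" for x
  have l: "linear L" using G_bilinear[OF ps] by (simp add: bilinear_def L_def[abs_def])
  have "L (gen i j) = 0" for i j using g0 by (simp add: L_def)
  \<comment> \<open>\<open>Z s\<close> is itself a combination of generators, so it is orthogonal to
    itself, and the metric is positive definite.\<close>
  then have "L (Z s) = 0"
    by (subst so_sum_gen[OF Zso]) (simp add: linear_cmul[OF l] linear_sum[OF l])
  then have "G (p s) (Z s) (Z s) = 0" by (simp add: L_def)
  then show ?thesis using G_eq_0[OF ps Zso] by (simp add: Z_def)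
qed

end

theorem theorem7:
  fixes g :: "('n::finite) metric_tensor"
    and nab :: "'n connection"
    and c :: "real \<Rightarrow> real \<Rightarrow> 'n sqmat"
    and p :: "real \<Rightarrow> 'n sqmat"
    and q :: "real \<Rightarrow> real \<Rightarrow> 'n sqmat"
  assumes "riemannian_metric g"
    and "levi_civita g nab"
    and "path_of_curves c"
    and "p = (\<lambda>s. c s 0)"
    and "q = (\<lambda>s t. srvf g nab (c s) t)"
  shows "geodesic g nab p q \<longleftrightarrow>
    (\<forall>s\<in>{0..1}.
       covariant_deriv nab p (velocity p) s
       + integral {0..1} (\<lambda>t. curvature nab (p s) (q s t)
           (covariant_deriv nab p (\<lambda>r. q r t) s) (velocity p s)) = 0) \<and>
    (\<forall>s\<in>{0..1}. \<forall>t\<in>{0..1}.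
       covariant_deriv nab p (covariant_deriv nab p (\<lambda>r. q r t)) s = 0)"
    (is "_ \<longleftrightarrow> ?E1 \<and> ?E2")
proof -
  interpret riem_so g nab by (rule riem_so.intro[OF assms(1,2)])
  have r: "regular_pair p q" and q0: "\<And>s t. s \<in> {0..1} \<Longrightarrow> t \<in> {0..1} \<Longrightarrow> q s t \<noteq> 0"
    using srvf_regular[OF assms(3-5)] by auto
  have SO: "p s \<in> SO" if "s \<in> {0..1}" for s using r that by (auto simp: regular_pair_def)
  show ?thesis
  proof
    assume geo: "geodesic g nab p q"
    have 2: "qacc p q s t = 0" if "s \<in> {0..1}" "t \<in> {0..1}" for s t
      by (rule geodesic_imp_second_equation[OF geo r q0 that])
    have 1: "accel p s + integral {0..1} (curvt p q s) = 0" if "s \<in> {0..1}" for s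
      by (rule geodesic_imp_first_equation[OF geo r q0 2 that])
    have ?E1 using first_equation_trivialised[OF r] 1 by (simp add: mm_simps)
    moreover have ?E2
    proof (intro ballI)
      fix s t :: real assume st: "s \<in> {0..1}" "t \<in> {0..1}"
      have "covariant_deriv nab p (covariant_deriv nab p (\<lambda>r. q r t)) s = p s ** qacc p q s t"
        by (simp add: qacc_def SO_cancel[OF SO[OF st(1)]])
      then show "covariant_deriv nab p (covariant_deriv nab p (\<lambda>r. q r t)) s = 0" by (simp add: 2[OF st] mm_simps)
    qed
    ultimately show "?E1 \<and> ?E2" ..
  next
    assume "?E1 \<and> ?E2"
    then show "geodesic g nab p q" by (intro geodesic_if_equations) blast+
  qed
qed

end
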